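(* For any fixed positive integer $d$, there is a randomized algorithm that, given any positive integer $n$, any integer weight functions $w^1,\dots,w^d$ on $N=\{(i,j):1\le i,j\le n\}$, and any function $f:\mathbb{R}^d\to\mathbb{R}$ presented by a comparison oracle, solves the nonlinear bipartite matching problem of finding a perfect matching $M\subset N$ of $K_{n,n}$ maximizing (or minimizing) $f(w^1(M),\dots,w^d(M))$ over all perfect matchings, in oracle-time which is polynomial in $n$ and $\max_{i,j,k}|w^k_{i,j}|$.
   Context: $N=\{(i,j):1\le i,j\le n\}$ is the edge set of the complete bipartite graph $K_{n,n}$. For a weight function $w^k:N\to\mathbb{Z}$ write $w^k_{i,j}=w^k(i,j)$, and for $M\subseteq N$ let $w^k(M):=\sum\{w^k(i,j):(i,j)\in M\}$. A comparison oracle for $f:\mathbb{R}^d\to\mathbb{R}$ is an oracle that, queried on $y,z\in\mathbb{Z}^d$, asserts whether or not $f(y)\le f(z)$. Oracle-time means the running time plus the number of oracle queries. A randomized algorithm that solves the nonlinear bipartite matching problem is an algorithm that has access to a random bit generator and, on any input to the problem, outputs a perfect matching which is optimal with probability at least $\frac12$; its running time includes a count of the number of random bits used. *)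

theory Defs
  imports
    "HOL-Probability.Probability"
    "HOL-Library.Log_Nat"
    "HOL-Computational_Algebra.Polynomial"
begin

section \<open>The nonlinear bipartite matching problem\<close>

definition edges :: "nat \<Rightarrow> (nat \<times> nat) set" where
  "edges n = {1..n} \<times> {1..n}"

text \<open>The two conditions range over the left and the right vertices of \<open>K\<^sub>n\<^sub>,\<^sub>n\<close>: each is covered by
  exactly one edge of \<open>M\<close>.\<close>

definition perfect_matching :: "nat \<Rightarrow> (nat \<times> nat) set \<Rightarrow> bool" where
  "perfect_matching n M \<longleftrightarrow> M \<subseteq> edges n
     \<and> (\<forall>i\<in>{1..n}. \<exists>!j. (i, j) \<in> M) \<and> (\<forall>j\<in>{1..n}. \<exists>!i. (i, j) \<in> M)"

text \<open>\<open>w k (i, j)\<close> is the weight \<open>w\<^sup>k\<^sub>i\<^sub>,\<^sub>j\<close>. Only \<open>1 \<le> k \<le> d\<close> and \<open>(i, j) \<in> edges n\<close> are relevant.\<close>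

type_synonym weights = "nat \<Rightarrow> nat \<times> nat \<Rightarrow> int"

text \<open>Points of \<open>\<real>\<^sup>d\<close> and \<open>\<int>\<^sup>d\<close> are lists of length \<open>d\<close>; the values of \<open>f\<close> on lists of
  other lengths are never used.\<close>

definition weight_vector :: "nat \<Rightarrow> weights \<Rightarrow> (nat \<times> nat) set \<Rightarrow> int list" where
  "weight_vector d w M = map (\<lambda>k. \<Sum>e\<in>M. w k e) [1..<Suc d]"

definition objective :: "nat \<Rightarrow> weights \<Rightarrow> (real list \<Rightarrow> real) \<Rightarrow> (nat \<times> nat) set \<Rightarrow> real" where
  "objective d w f M = f (map real_of_int (weight_vector d w M))"

definition maximizer :: "nat \<Rightarrow> nat \<Rightarrow> weights \<Rightarrow> (real list \<Rightarrow> real) \<Rightarrow> (nat \<times> nat) set \<Rightarrow> bool" where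
  "maximizer d n w f = is_arg_max (objective d w f) (perfect_matching n)"

definition minimizer :: "nat \<Rightarrow> nat \<Rightarrow> weights \<Rightarrow> (real list \<Rightarrow> real) \<Rightarrow> (nat \<times> nat) set \<Rightarrow> bool" where
  "minimizer d n w f = is_arg_min (objective d w f) (perfect_matching n)"

definition max_weight :: "nat \<Rightarrow> nat \<Rightarrow> weights \<Rightarrow> nat" where
  "max_weight d n w = Max {nat \<bar>w k e\<bar> | k e. k \<in> {1..d} \<and> e \<in> edges n}"

type_synonym comparison_oracle = "int list \<Rightarrow> int list \<Rightarrow> bool"

definition comparison_oracle :: "(real list \<Rightarrow> real) \<Rightarrow> comparison_oracle" where
  "comparison_oracle f y z \<longleftrightarrow> f (map real_of_int y) \<le> f (map real_of_int z)"

section \<open>Randomized oracle programs\<close>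

text \<open>The machine model is a structured random access machine under the logarithmic cost
  criterion, extended by an instruction that draws a random bit and an instruction that queries
  the comparison oracle. The memory consists of named integer arrays; a program mentions only
  finitely many names. \<open>Elem x i\<close> denotes \<open>x[i]\<close>, and \<open>Assign x i a\<close> denotes
  \<open>x[i] := a\<close>. \<open>Flip x\<close> writes a random bit to \<open>x[0]\<close>.
  \<open>Query x y z\<close> submits the vectors \<open>(y[0], \<dots>, y[d - 1])\<close> and
  \<open>(z[0], \<dots>, z[d - 1])\<close> to the oracle and writes the answer, as 0 or 1, to \<open>x[0]\<close>;
  this is the only access a program has to \<open>f\<close>.\<close>

datatype aexp =
    Num int
  | Elem string aexp
  | Plus aexp aexp
  | Minus aexp aexp
  | Times aexp aexp
  | Div aexp aexp
  | Mod aexp aexp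

datatype bexp =
    Less aexp aexp
  | Equal aexp aexp
  | Neg bexp
  | Conj bexp bexp

datatype com =
    Skip
  | Assign string aexp aexp
  | Flip string
  | Query string string string
  | Seq com com
  | If bexp com com
  | While bexp com

type_synonym store = "string \<Rightarrow> int \<Rightarrow> int"

primrec aval :: "store \<Rightarrow> aexp \<Rightarrow> int" where
  "aval s (Num k) = k"
| "aval s (Elem x i) = s x (aval s i)"
| "aval s (Plus a b) = aval s a + aval s b"
| "aval s (Minus a b) = aval s a - aval s b"
| "aval s (Times a b) = aval s a * aval s b"
| "aval s (Div a b) = aval s a div aval s b"
| "aval s (Mod a b) = aval s a mod aval s b"

primrec bval :: "store \<Rightarrow> bexp \<Rightarrow> bool" where
  "bval s (Less a b) \<longleftrightarrow> aval s a < aval s b"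
| "bval s (Equal a b) \<longleftrightarrow> aval s a = aval s b"
| "bval s (Neg b) \<longleftrightarrow> \<not> bval s b"
| "bval s (Conj a b) \<longleftrightarrow> bval s a \<and> bval s b"

text \<open>The binary length of an integer, including one bit for the sign.\<close>

definition int_size :: "int \<Rightarrow> nat" where
  "int_size k = 1 + nat (bitlen \<bar>k\<bar>)"

text \<open>Every operation is charged for the binary lengths of the integers it handles, including
  addresses; multiplication and division are charged as in the schoolbook algorithms. A unit charge
  per operation would be unsound, because repeated squaring produces integers of exponential
  length.\<close>

primrec acost :: "store \<Rightarrow> aexp \<Rightarrow> nat" where
  "acost s (Num k) = int_size k"
| "acost s (Elem x i) = acost s i + int_size (aval s i) + int_size (s x (aval s i))"
| "acost s (Plus a b) = acost s a + acost s b + int_size (aval s a) + int_size (aval s b)"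
| "acost s (Minus a b) = acost s a + acost s b + int_size (aval s a) + int_size (aval s b)"
| "acost s (Times a b) = acost s a + acost s b + int_size (aval s a) * int_size (aval s b)"
| "acost s (Div a b) = acost s a + acost s b + int_size (aval s a) * int_size (aval s b)"
| "acost s (Mod a b) = acost s a + acost s b + int_size (aval s a) * int_size (aval s b)"

primrec bcost :: "store \<Rightarrow> bexp \<Rightarrow> nat" where
  "bcost s (Less a b) = acost s a + acost s b + int_size (aval s a) + int_size (aval s b)"
| "bcost s (Equal a b) = acost s a + acost s b + int_size (aval s a) + int_size (aval s b)"
| "bcost s (Neg b) = 1 + bcost s b"
| "bcost s (Conj a b) = 1 + bcost s a + bcost s b"

definition vector_at :: "nat \<Rightarrow> store \<Rightarrow> string \<Rightarrow> int list" where
  "vector_at d s x = map (\<lambda>k. s x (int k)) [0..<d]"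

text \<open>\<open>exec d orc c (s, r) t (s', r')\<close>: started in store \<open>s\<close> with the sequence \<open>r\<close> of random
  bits, \<open>c\<close> halts after oracle-time \<open>t\<close> in store \<open>s'\<close>, and \<open>r'\<close> are the bits left unread.
  Since each random bit and each oracle query is charged at least one unit, \<open>t\<close> accounts for
  random bits and for queries. A query is also charged for the length of the two vectors
  submitted.\<close>

inductive exec ::
  "nat \<Rightarrow> comparison_oracle \<Rightarrow> com \<Rightarrow> store \<times> bool stream \<Rightarrow> nat \<Rightarrow> store \<times> bool stream \<Rightarrow> bool"
  for d :: nat and orc :: comparison_oracle
where
  exec_Skip: "exec d orc Skip (s, r) 1 (s, r)"
| exec_Assign:
    "exec d orc (Assign x i a) (s, r)
       (1 + acost s i + acost s a + int_size (aval s i) + int_size (aval s a))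
       (s(x := (s x)(aval s i := aval s a)), r)"
| exec_Flip:
    "exec d orc (Flip x) (s, r) 1 (s(x := (s x)(0 := of_bool (shd r))), stl r)"
| exec_Query:
    "exec d orc (Query x y z) (s, r)
       (1 + (\<Sum>k\<leftarrow>vector_at d s y. int_size k) + (\<Sum>k\<leftarrow>vector_at d s z. int_size k))
       (s(x := (s x)(0 := of_bool (orc (vector_at d s y) (vector_at d s z)))), r)"
| exec_Seq:
    "exec d orc c1 \<sigma>1 t1 \<sigma>2 \<Longrightarrow> exec d orc c2 \<sigma>2 t2 \<sigma>3
      \<Longrightarrow> exec d orc (Seq c1 c2) \<sigma>1 (t1 + t2) \<sigma>3"
| exec_IfTrue:
    "bval s b \<Longrightarrow> exec d orc c1 (s, r) t \<sigma>
      \<Longrightarrow> exec d orc (If b c1 c2) (s, r) (1 + bcost s b + t) \<sigma>"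
| exec_IfFalse:
    "\<not> bval s b \<Longrightarrow> exec d orc c2 (s, r) t \<sigma>
      \<Longrightarrow> exec d orc (If b c1 c2) (s, r) (1 + bcost s b + t) \<sigma>"
| exec_WhileFalse:
    "\<not> bval s b \<Longrightarrow> exec d orc (While b c) (s, r) (1 + bcost s b) (s, r)"
| exec_WhileTrue:
    "bval s b \<Longrightarrow> exec d orc c (s, r) t1 \<sigma>2 \<Longrightarrow> exec d orc (While b c) \<sigma>2 t2 \<sigma>3
      \<Longrightarrow> exec d orc (While b c) (s, r) (1 + bcost s b + t1 + t2) \<sigma>3"

inductive_cases exec_SkipE: "exec d orc Skip \<sigma> t \<sigma>'"
inductive_cases exec_AssignE: "exec d orc (Assign x i a) \<sigma> t \<sigma>'"
inductive_cases exec_FlipE: "exec d orc (Flip x) \<sigma> t \<sigma>'"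
inductive_cases exec_QueryE: "exec d orc (Query x y z) \<sigma> t \<sigma>'"
inductive_cases exec_SeqE: "exec d orc (Seq c1 c2) \<sigma> t \<sigma>'"
inductive_cases exec_IfE: "exec d orc (If b c1 c2) \<sigma> t \<sigma>'"
inductive_cases exec_WhileE: "exec d orc (While b c) \<sigma> t \<sigma>'"

lemma exec_deterministic:
  assumes "exec d orc c \<sigma> t1' \<sigma>1'" and "exec d orc c \<sigma> t2' \<sigma>2'"
  shows "t1' = t2' \<and> \<sigma>1' = \<sigma>2'"
  using assms
proof (induction arbitrary: t2' \<sigma>2' rule: exec.induct)
  case (exec_Skip s r)
  then show ?case by (auto elim: exec_SkipE)
next
  case (exec_Assign x i a s r)
  then show ?case by (auto elim: exec_AssignE)
next
  case (exec_Flip x s r)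
  then show ?case by (auto elim: exec_FlipE)
next
  case (exec_Query x y z s r)
  then show ?case by (auto elim: exec_QueryE)
next
  case (exec_Seq c1 \<sigma>1 t1 \<sigma>2 c2 t2 \<sigma>3)
  from exec_Seq.prems obtain u1 \<tau> u2 where "exec d orc c1 \<sigma>1 u1 \<tau>"
      and "exec d orc c2 \<tau> u2 \<sigma>2'" and "t2' = u1 + u2"
    by (rule exec_SeqE)
  then show ?case using exec_Seq.IH by metis
next
  case (exec_IfTrue s b c1 r t \<sigma> c2)
  from exec_IfTrue.prems \<open>bval s b\<close> obtain u where "exec d orc c1 (s, r) u \<sigma>2'"
      and "t2' = 1 + bcost s b + u"
    by (auto elim: exec_IfE)
  then show ?case using exec_IfTrue.IH by metis
next
  case (exec_IfFalse s b c2 r t \<sigma> c1)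
  from exec_IfFalse.prems \<open>\<not> bval s b\<close> obtain u where "exec d orc c2 (s, r) u \<sigma>2'"
      and "t2' = 1 + bcost s b + u"
    by (auto elim: exec_IfE)
  then show ?case using exec_IfFalse.IH by metis
next
  case (exec_WhileFalse s b c r)
  from exec_WhileFalse.prems \<open>\<not> bval s b\<close> show ?case
    by (auto elim: exec_WhileE)
next
  case (exec_WhileTrue s b c r t1 \<sigma>2 t2 \<sigma>3)
  from exec_WhileTrue.prems \<open>bval s b\<close> obtain u1 \<tau> u2 where "exec d orc c (s, r) u1 \<tau>"
      and "exec d orc (While b c) \<tau> u2 \<sigma>2'" and "t2' = 1 + bcost s b + u1 + u2"
    by (auto elim: exec_WhileE)
  then show ?case using exec_WhileTrue.IH by metis
qed

section \<open>Randomized algorithms for the matching problem\<close>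

text \<open>The input consists of \<open>n\<close> in \<open>''n''[0]\<close> and the weights in the array \<open>''w''\<close>, where
  \<open>w\<^sup>k\<^sub>i\<^sub>,\<^sub>j\<close> has the address \<open>((k - 1) n + (i - 1)) n + (j - 1)\<close>. All other cells are 0.\<close>

definition input_store :: "nat \<Rightarrow> nat \<Rightarrow> weights \<Rightarrow> store" where
  "input_store d n w = (\<lambda>x a.
     if x = ''n'' \<and> a = 0 then int n
     else if x = ''w'' \<and> 0 \<le> a \<and> a < int (d * n * n)
     then (let m = nat a in w (m div (n * n) + 1) (m div n mod n + 1, m mod n + 1))
     else 0)"

text \<open>The output is the incidence vector of a set of edges in the array \<open>''M''\<close>.\<close>

definition output_edges :: "nat \<Rightarrow> store \<Rightarrow> (nat \<times> nat) set" where
  "output_edges n s = {(i, j) \<in> edges n. s ''M'' (int ((i - 1) * n + (j - 1))) = 1}"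

definition halts_with ::
  "nat \<Rightarrow> com \<Rightarrow> nat \<Rightarrow> weights \<Rightarrow> (real list \<Rightarrow> real) \<Rightarrow> bool stream \<Rightarrow> nat \<Rightarrow> (nat \<times> nat) set \<Rightarrow> bool"
where
  "halts_with d c n w f r t M \<longleftrightarrow>
     (\<exists>s r'. exec d (comparison_oracle f) c (input_store d n w, r) t (s, r') \<and> M = output_edges n s)"

text \<open>Sequences of independent fair random bits.\<close>

definition random_bits :: "bool stream measure" where
  "random_bits = stream_space (measure_pmf (bernoulli_pmf (1 / 2)))"

text \<open>The time bound \<open>p\<close> is a polynomial in two variables, evaluated at \<open>n\<close> and at the largest
  absolute value of a weight; it is chosen before the input. The time bound and the requirement
  that the output be a perfect matching hold for every sequence of random bits.\<close>

definition solves_in_polynomial_oracle_time ::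
  "nat \<Rightarrow> (nat \<Rightarrow> weights \<Rightarrow> (real list \<Rightarrow> real) \<Rightarrow> (nat \<times> nat) set \<Rightarrow> bool) \<Rightarrow> com \<Rightarrow> bool"
where
  "solves_in_polynomial_oracle_time d optimal c \<longleftrightarrow>
     (\<exists>p :: nat poly poly. \<forall>n w f. n \<ge> 1 \<longrightarrow>
        (\<forall>r. \<exists>t M. halts_with d c n w f r t M
           \<and> t \<le> poly (poly p [:n:]) (max_weight d n w) \<and> perfect_matching n M)
        \<and> measure random_bits
            {r \<in> space random_bits. \<exists>t M. halts_with d c n w f r t M \<and> optimal n w f M} \<ge> 1 / 2)"

end

theory Submission
  imports Defs "Jordan_Normal_Form.Char_Poly"
begin

text \<open>
  Because \<open>d\<close> is fixed, the \<open>d\<close> weights can be merged into a single one. Shifted to be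
  nonnegative, the weights of an edge become the digits of one number, its code, in a base larger
  than any coordinate of the shifted weight vector of a matching. The code of a matching, the sum of the
  codes of its edges, then determines its weight vector, and only \<open>base ^ d\<close> codes
  are possible, which is polynomial in \<open>n\<close> and the largest weight. It remains to find out which
  codes belong to perfect matchings, to compare their weight vectors by the oracle, and to construct
  a matching with the best code.

  Draw a random integer \<open>r\<^sub>e\<close> for every edge \<open>e\<close> and put \<open>r\<^sub>e x\<^sup>c\<close>, where \<open>c\<close> is the code of
  \<open>e\<close>, at the position of \<open>e\<close> in an \<open>n\<close> by \<open>n\<close> matrix. The coefficient of \<open>x\<^sup>t\<close> in the
  determinant is the signed sum, over the perfect matchings with code \<open>t\<close>, of the products of
  their random numbers (\<open>coeff_det_weight_mat\<close>). So a nonzero coefficient certifies a matching.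
  Conversely, if a matching with code \<open>t\<close> exists, the coefficient is not identically zero and is
  affine in each random number, so it survives with probability at least one half
  (\<open>prob_signed_sum_zero\<close>). It is enough that this happens for the code of one fixed optimal
  matching: every other code that the program accepts is genuine, hence no better.

  The determinant is computed over the integers, at a power of two in the place of \<open>x\<close> that is so
  large that the coefficients can be read off as digits (\<open>coeff_zero_iff_digit_zero\<close>). The
  recursion of Faddeev and Leverrier serves for this (\<open>leverrier_eq_det\<close>): it needs no pivoting,
  all its divisions are exact, and the lengths of its numbers grow only linearly
  (\<open>leverrier_product_bound\<close>).

  Given the best code, the matching is found row by row. A signed sum splits according to the
  column used in a given row, so if it is nonzero, it stays nonzero for some choice of the column
  (\<open>signed_sum_row\<close>). This uses the same random numbers, so no further error arises. If no
  coefficient survives, the program outputs the diagonal; thus it always outputs a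
  perfect matching. Minimization is maximization with the arguments of the oracle exchanged.

  For the running time, counting instructions is separated from their logarithmic cost. The
  predicate \<open>wp\<close> bounds the number of instructions and, at the same time, guarantees that no
  memory cell ever exceeds a given number of bits; by \<open>bexec_imp_exec\<close> each instruction
  of a fixed program then has a cost polynomial in this number of bits.
\<close>

section \<open>Determinants by the recursion of Faddeev and Leverrier\<close>

text \<open>
  The second component runs through the coefficients of the characteristic polynomial of \<open>A\<close>,
  from the leading one downwards; the first component is \<open>A\<close> times the coefficient matrix of
  the adjugate of \<open>x I - A\<close> at the same power of \<open>x\<close>.
\<close>

primrec leverrier :: "nat \<Rightarrow> (nat \<Rightarrow> nat \<Rightarrow> int) \<Rightarrow> nat \<Rightarrow> (nat \<Rightarrow> nat \<Rightarrow> int) \<times> int" where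
  "leverrier n A 0 = ((\<lambda>i j. 0), 1)"
| "leverrier n A (Suc k) =
     (let Z = (\<lambda>i j. snd (leverrier n A k) * A i j + (\<Sum>l<n. A i l * fst (leverrier n A k) l j))
      in (Z, (- (\<Sum>i<n. Z i i)) div int (Suc k)))"

text \<open>
  Let \<open>B\<close> be the adjugate of \<open>x I - A\<close>. Comparing coefficients in
  \<open>(x I - A) B = char_poly A \<cdot> I\<close> expresses each coefficient matrix of \<open>B\<close> by the next higher one
  and a coefficient of the characteristic polynomial. The trace of \<open>B\<close> is the derivative of the
  characteristic polynomial, which yields that coefficient from a trace, up to a factor that the
  division removes exactly.
\<close>

lemma leverrier_eq_char_poly_coeff:
  fixes A :: "int mat"
  assumes A: "A \<in> carrier_mat n n" and k: "k \<le> n"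
  defines "B \<equiv> adj_mat (char_poly_matrix A)"
  shows "snd (leverrier n (\<lambda>i j. A $$ (i, j)) k) = coeff (char_poly A) (n - k) \<and>
    (\<forall>i<n. \<forall>j<n. fst (leverrier n (\<lambda>i j. A $$ (i, j)) k) i j
        = (\<Sum>l<n. A $$ (i, l) * coeff (B $$ (l, j)) (n - k)))"
proof -
  define C where "C = char_poly_matrix A"
  have C: "C \<in> carrier_mat n n" using A by (simp add: C_def)
  have B: "B \<in> carrier_mat n n" and CB: "C * B = char_poly A \<cdot>\<^sub>m 1\<^sub>m n"
    using adj_mat[OF C] by (auto simp: B_def C_def char_poly_def)
  have Cij: "C $$ (i, l) = (if i = l then [:0, 1:] else 0) - [:A $$ (i, l):]"
    if "i < n" "l < n" for i l
    using A that by (auto simp: C_def char_poly_matrix_def)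
  have Bij: "B $$ (i, j) = cofactor C j i" if "i < n" "j < n" for i j
    using A that by (auto simp: B_def C_def[symmetric] adj_mat_def C[unfolded carrier_mat_def, simplified])
  have degB: "coeff (B $$ (i, j)) n = 0" if "i < n" "j < n" for i j
  proof -
    have M: "mat_delete C j i \<in> carrier_mat (n - 1) (n - 1)"
      using C by (rule mat_delete_carrier)
    have "degree (Determinant.det (mat_delete C j i)) \<le> 1 * (n - 1)"
    proof (rule degree_det_le[OF _ M])
      fix a b assume "a < n - 1" "b < n - 1"
      then have "mat_delete C j i $$ (a, b)
          = C $$ (if a < j then a else Suc a, if b < i then b else Suc b)"
        using C by (auto simp: mat_delete_def)
      moreover have "degree (C $$ (a', b')) \<le> 1" if "a' < n" "b' < n" for a' b'
        unfolding Cij[OF that] by (auto intro!: degree_diff_le)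
      ultimately show "degree (mat_delete C j i $$ (a, b)) \<le> 1"
        using \<open>a < n - 1\<close> \<open>b < n - 1\<close> by (simp split: if_splits)
    qed
    then have "degree (cofactor C j i) < n"
      using that by (cases "even (j + i)") (auto simp: cofactor_def)
    then show ?thesis using that by (simp add: Bij coeff_eq_0)
  qed
  have eq: "[:0, 1:] * B $$ (i, j) - (\<Sum>l<n. [:A $$ (i, l):] * B $$ (l, j))
      = (if i = j then char_poly A else 0)" if ij: "i < n" "j < n" for i j
  proof -
    have "(\<Sum>l<n. C $$ (i, l) * B $$ (l, j)) = (C * B) $$ (i, j)"
      using B C ij by (auto simp: times_mat_def scalar_prod_def lessThan_atLeast0)
    also have "\<dots> = (if i = j then char_poly A else 0)" using ij by (simp add: CB)
    also have "(\<Sum>l<n. C $$ (i, l) * B $$ (l, j))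
       = (\<Sum>l<n. (if i = l then [:0, 1:] * B $$ (l, j) else 0) - [:A $$ (i, l):] * B $$ (l, j))"
      by (rule sum.cong) (auto simp: Cij ij algebra_simps)
    also have "\<dots> = [:0, 1:] * B $$ (i, j) - (\<Sum>l<n. [:A $$ (i, l):] * B $$ (l, j))"
      using ij by (simp add: sum_subtractf sum.delta')
    finally show ?thesis .
  qed
  have rec: "coeff (B $$ (i, j)) m = (\<Sum>l<n. A $$ (i, l) * coeff (B $$ (l, j)) (Suc m))
      + (if i = j then coeff (char_poly A) (Suc m) else 0)" if ij: "i < n" "j < n" for i j m
    using arg_cong[OF eq[OF ij], of "\<lambda>p. coeff p (Suc m)"]
    by (auto simp: coeff_sum coeff_pCons split: nat.splits if_splits)
  have rec0: "(\<Sum>l<n. A $$ (i, l) * coeff (B $$ (l, j)) 0)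
      = - (if i = j then coeff (char_poly A) 0 else 0)" if ij: "i < n" "j < n" for i j
    using arg_cong[OF eq[OF ij], of "\<lambda>p. coeff p 0"]
    by (auto simp: coeff_sum coeff_pCons split: nat.splits if_splits)
  have tr: "(\<Sum>i<n. coeff (B $$ (i, i)) m) = int (Suc m) * coeff (char_poly A) (Suc m)" for m
  proof -
    have "(\<Sum>i<n. B $$ (i, i)) = (\<Sum>i<n. char_poly (mat_delete A i i))"
    proof (rule sum.cong)
      fix i assume "i \<in> {..<n}"
      then have i: "i < n" by simp
      have "mat_delete C i i = char_poly_matrix (mat_delete A i i)"
        using A i unfolding C_def char_poly_matrix_def
        by (intro eq_matI) (auto simp: mat_delete_def)
      then show "B $$ (i, i) = char_poly (mat_delete A i i)"
        using i by (simp add: Bij cofactor_def char_poly_def)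
    qed simp
    also have "\<dots> = pderiv (char_poly A)" using pderiv_char_poly[OF A] by simp
    finally have "coeff (\<Sum>i<n. B $$ (i, i)) m = coeff (pderiv (char_poly A)) m" by simp
    then show ?thesis by (simp add: coeff_sum coeff_pderiv)
  qed
  show ?thesis using k
  proof (induction k)
    case 0
    show ?case using degree_monic_char_poly[OF A] degB by auto
  next
    case (Suc k)
    define F where "F = leverrier n (\<lambda>i j. A $$ (i, j)) k"
    define m where "m = n - Suc k"
    have m: "n - k = Suc m" using Suc.prems by (simp add: m_def)
    have c: "snd F = coeff (char_poly A) (Suc m)"
      and Y: "\<And>i j. i < n \<Longrightarrow> j < n \<Longrightarrow>
         fst F i j = (\<Sum>l<n. A $$ (i, l) * coeff (B $$ (l, j)) (Suc m))"
      using Suc by (auto simp: F_def m)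
    define Z where "Z = (\<lambda>i j. snd F * A $$ (i, j) + (\<Sum>l<n. A $$ (i, l) * fst F l j))"
    have step: "leverrier n (\<lambda>i j. A $$ (i, j)) (Suc k) = (Z, (- (\<Sum>i<n. Z i i)) div int (Suc k))"
      by (simp add: F_def Z_def Let_def)
    have Z: "Z i j = (\<Sum>l<n. A $$ (i, l) * coeff (B $$ (l, j)) m)" if ij: "i < n" "j < n" for i j
    proof -
      have "(\<Sum>l<n. A $$ (i, l) * coeff (B $$ (l, j)) m)
        = (\<Sum>l<n. A $$ (i, l) * fst F l j + (if l = j then A $$ (i, l) * snd F else 0))"
        by (rule sum.cong) (auto simp: rec Y c ij algebra_simps)
      also have "\<dots> = (\<Sum>l<n. A $$ (i, l) * fst F l j) + A $$ (i, j) * snd F"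
        using ij by (simp add: sum.distrib sum.delta)
      finally show ?thesis by (simp add: Z_def)
    qed
    have "(\<Sum>i<n. Z i i) = - int (Suc k) * coeff (char_poly A) m"
    proof (cases m)
      case 0
      have "(\<Sum>i<n. Z i i) = (\<Sum>i<n. - coeff (char_poly A) 0)"
        using rec0 by (intro sum.cong) (auto simp: Z 0)
      moreover have "n = Suc k" using m 0 Suc.prems by simp
      ultimately show ?thesis by (simp add: 0 algebra_simps)
    next
      case (Suc m')
      have "(\<Sum>i<n. coeff (B $$ (i, i)) m') = (\<Sum>i<n. Z i i + coeff (char_poly A) m)"
        by (rule sum.cong) (auto simp: rec Z Suc)
      then have "(\<Sum>i<n. Z i i) = int m * coeff (char_poly A) m - int n * coeff (char_poly A) m"
        by (simp add: tr sum.distrib Suc)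
      moreover have "int n = int m + int (Suc k)" using Suc.prems by (simp add: m_def)
      ultimately show ?thesis by (simp add: algebra_simps)
    qed
    then have "- (\<Sum>i<n. Z i i) = int (Suc k) * coeff (char_poly A) m"
      by (simp only: mult_minus_left minus_minus)
    then have "(- (\<Sum>i<n. Z i i)) div int (Suc k) = coeff (char_poly A) m"
      by (simp only: nonzero_mult_div_cancel_left of_nat_eq_0_iff nat.distinct not_False_eq_True)
    then show ?case unfolding step by (simp add: Z m_def[symmetric])
  qed
qed

lemma leverrier_cong:
  assumes "\<And>i j. i < n \<Longrightarrow> j < n \<Longrightarrow> A i j = A' i j"
  shows "snd (leverrier n A k) = snd (leverrier n A' k) \<and>
    (\<forall>i<n. \<forall>j<n. fst (leverrier n A k) i j = fst (leverrier n A' k) i j)"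
proof (induction k)
  case (Suc k)
  then show ?case using assms by (auto simp: Let_def intro!: arg_cong2[of _ _ _ _ "(div)"] sum.cong)
qed simp

lemma leverrier_eq_det:
  "snd (leverrier n A n) = (-1) ^ n * Determinant.det (mat n n (\<lambda>(i, j). A i j))"
proof -
  define M where "M = mat n n (\<lambda>(i, j). A i j)"
  have M: "M \<in> carrier_mat n n" by (simp add: M_def)
  have "snd (leverrier n A n) = snd (leverrier n (\<lambda>i j. M $$ (i, j)) n)"
    using leverrier_cong[of n A "\<lambda>i j. M $$ (i, j)" n] by (simp add: M_def)
  also have "\<dots> = poly (char_poly M) 0"
    using leverrier_eq_char_poly_coeff[OF M order.refl] by (simp add: poly_0_coeff_0)
  also have "\<dots> = Determinant.det (- M)"
    unfolding char_poly_def
    by (rule poly_det_cong[OF _ char_poly_matrix_closed[OF M]]) (use M in \<open>auto simp: char_poly_matrix_def\<close>)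
  also have "- M = (-1) \<cdot>\<^sub>m M" by (auto simp: M_def)
  also have "Determinant.det \<dots> = (-1) ^ n * Determinant.det M"
    using M by simp
  finally show ?thesis by (simp add: M_def)
qed

lemma abs_div_le: "\<bar>a div b\<bar> \<le> \<bar>a :: int\<bar>"
proof (cases "b = 0")
  case False
  then have b: "1 \<le> \<bar>b\<bar>" "0 < \<bar>b\<bar>" by auto
  have "\<bar>c div \<bar>b\<bar>\<bar> \<le> \<bar>c\<bar>" for c
  proof (cases "c \<ge> 0")
    case True
    then show ?thesis using zdiv_mono2[of c 1 "\<bar>b\<bar>"] pos_imp_zdiv_nonneg_iff[OF b(2), of c] b
      by simp
  next
    case neg: False
    then show ?thesis using zdiv_mono2_neg[of c 1 "\<bar>b\<bar>"] pos_imp_zdiv_neg_iff[OF b(2), of c] b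
      by simp
  qed
  from this[of "sgn b * a"] show ?thesis
    using False by (cases "b > 0") (auto simp: abs_mult)
qed simp

text \<open>
  Each step multiplies the size of the entries by at most \<open>K\<close>, so numbers of polynomial length
  suffice. The last two bounds cover the partial sums that a program stores while it computes a
  step.
\<close>

lemma leverrier_bound:
  assumes n: "1 \<le> n" and A: "\<And>i j. i < n \<Longrightarrow> j < n \<Longrightarrow> \<bar>A i j\<bar> \<le> int G"
  defines "K \<equiv> int (2 * n * G)"
  shows leverrier_snd_bound: "\<bar>snd (leverrier n A k)\<bar> \<le> int n * K ^ k"
    and leverrier_product_bound: "i < n \<Longrightarrow> j < n \<Longrightarrow> m \<le> n \<Longrightarrow>
      \<bar>snd (leverrier n A k) * A i j + (\<Sum>l<m. A i l * fst (leverrier n A k) l j)\<bar> \<le> K ^ Suc k"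
    and leverrier_trace_bound: "m \<le> n \<Longrightarrow> \<bar>\<Sum>i<m. fst (leverrier n A k) i i\<bar> \<le> int n * K ^ k"
proof -
  have K: "0 \<le> K" by (simp add: K_def)
  have product: "\<bar>c * A i j + (\<Sum>l<m. A i l * Y l j)\<bar> \<le> K ^ Suc k"
    if "\<bar>c\<bar> \<le> int n * K ^ k" "\<And>i j. i < n \<Longrightarrow> j < n \<Longrightarrow> \<bar>Y i j\<bar> \<le> K ^ k" "i < n" "j < n" "m \<le> n"
    for c Y k i j m
  proof -
    have "\<bar>c * A i j\<bar> \<le> (int n * K ^ k) * int G"
      unfolding abs_mult using that A K by (intro mult_mono) auto
    moreover have "\<bar>\<Sum>l<m. A i l * Y l j\<bar> \<le> (\<Sum>l<m. int G * K ^ k)"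
      using that A K by (intro order.trans[OF sum_abs] sum_mono) (auto simp: abs_mult intro!: mult_mono)
    moreover have "(\<Sum>l<m. int G * K ^ k) \<le> int n * (int G * K ^ k)"
      using that K by (simp add: mult_right_mono)
    moreover have "int n * K ^ k * int G + int n * (int G * K ^ k) = K ^ Suc k"
      by (simp add: K_def algebra_simps)
    ultimately show ?thesis by linarith
  qed
  have trace: "\<bar>\<Sum>i<m. Y i i\<bar> \<le> int n * K ^ k"
    if "\<And>i j. i < n \<Longrightarrow> j < n \<Longrightarrow> \<bar>Y i j\<bar> \<le> K ^ k" "m \<le> n" for Y :: "nat \<Rightarrow> nat \<Rightarrow> int" and m k
  proof -
    have "\<bar>\<Sum>i<m. Y i i\<bar> \<le> (\<Sum>i<m. K ^ k)"
      using that by (intro order.trans[OF sum_abs] sum_mono) auto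
    also have "\<dots> \<le> int n * K ^ k" using that K by (simp add: mult_right_mono)
    finally show ?thesis .
  qed
  have both: "\<bar>snd (leverrier n A k)\<bar> \<le> int n * K ^ k \<and> (\<forall>i<n. \<forall>j<n. \<bar>fst (leverrier n A k) i j\<bar> \<le> K ^ k)" for k
  proof (induction k)
    case 0
    then show ?case using n by simp
  next
    case (Suc k)
    have Y: "\<bar>fst (leverrier n A (Suc k)) i j\<bar> \<le> K ^ Suc k" if "i < n" "j < n" for i j
      using product[of "snd (leverrier n A k)" k "fst (leverrier n A k)" i j n] Suc that by (simp add: Let_def)
    have "snd (leverrier n A (Suc k)) = (- (\<Sum>i<n. fst (leverrier n A (Suc k)) i i)) div int (Suc k)"
      by (simp add: Let_def)
    then have "\<bar>snd (leverrier n A (Suc k))\<bar> \<le> \<bar>- (\<Sum>i<n. fst (leverrier n A (Suc k)) i i)\<bar>"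
      by (simp only: abs_div_le)
    also have "\<dots> \<le> int n * K ^ Suc k"
      unfolding abs_minus_cancel by (rule trace[OF Y order.refl])
    finally show ?case using Y by blast
  qed
  show "\<bar>snd (leverrier n A k)\<bar> \<le> int n * K ^ k" using both by blast
  have Y: "\<bar>fst (leverrier n A k) i j\<bar> \<le> K ^ k" if "i < n" "j < n" for i j using both that by blast
  show "\<bar>snd (leverrier n A k) * A i j + (\<Sum>l<m. A i l * fst (leverrier n A k) l j)\<bar> \<le> K ^ Suc k"
    if "i < n" "j < n" "m \<le> n" using both that by (intro product) auto
  show "\<bar>\<Sum>i<m. fst (leverrier n A k) i i\<bar> \<le> int n * K ^ k" if "m \<le> n" using trace[OF Y that] .
qed

section \<open>Events decided by finitely many random bits\<close>

text \<open>
  In topological terms, these are the open sets of Cantor space. The set of bit sequences on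
  which a program succeeds is of this kind, which is how it is seen to be measurable.
\<close>

definition finitary :: "(bool stream \<Rightarrow> bool) \<Rightarrow> bool" where
  "finitary P \<longleftrightarrow> (\<forall>r. P r \<longrightarrow> (\<exists>m. \<forall>r'. stake m r' = stake m r \<longrightarrow> P r'))"

lemma space_random_bits [simp]: "space random_bits = UNIV"
  by (simp add: random_bits_def space_stream_space)

text \<open>
  An open set is the union of the cylinders that it contains, and there are only countably many
  cylinders.
\<close>

lemma finitary_sets:
  assumes "finitary P"
  shows "{r. P r} \<in> sets random_bits"
proof -
  define C where "C = {bs. \<forall>r. stake (length bs) r = bs \<longrightarrow> P r}"
  have "{r. P r} = (\<Union>bs\<in>C. {r. stake (length bs) r = bs})"
  proof (intro equalityI subsetI)
    fix r assume "r \<in> {r. P r}"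
    with assms obtain m where "\<And>r'. stake m r' = stake m r \<Longrightarrow> P r'"
      unfolding finitary_def by blast
    then have "stake m r \<in> C" by (simp add: C_def)
    then show "r \<in> (\<Union>bs\<in>C. {r. stake (length bs) r = bs})"
      by (rule UN_I) simp
  qed (auto simp: C_def)
  moreover have "{r. stake (length bs) r = bs} \<in> sets random_bits" for bs :: "bool list"
  proof -
    have s: "sets random_bits = sets (stream_space (count_space (UNIV :: bool set)))"
      unfolding random_bits_def by (rule sets_stream_space_cong) simp
    have "stake (length bs) -` {bs} \<inter> space (stream_space (count_space UNIV))
       \<in> sets (stream_space (count_space (UNIV :: bool set)))"
      by (rule measurable_sets[OF measurable_stake]) simp
    moreover have "stake (length bs) -` {bs} \<inter> space (stream_space (count_space UNIV))
       = {r. stake (length bs) r = bs}" by (auto simp: space_stream_space)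
    ultimately show ?thesis using s by simp
  qed
  ultimately show ?thesis
    by (simp only:) (rule sets.countable_UN'[OF countableI_type], blast)
qed

lemma stake_add_eqD:
  assumes "stake (m + k) r' = stake (m + k) r"
  shows "stake m r' = stake m r" and "stake k (sdrop m r') = stake k (sdrop m r)"
  using arg_cong[OF assms, of "take m"] arg_cong[OF assms, of "drop m"]
  by (simp_all add: take_stake drop_stake)

lemma finitary_sdrop: "finitary P \<Longrightarrow> finitary (\<lambda>r. P (sdrop m r))"
  unfolding finitary_def
proof (intro allI impI)
  fix r assume *: "\<forall>r. P r \<longrightarrow> (\<exists>m. \<forall>r'. stake m r' = stake m r \<longrightarrow> P r')" "P (sdrop m r)"
  then obtain k where k: "\<And>r'. stake k r' = stake k (sdrop m r) \<Longrightarrow> P r'" by blast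
  have "P (sdrop m r')" if "stake (m + k) r' = stake (m + k) r" for r'
    by (rule k[OF stake_add_eqD(2)[OF that]])
  then show "\<exists>k. \<forall>r'. stake k r' = stake k r \<longrightarrow> P (sdrop m r')" by blast
qed

lemma finitary_conj: "finitary P \<Longrightarrow> finitary Q \<Longrightarrow> finitary (\<lambda>r. P r \<and> Q r)"
  unfolding finitary_def
proof (intro allI impI)
  fix r assume *: "\<forall>r. P r \<longrightarrow> (\<exists>m. \<forall>r'. stake m r' = stake m r \<longrightarrow> P r')"
    "\<forall>r. Q r \<longrightarrow> (\<exists>m. \<forall>r'. stake m r' = stake m r \<longrightarrow> Q r')" "P r \<and> Q r"
  then obtain k l where k: "\<And>r'. stake k r' = stake k r \<Longrightarrow> P r'"
    and l: "\<And>r'. stake l r' = stake l r \<Longrightarrow> Q r'" by blast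
  have "P r' \<and> Q r'" if "stake (max k l) r' = stake (max k l) r" for r'
    using k[of r'] l[of r'] arg_cong[OF that, of "take k"] arg_cong[OF that, of "take l"]
    by (simp add: take_stake min_def max_def split: if_splits)
  then show "\<exists>k. \<forall>r'. stake k r' = stake k r \<longrightarrow> P r' \<and> Q r'" by blast
qed

lemma finitary_ex: "(\<And>x. finitary (P x)) \<Longrightarrow> finitary (\<lambda>r. \<exists>x. P x r)"
proof -
  assume *: "\<And>x. finitary (P x)"
  show ?thesis
    unfolding finitary_def
  proof (intro allI impI)
    fix r assume "\<exists>x. P x r"
    then obtain x where "P x r" ..
    with *[of x] obtain m where "\<And>r'. stake m r' = stake m r \<Longrightarrow> P x r'"
      unfolding finitary_def by blast
    then show "\<exists>m. \<forall>r'. stake m r' = stake m r \<longrightarrow> (\<exists>x. P x r')" by blast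
  qed
qed

section \<open>Random integers and multi-affine functions\<close>

primrec bits_value :: "nat \<Rightarrow> bool stream \<Rightarrow> nat" where
  "bits_value 0 r = 0"
| "bits_value (Suc m) r = of_bool (shd r) * 2 ^ m + bits_value m (stl r)"

lemma bits_value_less: "bits_value m r < 2 ^ m"
proof (induction m arbitrary: r)
  case (Suc m)
  then show ?case using Suc[of "stl r"] by (cases "shd r") (simp_all add: mult_2 trans_less_add1)
qed simp

text \<open>
  The form in which a loop computes the value, by appending one bit after the other.
\<close>

lemma bits_value_snoc: "bits_value (Suc m) r = 2 * bits_value m r + of_bool (r !! m)"
proof (induction m arbitrary: r)
  case (Suc m)
  have "bits_value (Suc (Suc m)) r = of_bool (shd r) * 2 ^ Suc m + bits_value (Suc m) (stl r)"
    by simp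
  also have "bits_value (Suc m) (stl r) = 2 * bits_value m (stl r) + of_bool (stl r !! m)"
    by (rule Suc)
  finally show ?case by (simp add: algebra_simps)
qed simp

lemma bits_value_stake: "stake m r' = stake m r \<Longrightarrow> bits_value m r' = bits_value m r"
proof (induction m arbitrary: r r')
  case (Suc m)
  from Suc.prems have "shd r' = shd r" "stake m (stl r') = stake m (stl r)" by auto
  with Suc.IH[of "stl r'" "stl r"] show ?case by (simp only: bits_value.simps)
qed simp

lemma finitary_block:
  assumes "\<And>x. finitary (P x)"
  shows "finitary (\<lambda>r. P (bits_value m r) (sdrop m r))"
proof -
  have "finitary (\<lambda>r. bits_value m r = x)" for x
    unfolding finitary_def
  proof (intro allI impI exI)
    fix r r' assume "bits_value m r = x" "stake m r' = stake m r"
    then show "bits_value m r' = x" using bits_value_stake[of m r' r] by simp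
  qed
  then have "finitary (\<lambda>r. \<exists>x. bits_value m r = x \<and> P x (sdrop m r))"
    by (rule finitary_ex[OF finitary_conj[OF _ finitary_sdrop[OF assms]]])
  then show ?thesis by simp
qed

lemma prob_space_random_bits: "prob_space random_bits"
  unfolding random_bits_def by (rule prob_space.prob_space_stream_space[OF prob_space_measure_pmf])

lemma prob_shd:
  assumes "finitary P"
  shows "measure random_bits {r. P r}
    = (measure random_bits {r. P (True ## r)} + measure random_bits {r. P (False ## r)}) / 2"
proof -
  have "ennreal (measure random_bits {r. P r})
    = (\<integral>\<^sup>+t. ennreal (measure random_bits {r. P (t ## r)}) \<partial>measure_pmf (bernoulli_pmf (1 / 2)))"
    using prob_space.prob_stream_space[OF prob_space_measure_pmf, of "bernoulli_pmf (1 / 2)" P] finitary_sets[OF assms]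
    by (simp add: random_bits_def space_stream_space)
  also have "\<dots> = ennreal (measure random_bits {r. P (True ## r)}) * ennreal (1 / 2)
      + ennreal (measure random_bits {r. P (False ## r)}) * ennreal (1 / 2)"
    by (subst nn_integral_measure_pmf_support[where A = UNIV]) (auto simp: UNIV_bool add.commute)
  also have "\<dots> = ennreal (measure random_bits {r. P (True ## r)} * (1 / 2)
      + measure random_bits {r. P (False ## r)} * (1 / 2))"
    by (subst ennreal_plus) (auto simp only: ennreal_mult'' intro!: mult_nonneg_nonneg measure_nonneg)
  also have "\<dots> = ennreal ((measure random_bits {r. P (True ## r)} + measure random_bits {r. P (False ## r)}) / 2)"
    by (rule arg_cong[of _ _ ennreal]) (simp add: field_simps)
  finally show ?thesis by (subst (asm) ennreal_inj) (auto)
qed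

text \<open>
  The first \<open>m\<close> bits form a uniformly distributed number that is independent of the remaining
  bits.
\<close>

lemma prob_block:
  assumes "\<And>x. finitary (P x)"
  shows "measure random_bits {r. P (bits_value m r) (sdrop m r)}
    = (\<Sum>x<2 ^ m. measure random_bits {r. P x r}) / 2 ^ m"
  using assms
proof (induction m arbitrary: P)
  case (Suc m)
  have "measure random_bits {r. P (bits_value (Suc m) r) (sdrop (Suc m) r)}
    = (measure random_bits {r. P (2 ^ m + bits_value m r) (sdrop m r)}
      + measure random_bits {r. P (bits_value m r) (sdrop m r)}) / 2"
    by (subst prob_shd[OF finitary_block[OF Suc.prems]]) simp
  also have "\<dots> = ((\<Sum>x<2 ^ m. measure random_bits {r. P (2 ^ m + x) r}) / 2 ^ m
      + (\<Sum>x<2 ^ m. measure random_bits {r. P x r}) / 2 ^ m) / 2"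
    using Suc.IH[of P] Suc.IH[of "\<lambda>x. P (2 ^ m + x)"] Suc.prems by simp
  also have "\<dots> = ((\<Sum>x<2 ^ m. measure random_bits {r. P x r})
      + (\<Sum>x<2 ^ m. measure random_bits {r. P (2 ^ m + x) r})) / 2 ^ Suc m"
    by (simp add: add_divide_distrib)
  also have "(\<Sum>x<2 ^ m. measure random_bits {r. P x r})
      + (\<Sum>x<2 ^ m. measure random_bits {r. P (2 ^ m + x) r})
    = (\<Sum>x<2 ^ Suc m. measure random_bits {r. P x r})"
    using sum.atLeastLessThan_concat[of 0 "2 ^ m" "2 ^ Suc m" "\<lambda>x. measure random_bits {r. P x r}"]
      sum.shift_bounds_nat_ivl[of "\<lambda>x. measure random_bits {r. P x r}" 0 "2 ^ m" "2 ^ m"]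
    by (simp add: lessThan_atLeast0 add.commute mult_2)
  finally show ?case .
qed simp

lemma bits_value_sdrop_cong:
  assumes "stake (l * m) r' = stake (l * m) r" and "c < l"
  shows "bits_value m (sdrop (c * m) r') = bits_value m (sdrop (c * m) r)"
proof (rule bits_value_stake)
  have "Suc c * m \<le> l * m" using assms(2) by (intro mult_le_mono1) auto
  then have "m \<le> l * m - c * m" by simp
  then show "stake m (sdrop (c * m) r') = stake m (sdrop (c * m) r)"
    using arg_cong[OF assms(1), of "\<lambda>xs. take m (drop (c * m) xs)"]
    by (simp add: drop_stake take_stake min_absorb1)
qed

definition multi_affine :: "((nat \<Rightarrow> int) \<Rightarrow> int) \<Rightarrow> bool" where
  "multi_affine q \<longleftrightarrow> (\<forall>v a. \<exists>\<alpha> \<beta>. \<forall>x. q (v(a := x)) = \<alpha> + \<beta> * x)"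

text \<open>
  Start at a point \<open>v\<close> where \<open>q\<close> does not vanish and replace the coordinates one at a time by
  random numbers. As a function of one coordinate, \<open>q\<close> is affine and nonzero at the
  present point, so it has at most one zero, and the value is lost in this step with probability at
  most \<open>1 / 2 ^ m\<close>. The coordinates from \<open>a\<close> on are treated in the order of the blocks of bits, so
  that the induction can peel off the first block.
\<close>

lemma prob_multi_affine_zero:
  assumes q: "multi_affine q" and "q v \<noteq> 0"
  shows "measure random_bits {r. q (\<lambda>b. if a \<le> b \<and> b < a + l
      then int (bits_value m (sdrop ((b - a) * m) r)) else v b) = 0} \<le> real l / 2 ^ m"
  using assms(2)
proof (induction l arbitrary: a v)
  case 0
  have "(\<lambda>b. if a \<le> b \<and> b < a + 0 then int (bits_value m (sdrop ((b - a) * m) r)) else v b) = v"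
    for r by auto
  with 0 show ?case by (simp only:) simp
next
  case (Suc l)
  interpret prob_space random_bits by (rule prob_space_random_bits)
  \<comment> \<open>the event that remains after the first block has set coordinate \<open>a\<close> to \<open>x\<close>\<close>
  define P where "P = (\<lambda>x r. q (\<lambda>b. if Suc a \<le> b \<and> b < Suc a + l
      then int (bits_value m (sdrop ((b - Suc a) * m) r)) else (v(a := int x)) b) = 0)"
  have fin: "finitary (P x)" for x
  proof -
    have "P x r' = P x r" if eq: "stake (l * m) r' = stake (l * m) r" for r r'
    proof -
      have "bits_value m (sdrop ((b - Suc a) * m) r') = bits_value m (sdrop ((b - Suc a) * m) r)"
        if "Suc a \<le> b" "b < Suc a + l" for b
        using that by (intro bits_value_sdrop_cong[OF eq]) auto
      then show ?thesis unfolding P_def by (intro arg_cong2[of _ _ _ _ "(=)"] arg_cong[of _ _ q]) auto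
    qed
    then show ?thesis unfolding finitary_def by blast
  qed
  have eq: "{r. q (\<lambda>b. if a \<le> b \<and> b < a + Suc l
      then int (bits_value m (sdrop ((b - a) * m) r)) else v b) = 0}
     = {r. P (bits_value m r) (sdrop m r)}"
  proof -
    have "(\<lambda>b. if a \<le> b \<and> b < a + Suc l then int (bits_value m (sdrop ((b - a) * m) r)) else v b)
      = (\<lambda>b. if Suc a \<le> b \<and> b < Suc a + l
      then int (bits_value m (sdrop ((b - Suc a) * m) (sdrop m r))) else (v(a := int (bits_value m r))) b)"
      for r
    proof
      fix b
      consider "b < a" | "b = a" | c where "b = Suc a + c" by (metis add_Suc less_iff_Suc_add linorder_neqE_nat)
      then show "(if a \<le> b \<and> b < a + Suc l then int (bits_value m (sdrop ((b - a) * m) r)) else v b)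
      = (if Suc a \<le> b \<and> b < Suc a + l
      then int (bits_value m (sdrop ((b - Suc a) * m) (sdrop m r))) else (v(a := int (bits_value m r))) b)"
        by cases auto
    qed
    then show ?thesis by (simp add: P_def)
  qed
  have "measure random_bits {r. q (\<lambda>b. if a \<le> b \<and> b < a + Suc l
      then int (bits_value m (sdrop ((b - a) * m) r)) else v b) = 0}
    = (\<Sum>x<2 ^ m. measure random_bits {r. P x r}) / 2 ^ m"
    unfolding eq by (rule prob_block[OF fin])
  also have "\<dots> \<le> real (1 + l) / 2 ^ m"
  proof -
    obtain \<alpha> \<beta> where ab: "\<And>x. q (v(a := x)) = \<alpha> + \<beta> * x"
      using q unfolding multi_affine_def by metis
    \<comment> \<open>the values of the next block for which the induction hypothesis is not available\<close>
    define Z where "Z = {x \<in> {..<2 ^ m :: nat}. q (v(a := int x)) = 0}"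
    have "\<alpha> \<noteq> 0 \<or> \<beta> \<noteq> 0" using ab[of "v a"] Suc.prems by auto
    then have "x = y" if "x \<in> Z" "y \<in> Z" for x y
    proof -
      have *: "\<alpha> + \<beta> * int x = 0" "\<alpha> + \<beta> * int y = 0" using that by (auto simp: Z_def ab)
      then have "\<beta> \<noteq> 0" using \<open>\<alpha> \<noteq> 0 \<or> \<beta> \<noteq> 0\<close> by auto
      moreover have "\<beta> * int x = \<beta> * int y" using * by linarith
      ultimately show ?thesis by simp
    qed
    then have Z: "card Z \<le> 1" by (auto simp: card_le_Suc0_iff_eq Z_def)
    \<comment> \<open>a zero of the affine function costs at most 1, every other block the induction bound\<close>
    have "(\<Sum>x<2 ^ m. measure random_bits {r. P x r})
       \<le> (\<Sum>x\<in>{..<2 ^ m}. (if x \<in> Z then 1 else 0) + real l / 2 ^ m)"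
    proof (rule sum_mono)
      fix x :: nat assume x: "x \<in> {..<2 ^ m}"
      show "measure random_bits {r. P x r} \<le> (if x \<in> Z then 1 else 0) + real l / 2 ^ m"
      proof (cases "x \<in> Z")
        case True
        then show ?thesis using prob_le_1[of "{r. P x r}"] by (simp add: add_increasing2)
      next
        case False
        then have "q (v(a := int x)) \<noteq> 0" using x by (simp add: Z_def)
        from Suc.IH[OF this, of "Suc a"] False show ?thesis by (simp add: P_def)
      qed
    qed
    also have "\<dots> = real (card Z) + real l"
      by (simp add: sum.distrib sum.If_cases Z_def Int_def)
    also have "\<dots> \<le> real (1 + l)" using Z by simp
    finally show ?thesis by (simp add: divide_right_mono)
  qed
  finally show ?case by simp
qed

section \<open>Executions read finitely many bits\<close>

lemma exec_finitary:
  assumes "exec d orc c \<sigma> t \<sigma>'"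
  shows "\<exists>m. snd \<sigma>' = sdrop m (snd \<sigma>) \<and>
    (\<forall>r. stake m r = stake m (snd \<sigma>) \<longrightarrow> exec d orc c (fst \<sigma>, r) t (fst \<sigma>', sdrop m r))"
  using assms
proof (induction rule: exec.induct)
  case (exec_Skip s r)
  then show ?case using exec.exec_Skip[of d orc s] by (intro exI[of _ 0]) auto
next
  case (exec_Assign x i a s r)
  show ?case
    by (intro exI[of _ 0] conjI allI impI) (simp_all only: fst_conv snd_conv sdrop.simps exec.exec_Assign)
next
  case (exec_Flip x s r)
  have "exec d orc (Flip x) (s, r') 1 (s(x := (s x)(0 := of_bool (shd r))), stl r')"
    if "stake 1 r' = stake 1 r" for r'
    using exec.exec_Flip[of d orc x s r'] that by simp
  then show ?case
    by (intro exI[of _ 1] conjI allI impI) (simp_all only: fst_conv snd_conv sdrop.simps One_nat_def)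
next
  case (exec_Query x y z s r)
  show ?case
    by (intro exI[of _ 0] conjI allI impI) (simp_all only: fst_conv snd_conv sdrop.simps exec.exec_Query)
next
  case (exec_Seq c1 \<sigma>1 t1 \<sigma>2 c2 t2 \<sigma>3)
  then obtain m m' where m: "snd \<sigma>2 = sdrop m (snd \<sigma>1)"
      "\<And>r. stake m r = stake m (snd \<sigma>1) \<Longrightarrow> exec d orc c1 (fst \<sigma>1, r) t1 (fst \<sigma>2, sdrop m r)"
      "snd \<sigma>3 = sdrop m' (snd \<sigma>2)"
      "\<And>r. stake m' r = stake m' (snd \<sigma>2) \<Longrightarrow> exec d orc c2 (fst \<sigma>2, r) t2 (fst \<sigma>3, sdrop m' r)"
    by blast
  show ?case
  proof (intro exI[of _ "m + m'"] conjI allI impI)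
    fix r assume "stake (m + m') r = stake (m + m') (snd \<sigma>1)"
    then have "stake m r = stake m (snd \<sigma>1)" "stake m' (sdrop m r) = stake m' (snd \<sigma>2)"
      unfolding m(1) by (rule stake_add_eqD)+
    from exec.exec_Seq[OF m(2)[OF this(1)] m(4)[OF this(2)]]
    show "exec d orc (Seq c1 c2) (fst \<sigma>1, r) (t1 + t2) (fst \<sigma>3, sdrop (m + m') r)" by simp
  qed (simp add: m)
next
  case (exec_IfTrue s b c1 r t \<sigma> c2)
  then obtain m where "snd \<sigma> = sdrop m r"
      "\<And>r'. stake m r' = stake m r \<Longrightarrow> exec d orc c1 (s, r') t (fst \<sigma>, sdrop m r')"
    by auto
  with exec.exec_IfTrue[OF exec_IfTrue.hyps(1)] show ?case by (intro exI[of _ m]) simp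
next
  case (exec_IfFalse s b c2 r t \<sigma> c1)
  then obtain m where "snd \<sigma> = sdrop m r"
      "\<And>r'. stake m r' = stake m r \<Longrightarrow> exec d orc c2 (s, r') t (fst \<sigma>, sdrop m r')"
    by auto
  with exec.exec_IfFalse[OF exec_IfFalse.hyps(1)] show ?case by (intro exI[of _ m]) simp
next
  case (exec_WhileFalse s b c r)
  then show ?case using exec.exec_WhileFalse[of s b d orc c] by (intro exI[of _ 0]) auto
next
  case (exec_WhileTrue s b c r t1 \<sigma>2 t2 \<sigma>3)
  then obtain m m' where m: "snd \<sigma>2 = sdrop m r"
      "\<And>r'. stake m r' = stake m r \<Longrightarrow> exec d orc c (s, r') t1 (fst \<sigma>2, sdrop m r')"
      "snd \<sigma>3 = sdrop m' (snd \<sigma>2)"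
      "\<And>r. stake m' r = stake m' (snd \<sigma>2) \<Longrightarrow> exec d orc (While b c) (fst \<sigma>2, r) t2 (fst \<sigma>3, sdrop m' r)"
    by auto
  show ?case
  proof (intro exI[of _ "m + m'"] conjI allI impI)
    fix r' assume "stake (m + m') r' = stake (m + m') (snd (s, r))"
    then have "stake m r' = stake m r" "stake m' (sdrop m r') = stake m' (snd \<sigma>2)"
      unfolding m(1) snd_conv by (rule stake_add_eqD)+
    from exec.exec_WhileTrue[OF exec_WhileTrue.hyps(1) m(2)[OF this(1)] m(4)[OF this(2)]]
    show "exec d orc (While b c) (fst (s, r), r') (1 + bcost s b + t1 + t2) (fst \<sigma>3, sdrop (m + m') r')"
      by simp
  qed (simp add: m)
qed

lemma finitary_halts: "finitary (\<lambda>r. \<exists>t M. halts_with d c n w f r t M \<and> P M)"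
  unfolding finitary_def
proof (intro allI impI)
  fix r assume "\<exists>t M. halts_with d c n w f r t M \<and> P M"
  then obtain t s r1 where t: "exec d (comparison_oracle f) c (input_store d n w, r) t (s, r1)"
    and P: "P (output_edges n s)" by (auto simp: halts_with_def)
  from exec_finitary[OF t] obtain m where "\<And>r'. stake m r' = stake m r \<Longrightarrow>
      exec d (comparison_oracle f) c (input_store d n w, r') t (s, sdrop m r')" by auto
  with P show "\<exists>m. \<forall>r'. stake m r' = stake m r \<longrightarrow> (\<exists>t M. halts_with d c n w f r' t M \<and> P M)"
    unfolding halts_with_def by blast
qed

section \<open>Coefficients of a polynomial as digits of an integer\<close>

text \<open>
  With digits smaller than half the base in absolute value, the part below position \<open>t\<close> is less
  than half a unit at that position.
\<close>

lemma two_abs_sum_less: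
  fixes c :: "nat \<Rightarrow> int"
  assumes "\<And>s. \<bar>c s\<bar> < H"
  shows "2 * \<bar>\<Sum>s<t. c s * (2 * H) ^ s\<bar> < (2 * H) ^ t"
proof (induction t)
  case (Suc t)
  have H: "0 < H" using assms[of 0] by linarith
  have "2 * \<bar>\<Sum>s<Suc t. c s * (2 * H) ^ s\<bar>
      \<le> 2 * \<bar>\<Sum>s<t. c s * (2 * H) ^ s\<bar> + 2 * (\<bar>c t\<bar> * (2 * H) ^ t)"
    using H abs_triangle_ineq[of "\<Sum>s<t. c s * (2 * H) ^ s" "c t * (2 * H) ^ t"]
    by (simp add: abs_mult)
  also have "\<dots> < (2 * H) ^ t + 2 * ((H - 1) * (2 * H) ^ t)"
  proof -
    have "\<bar>c t\<bar> * (2 * H) ^ t \<le> (H - 1) * (2 * H) ^ t"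
      using assms[of t] H by (intro mult_right_mono) auto
    then show ?thesis using Suc by linarith
  qed
  also have "\<dots> \<le> (2 * H) ^ Suc t" using H by (simp add: algebra_simps)
  finally show ?case .
qed simp

text \<open>
  Coefficients may be negative, so a truncating division by \<open>(2 * H) ^ t\<close> could be off by one.
  Rounding to the nearest integer, that is, adding half a unit before dividing, removes exactly the
  lower coefficients.
\<close>

lemma coeff_zero_iff_digit_zero:
  fixes p :: "int poly"
  assumes H: "\<And>s. \<bar>coeff p s\<bar> < H"
  shows "(2 * poly p (2 * H) + (2 * H) ^ t) div (2 * (2 * H) ^ t) mod (2 * H) = 0 \<longleftrightarrow> coeff p t = 0"
proof -
  define X where "X = 2 * H"
  have X: "0 < X" using H[of 0] by (simp add: X_def)
  \<comment> \<open>the terms below position \<open>t\<close>, and those above it divided by \<open>X ^ Suc t\<close>\<close>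
  define lo where "lo = (\<Sum>s<t. coeff p s * X ^ s)"
  define hi where "hi = (\<Sum>s<degree p. coeff p (s + Suc t) * X ^ s)"
  have "poly p X = (\<Sum>s<degree p + Suc t. coeff p s * X ^ s)"
    unfolding poly_altdef
    by (rule sum.mono_neutral_left) (auto simp: coeff_eq_0)
  also have "\<dots> = (\<Sum>s<Suc t. coeff p s * X ^ s) + (\<Sum>s<degree p. coeff p (s + Suc t) * X ^ (s + Suc t))"
    using sum.atLeastLessThan_concat[of 0 "Suc t" "degree p + Suc t" "\<lambda>s. coeff p s * X ^ s"]
      sum.shift_bounds_nat_ivl[of "\<lambda>s. coeff p s * X ^ s" 0 "Suc t" "degree p"]
    by (simp add: lessThan_atLeast0)
  also have "(\<Sum>s<degree p. coeff p (s + Suc t) * X ^ (s + Suc t)) = X ^ t * (X * hi)"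
    by (simp add: hi_def sum_distrib_left power_add mult_ac)
  finally have eq: "2 * poly p X + X ^ t = (2 * lo + X ^ t) + (coeff p t + X * hi) * (2 * X ^ t)"
    by (simp add: lo_def algebra_simps)
  have "2 * \<bar>lo\<bar> < X ^ t"
    unfolding lo_def X_def by (rule two_abs_sum_less[OF H])
  then have "(2 * lo + X ^ t) div (2 * X ^ t) = 0"
    by (intro div_pos_pos_trivial) linarith+
  then have "(2 * poly p X + X ^ t) div (2 * X ^ t) = coeff p t + X * hi"
    unfolding eq using X by (subst div_mult_self1) auto
  moreover have "coeff p t mod X = 0 \<longleftrightarrow> coeff p t = 0"
  proof
    assume "coeff p t mod X = 0"
    then have "X dvd \<bar>coeff p t\<bar>" by (simp add: mod_eq_0_iff_dvd)
    then show "coeff p t = 0"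
      using zdvd_imp_le[of X "\<bar>coeff p t\<bar>"] H[of t] by (fastforce simp: X_def)
  qed simp
  ultimately show ?thesis by (simp add: X_def[symmetric])
qed

section \<open>Signed sums over perfect matchings with a given code\<close>

lemma address_bound: "i < n \<Longrightarrow> j < n \<Longrightarrow> i * n + j < n * (n :: nat)"
proof -
  assume "i < n" "j < n"
  then have "i * n + j < Suc i * n" by simp
  moreover have "Suc i * n \<le> n * n" using \<open>i < n\<close> by (intro mult_le_mono1) simp
  ultimately show ?thesis by linarith
qed

lemma address_inject:
  assumes "i * n + j = i' * n + j'" "j < n" "j' < (n :: nat)"
  shows "i = i' \<and> j = j'"
  using assms by (metis add.commute mod_mult_self3 mod_less div_mult_self3 div_less add_0 not_less_zero)

text \<open>
  The position \<open>(i, j)\<close> of a matrix has the address \<open>i * n + j\<close>, as in the memory of the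
  program. The predicate \<open>S\<close> says which positions may be used; it is restricted step by step
  while a matching is constructed.
\<close>

definition selections :: "nat \<Rightarrow> (nat \<Rightarrow> nat) \<Rightarrow> (nat \<Rightarrow> nat \<Rightarrow> bool) \<Rightarrow> nat \<Rightarrow> (nat \<Rightarrow> nat) set" where
  "selections n u S t = {p. p permutes {0..<n} \<and> (\<forall>i<n. S i (p i)) \<and> (\<Sum>i<n. u (i * n + p i)) = t}"

definition signed_sum :: "nat \<Rightarrow> (nat \<Rightarrow> nat) \<Rightarrow> (nat \<Rightarrow> nat \<Rightarrow> bool) \<Rightarrow> nat \<Rightarrow> (nat \<Rightarrow> int) \<Rightarrow> int" where
  "signed_sum n u S t r = (\<Sum>p\<in>selections n u S t. signof p * (\<Prod>i<n. r (i * n + p i)))"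

definition weight_mat :: "nat \<Rightarrow> (nat \<Rightarrow> nat) \<Rightarrow> (nat \<Rightarrow> nat \<Rightarrow> bool) \<Rightarrow> (nat \<Rightarrow> int) \<Rightarrow> int poly mat" where
  "weight_mat n u S r = mat n n (\<lambda>(i, j). if S i j then monom (r (i * n + j)) (u (i * n + j)) else 0)"

lemma finite_selections: "finite (selections n u S t)"
  by (rule finite_subset[OF _ finite_permutations[of "{0..<n}"]]) (auto simp: selections_def)

text \<open>
  In the expansion of the determinant over permutations, each product is a monomial whose exponent
  is the code of the permutation.
\<close>

lemma coeff_det_weight_mat:
  "coeff (Determinant.det (weight_mat n u S r)) t = signed_sum n u S t r"
proof -
  have M: "weight_mat n u S r \<in> carrier_mat n n" by (simp add: weight_mat_def)
  have prod: "(\<Prod>i<n. if S i (p i) then monom (r (i * n + p i)) (u (i * n + p i)) else 0)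
     = (if \<forall>i<n. S i (p i) then monom (\<Prod>i<n. r (i * n + p i)) (\<Sum>i<n. u (i * n + p i)) else 0)"
    for p :: "nat \<Rightarrow> nat"
  proof (cases "\<forall>i<n. S i (p i)")
    case True
    have "(\<Prod>i<m. monom (r (i * n + p i)) (u (i * n + p i)))
        = monom (\<Prod>i<m. r (i * n + p i)) (\<Sum>i<m. u (i * n + p i))" for m
      by (induction m) (simp_all add: mult_monom monom_0 one_pCons)
    with True show ?thesis by simp
  next
    case False
    then show ?thesis by auto
  qed
  have "coeff (Determinant.det (weight_mat n u S r)) t
    = (\<Sum>p\<in>{p. p permutes {0..<n}}. coeff (signof p * (\<Prod>i<n. weight_mat n u S r $$ (i, p i))) t)"
    by (simp add: det_def'[OF M] coeff_sum lessThan_atLeast0)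
  also have "\<dots> = (\<Sum>p\<in>{p. p permutes {0..<n}}. if p \<in> selections n u S t
      then signof p * (\<Prod>i<n. r (i * n + p i)) else 0)"
  proof (rule sum.cong[OF refl])
    fix p assume p: "p \<in> {p. p permutes {0..<n}}"
    then have "p i < n" if "i < n" for i using that permutes_in_image[of p "{0..<n}" i] by simp
    then have "(\<Prod>i<n. weight_mat n u S r $$ (i, p i))
      = (\<Prod>i<n. if S i (p i) then monom (r (i * n + p i)) (u (i * n + p i)) else 0)"
      by (intro prod.cong) (auto simp: weight_mat_def)
    with p show "coeff (signof p * (\<Prod>i<n. weight_mat n u S r $$ (i, p i))) t
      = (if p \<in> selections n u S t then signof p * (\<Prod>i<n. r (i * n + p i)) else 0)"
      unfolding prod by (cases p rule: sign_cases) (auto simp: selections_def)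
  qed
  also have "\<dots> = signed_sum n u S t r"
    unfolding signed_sum_def
    by (rule sum.mono_neutral_cong_right) (auto simp: finite_permutations selections_def)
  finally show ?thesis .
qed

lemma poly_det_weight_mat:
  "poly (Determinant.det (weight_mat n u S r)) x
    = Determinant.det (mat n n (\<lambda>(i, j). if S i j then r (i * n + j) * x ^ u (i * n + j) else 0))"
  by (rule poly_det_cong[of _ n]) (auto simp: weight_mat_def poly_monom)

lemma abs_signed_sum_le:
  assumes r: "\<And>a. a < n * n \<Longrightarrow> \<bar>r a\<bar> \<le> R"
  shows "\<bar>signed_sum n u S t r\<bar> \<le> fact n * R ^ n"
proof -
  have "\<bar>signof p * (\<Prod>i<n. r (i * n + p i))\<bar> \<le> R ^ n" if "p permutes {0..<n}" for p
  proof -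
    have "\<bar>r (i * n + p i)\<bar> \<le> R" if "i < n" for i
    proof (rule r[OF address_bound[OF that]])
      show "p i < n" using that permutes_in_image[OF \<open>p permutes _\<close>, of i] by simp
    qed
    then have "(\<Prod>i<n. \<bar>r (i * n + p i)\<bar>) \<le> (\<Prod>i<n. R)" by (intro prod_mono) auto
    moreover have "\<bar>signof p :: int\<bar> = 1" by (cases p rule: sign_cases) auto
    ultimately show ?thesis by (simp add: abs_mult abs_prod)
  qed
  then have "\<bar>signed_sum n u S t r\<bar> \<le> (\<Sum>p\<in>selections n u S t. R ^ n)"
    unfolding signed_sum_def by (intro order.trans[OF sum_abs sum_mono]) (auto simp: selections_def)
  also have "\<dots> = int (card (selections n u S t)) * R ^ n" by simp
  also have "\<dots> \<le> int (fact n) * R ^ n"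
  proof (rule mult_right_mono)
    have "card (selections n u S t) \<le> card {p. p permutes {0..<n}}"
      by (rule card_mono) (auto simp: finite_permutations selections_def)
    then have "card (selections n u S t) \<le> fact n"
      by (simp add: card_permutations[of _ n])
    then show "int (card (selections n u S t)) \<le> int (fact n)"
      by (simp only: of_nat_le_iff)
    show "0 \<le> R ^ n"
      by (cases "n = 0") (use order.trans[OF abs_ge_zero r[of 0]] in auto)
  qed
  finally show ?thesis by simp
qed

lemma signed_sum_nonzeroD: "signed_sum n u S t r \<noteq> 0 \<Longrightarrow> selections n u S t \<noteq> {}"
  by (auto simp: signed_sum_def)

text \<open>
  The permutations are classified by their value at \<open>i\<close>, so the signed sum is the total of
  the signed sums in which the column of row \<open>i\<close> is prescribed.
\<close>

lemma signed_sum_row: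
  assumes "i < n" "signed_sum n u S t r \<noteq> 0"
  shows "\<exists>j<n. signed_sum n u (\<lambda>k l. S k l \<and> (k = i \<longrightarrow> l = j)) t r \<noteq> 0"
proof (rule ccontr)
  assume "\<not> ?thesis"
  then have 0: "signed_sum n u (\<lambda>k l. S k l \<and> (k = i \<longrightarrow> l = j)) t r = 0" if "j < n" for j
    using that by auto
  have "selections n u S t = (\<Union>j\<in>{..<n}. selections n u (\<lambda>k l. S k l \<and> (k = i \<longrightarrow> l = j)) t)"
  proof (intro equalityI subsetI)
    fix p assume p: "p \<in> selections n u S t"
    then have "p i < n" using assms(1) permutes_in_image[of p "{0..<n}" i] by (auto simp: selections_def)
    with p show "p \<in> (\<Union>j\<in>{..<n}. selections n u (\<lambda>k l. S k l \<and> (k = i \<longrightarrow> l = j)) t)"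
      by (auto simp: selections_def)
  qed (auto simp: selections_def)
  then have "signed_sum n u S t r = (\<Sum>j<n. signed_sum n u (\<lambda>k l. S k l \<and> (k = i \<longrightarrow> l = j)) t r)"
    unfolding signed_sum_def
  proof (simp only:, subst sum.UNION_disjoint)
    show "\<forall>j\<in>{..<n}. \<forall>j'\<in>{..<n}. j \<noteq> j' \<longrightarrow>
        selections n u (\<lambda>k l. S k l \<and> (k = i \<longrightarrow> l = j)) t
        \<inter> selections n u (\<lambda>k l. S k l \<and> (k = i \<longrightarrow> l = j')) t = {}"
      using assms(1) by (auto simp: selections_def)
  qed (simp_all add: finite_selections)
  with 0 assms(2) show False by simp
qed

text \<open>
  A permutation uses each address at most once, so every product contains a given variable at most
  to the first power.
\<close>

lemma multi_affine_signed_sum: "multi_affine (signed_sum n u S t)"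
  unfolding multi_affine_def
proof (intro allI)
  fix r :: "nat \<Rightarrow> int" and a :: nat
  have "\<exists>\<alpha> \<beta>. \<forall>x. signof p * (\<Prod>i<n. (r(a := x)) (i * n + p i)) = \<alpha> + \<beta> * x"
    if p: "p \<in> selections n u S t" for p
  proof (cases "\<exists>k<n. a = k * n + p k")
    case True
    then obtain k where k: "k < n" "a = k * n + p k" by blast
    have pn: "p i < n" if "i < n" for i
      using p that permutes_in_image[of p "{0..<n}" i] by (auto simp: selections_def)
    have "(\<Prod>i<n. (r(a := x)) (i * n + p i)) = x * (\<Prod>i\<in>{..<n} - {k}. r (i * n + p i))" for x
    proof -
      have "(\<Prod>i<n. (r(a := x)) (i * n + p i))
          = (r(a := x)) (k * n + p k) * (\<Prod>i\<in>{..<n} - {k}. (r(a := x)) (i * n + p i))"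
        using k by (intro prod.remove) auto
      also have "(\<Prod>i\<in>{..<n} - {k}. (r(a := x)) (i * n + p i)) = (\<Prod>i\<in>{..<n} - {k}. r (i * n + p i))"
        using k pn address_inject[of _ n _ k "p k"] by (intro prod.cong) auto
      finally show ?thesis using k by simp
    qed
    then show ?thesis
      by (intro exI[of _ 0] exI[of _ "signof p * (\<Prod>i\<in>{..<n} - {k}. r (i * n + p i))"]) (simp add: mult_ac)
  next
    case False
    then have "(\<Prod>i<n. (r(a := x)) (i * n + p i)) = (\<Prod>i<n. r (i * n + p i))" for x
      by (intro prod.cong) auto
    then show ?thesis
      by (intro exI[of _ "signof p * (\<Prod>i<n. r (i * n + p i))"] exI[of _ 0]) simp
  qed
  then obtain \<alpha> \<beta> where ab: "\<And>p x. p \<in> selections n u S t \<Longrightarrow>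
      signof p * (\<Prod>i<n. (r(a := x)) (i * n + p i)) = \<alpha> p + \<beta> p * x" by metis
  have "signed_sum n u S t (r(a := x))
      = (\<Sum>p\<in>selections n u S t. \<alpha> p) + (\<Sum>p\<in>selections n u S t. \<beta> p) * x" for x
  proof -
    have "signed_sum n u S t (r(a := x)) = (\<Sum>p\<in>selections n u S t. \<alpha> p + \<beta> p * x)"
      unfolding signed_sum_def by (rule sum.cong[OF refl ab])
    then show ?thesis by (simp add: sum.distrib sum_distrib_right)
  qed
  then show "\<exists>\<alpha> \<beta>. \<forall>x. signed_sum n u S t (r(a := x)) = \<alpha> + \<beta> * x" by blast
qed

text \<open>
  If exactly the edges of \<open>p\<close> get the value 1, only the product of \<open>p\<close> itself is nonzero. This is
  the point where the signed sum does not vanish.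
\<close>

lemma signed_sum_indicator:
  assumes p: "p \<in> selections n u S t"
  shows "signed_sum n u S t (\<lambda>a. of_bool (a mod n = p (a div n))) = signof p"
proof -
  have pn: "q i < n" if "q \<in> selections n u S t" "i < n" for q i
    using that permutes_in_image[of q "{0..<n}" i] by (auto simp: selections_def)
  have prod: "(\<Prod>i<n. of_bool ((i * n + q i) mod n = p ((i * n + q i) div n)) :: int) = of_bool (q = p)"
    if q: "q \<in> selections n u S t" for q
  proof -
    have e: "(\<Prod>i<n. of_bool ((i * n + q i) mod n = p ((i * n + q i) div n)) :: int)
       = (\<Prod>i<n. of_bool (q i = p i))"
      using pn[OF q] by (intro prod.cong) auto
    show ?thesis
    proof (cases "q = p")
      case True
      then show ?thesis unfolding e by simp
    next
      case False
      then obtain i where i: "q i \<noteq> p i" by auto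
      then have "i < n"
        using p q permutes_not_in[of p "{0..<n}" i] permutes_not_in[of q "{0..<n}" i]
        by (cases "i < n") (auto simp: selections_def)
      then have "(\<Prod>i<n. of_bool (q i = p i) :: int) = 0" using i by (intro prod_zero) auto
      then show ?thesis unfolding e using False by simp
    qed
  qed
  have "signed_sum n u S t (\<lambda>a. of_bool (a mod n = p (a div n)))
      = (\<Sum>q\<in>selections n u S t. if q = p then signof q else 0)"
    unfolding signed_sum_def by (rule sum.cong[OF refl], subst prod) auto
  then show ?thesis using p by (simp add: finite_selections)
qed

lemma signed_sum_cong:
  assumes "\<And>a. a < n * n \<Longrightarrow> r a = r' a" and "\<And>i j. i < n \<Longrightarrow> j < n \<Longrightarrow> S i j = S' i j"
  shows "signed_sum n u S t r = signed_sum n u S' t r'"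
proof -
  have pn: "p i < n" if "p permutes {0..<n}" "i < n" for p i
    using that permutes_in_image[of p "{0..<n}" i] by auto
  have "i * n + p i < n * n" if "p permutes {0..<n}" "i < n" for p i
    using address_bound[OF that(2) pn[OF that]] .
  moreover have "selections n u S t = selections n u S' t"
    unfolding selections_def using assms(2) pn by auto
  ultimately show ?thesis unfolding signed_sum_def using assms(1)
    by (auto intro!: sum.cong prod.cong simp: selections_def)
qed

text \<open>
  There are \<open>n * n\<close> variables of \<open>2 * n\<close> random bits each, so the error is at most
  \<open>n * n / 4 ^ n\<close>.
\<close>

lemma prob_signed_sum_zero:
  assumes n: "n \<ge> 1" and p: "p \<in> selections n u S t"
  shows "measure random_bits
    {r. signed_sum n u S t (\<lambda>a. int (bits_value (2 * n) (sdrop (a * (2 * n)) r))) = 0} \<le> 1 / 2"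
proof -
  define v :: "nat \<Rightarrow> int" where "v = (\<lambda>a. of_bool (a mod n = p (a div n)))"
  have "signed_sum n u S t v \<noteq> 0"
    unfolding v_def signed_sum_indicator[OF p] by (cases p rule: sign_cases) auto
  from prob_multi_affine_zero[OF multi_affine_signed_sum this, of 0 "n * n" "2 * n"]
  have "measure random_bits {r. signed_sum n u S t (\<lambda>b. if 0 \<le> b \<and> b < 0 + n * n
      then int (bits_value (2 * n) (sdrop ((b - 0) * (2 * n)) r)) else v b) = 0}
    \<le> real (n * n) / 2 ^ (2 * n)" .
  also have "(\<lambda>r. signed_sum n u S t (\<lambda>b. if 0 \<le> b \<and> b < 0 + n * n
      then int (bits_value (2 * n) (sdrop ((b - 0) * (2 * n)) r)) else v b))
    = (\<lambda>r. signed_sum n u S t (\<lambda>a. int (bits_value (2 * n) (sdrop (a * (2 * n)) r))))"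
    by (intro ext signed_sum_cong) auto
  also have "real (n * n) / 2 ^ (2 * n) \<le> 1 / 2"
  proof -
    have "n * n * 2 \<le> 2 ^ (2 * n)" using n
    proof (induction n rule: dec_induct)
      case (step n)
      have "n \<le> n * n" "1 \<le> n * n" using step(1) by simp_all
      moreover have "Suc n * Suc n = n * n + 2 * n + 1" by simp
      ultimately have "Suc n * Suc n \<le> 4 * (n * n)" by linarith
      then have "Suc n * Suc n * 2 \<le> 4 * (n * n * 2)" by simp
      also have "\<dots> \<le> 4 * 2 ^ (2 * n)" using step by simp
      finally show ?case by simp
    qed simp
    then have "real (n * n * 2) \<le> 2 ^ (2 * n)" by (metis of_nat_le_iff of_nat_numeral of_nat_power)
    then show ?thesis by (simp add: field_simps)
  qed
  finally show ?thesis by simp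
qed

lemma finitary_signed_sum_zero:
  "finitary (\<lambda>r. signed_sum n u S t (\<lambda>a. int (bits_value m (sdrop (a * m) r))) = 0)"
  unfolding finitary_def
proof (intro allI impI exI)
  fix r r'
  assume 0: "signed_sum n u S t (\<lambda>a. int (bits_value m (sdrop (a * m) r))) = 0"
    and eq: "stake ((n * n) * m) r' = stake ((n * n) * m) r"
  have "signed_sum n u S t (\<lambda>a. int (bits_value m (sdrop (a * m) r')))
      = signed_sum n u S t (\<lambda>a. int (bits_value m (sdrop (a * m) r)))"
    by (rule signed_sum_cong) (simp_all add: bits_value_sdrop_cong[OF eq])
  with 0 show "signed_sum n u S t (\<lambda>a. int (bits_value m (sdrop (a * m) r'))) = 0" by simp
qed

section \<open>Digit expansions\<close>

lemma digit_sum_less: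
  fixes a :: "nat \<Rightarrow> nat"
  assumes "\<And>k. k < d \<Longrightarrow> a k < B"
  shows "(\<Sum>k<d. a k * B ^ k) < B ^ d"
  using assms
proof (induction d)
  case (Suc d)
  then have "(\<Sum>k<d. a k * B ^ k) < B ^ d" by simp
  moreover have "Suc (a d) * B ^ d \<le> B * B ^ d"
    using Suc.prems[of d] by (intro mult_le_mono1) simp
  ultimately show ?case by simp
qed simp

lemma digit_sum_digit:
  fixes a :: "nat \<Rightarrow> nat"
  assumes "\<And>k. k < d \<Longrightarrow> a k < B" and "k < d"
  shows "(\<Sum>k<d. a k * B ^ k) div B ^ k mod B = a k"
proof -
  have B: "0 < B" using assms by (metis not_less_zero gr0I)
  have "(\<Sum>l<d. a l * B ^ l) = (\<Sum>l<Suc k. a l * B ^ l) + (\<Sum>l<d - Suc k. a (l + Suc k) * B ^ (l + Suc k))"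
    using sum.atLeastLessThan_concat[of 0 "Suc k" d "\<lambda>l. a l * B ^ l"]
      sum.shift_bounds_nat_ivl[of "\<lambda>l. a l * B ^ l" 0 "Suc k" "d - Suc k"] assms(2)
    by (simp add: lessThan_atLeast0)
  also have "(\<Sum>l<d - Suc k. a (l + Suc k) * B ^ (l + Suc k))
      = B ^ k * (B * (\<Sum>l<d - Suc k. a (l + Suc k) * B ^ l))"
    by (simp add: sum_distrib_left power_add mult_ac)
  finally have "(\<Sum>l<d. a l * B ^ l)
    = (\<Sum>l<k. a l * B ^ l) + (a k + B * (\<Sum>l<d - Suc k. a (l + Suc k) * B ^ l)) * B ^ k"
    by (simp add: algebra_simps)
  moreover have "(\<Sum>l<k. a l * B ^ l) < B ^ k" using assms by (intro digit_sum_less) auto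
  ultimately have "(\<Sum>l<d. a l * B ^ l) div B ^ k = a k + B * (\<Sum>l<d - Suc k. a (l + Suc k) * B ^ l)"
    using B by simp
  then show ?thesis using assms by simp
qed

section \<open>Perfect matchings as permutations\<close>

text \<open>
  Vertices are numbered from 1, whereas permutations act on \<open>{0..<n}\<close>.
\<close>

definition matching_of :: "nat \<Rightarrow> (nat \<Rightarrow> nat) \<Rightarrow> (nat \<times> nat) set" where
  "matching_of n p = (\<lambda>i. (Suc i, Suc (p i))) ` {..<n}"

lemma sum_matching_of: "(\<Sum>e\<in>matching_of n p. g e) = (\<Sum>i<n. g (Suc i, Suc (p i)))"
  unfolding matching_of_def by (subst sum.reindex) (auto simp: inj_on_def)

lemma perfect_matching_of:
  assumes p: "p permutes {0..<n}"
  shows "perfect_matching n (matching_of n p)"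
  unfolding perfect_matching_def
proof (intro conjI ballI)
  have pn: "p i < n" if "i < n" for i using p that permutes_in_image[of p "{0..<n}" i] by auto
  then show "matching_of n p \<subseteq> edges n" by (auto simp: matching_of_def edges_def Suc_le_eq)
  fix i assume i: "i \<in> {1..n}"
  show "\<exists>!j. (i, j) \<in> matching_of n p"
    using i by (intro ex1I[of _ "Suc (p (i - 1))"]) (auto simp: matching_of_def image_iff intro!: bexI[of _ "i - 1"])
  obtain k where k: "p k = i - 1" using permutes_surj[OF p] by (metis surjD)
  have "i - 1 < n" using i by auto
  then have "k < n" using k permutes_in_image[OF p, of k] by simp
  then show "\<exists>!k. (k, i) \<in> matching_of n p"
    using i k permutes_inj[OF p]
    by (intro ex1I[of _ "Suc k"]) (auto simp: matching_of_def image_iff inj_def intro!: bexI[of _ k])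
qed

lemma perfect_matching_imp_matching_of:
  assumes M: "perfect_matching n M"
  obtains p where "p permutes {0..<n}" "M = matching_of n p"
proof -
  have sub: "M \<subseteq> {1..n} \<times> {1..n}" using M by (simp add: perfect_matching_def edges_def)
  define p where "p i = (if i < n then (THE j. (Suc i, j) \<in> M) - 1 else i)" for i
  have in_M: "(Suc i, Suc (p i)) \<in> M" if "i < n" for i
  proof -
    have "\<exists>!j. (Suc i, j) \<in> M" using M that by (auto simp: perfect_matching_def)
    then have "(Suc i, THE j. (Suc i, j) \<in> M) \<in> M" by (rule theI')
    moreover from this have "1 \<le> (THE j. (Suc i, j) \<in> M)" using sub by auto
    ultimately show ?thesis using that by (simp add: p_def)
  qed
  have unique_l: "j = j'" if "(i, j) \<in> M" "(i, j') \<in> M" for i j j'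
  proof -
    have "i \<in> {1..n}" using that sub by auto
    then show ?thesis using M that unfolding perfect_matching_def by blast
  qed
  have unique_r: "i = i'" if "(i, j) \<in> M" "(i', j) \<in> M" for i i' j
  proof -
    have "j \<in> {1..n}" using that sub by auto
    then show ?thesis using M that unfolding perfect_matching_def by blast
  qed
  have pn: "p i < n" if "i < n" for i using in_M[OF that] sub by auto
  have "inj_on p {0..<n}"
    using in_M unique_r by (auto simp: inj_on_def) (metis Suc_inject)
  moreover have "p ` {0..<n} \<subseteq> {0..<n}" using pn by auto
  ultimately have "bij_betw p {0..<n} {0..<n}"
    by (simp add: bij_betw_def endo_inj_surj)
  then have "p permutes {0..<n}" by (rule bij_imp_permutes) (simp add: p_def)
  moreover have "M = matching_of n p"
  proof (intro equalityI subsetI)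
    fix e assume "e \<in> M"
    moreover obtain a j where a: "e = (a, j)" by (cases e)
    moreover from calculation obtain i where "a = Suc i" "i < n"
      using sub by (cases a) auto
    ultimately have e: "e = (Suc i, j)" "i < n" "(Suc i, j) \<in> M" by auto
    then show "e \<in> matching_of n p"
      using unique_l[OF in_M[OF e(2)] e(3)] by (auto simp: matching_of_def)
  qed (auto simp: matching_of_def in_M)
  ultimately show ?thesis by (rule that)
qed

section \<open>Cost of executions in bounded memory\<close>

lemma int_size_le_iff: "int_size k \<le> Suc m \<longleftrightarrow> \<bar>k\<bar> < 2 ^ m"
  using bitlen_le_iff_power[of "\<bar>k\<bar>" "int m"] by (simp add: int_size_def nat_le_iff)

lemma int_size_pos: "1 \<le> int_size k"
  by (simp add: int_size_def)

lemma int_size_abs: "\<bar>k\<bar> < 2 ^ (int_size k - 1)"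
  using int_size_le_iff[of k "int_size k - 1"] int_size_pos[of k] by simp

lemma int_size_add: "int_size (a + b) \<le> int_size a + int_size b"
proof -
  define p where "p = int_size a - 1"
  define q where "q = int_size b - 1"
  have "\<bar>a\<bar> < 2 ^ p" "\<bar>b\<bar> < 2 ^ q" using int_size_abs by (simp_all add: p_def q_def)
  moreover have "(2::int) ^ p \<le> 2 ^ (p + q)" "(2::int) ^ q \<le> 2 ^ (p + q)"
    by (auto intro!: power_increasing)
  ultimately have "\<bar>a + b\<bar> < 2 ^ Suc (p + q)" unfolding power_Suc by linarith
  then have "int_size (a + b) \<le> Suc (Suc (p + q))" by (simp only: int_size_le_iff)
  then show ?thesis using int_size_pos[of a] int_size_pos[of b] by (simp add: p_def q_def)
qed

lemma int_size_uminus [simp]: "int_size (- a) = int_size a"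
  by (simp add: int_size_def)

lemma int_size_mult: "int_size (a * b) \<le> int_size a + int_size b"
proof -
  define p where "p = int_size a - 1"
  define q where "q = int_size b - 1"
  have "\<bar>a\<bar> < 2 ^ p" "\<bar>b\<bar> < 2 ^ q" using int_size_abs by (simp_all add: p_def q_def)
  then have "\<bar>a\<bar> * \<bar>b\<bar> < 2 ^ p * 2 ^ q" by (intro mult_strict_mono') auto
  then have "\<bar>a * b\<bar> < 2 ^ (p + q)" by (simp add: abs_mult power_add)
  then have "int_size (a * b) \<le> Suc (p + q)" by (simp only: int_size_le_iff)
  then show ?thesis using int_size_pos[of a] int_size_pos[of b] by (simp add: p_def q_def)
qed

lemma int_size_mono: "\<bar>a\<bar> \<le> \<bar>b\<bar> \<Longrightarrow> int_size a \<le> int_size b"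
  using int_size_abs[of b] int_size_le_iff[of a "int_size b - 1"] int_size_pos[of b] by simp

lemma int_size_mod: "int_size (a mod b) \<le> int_size a + int_size b"
proof (cases "b = 0")
  case False
  then have "\<bar>a mod b\<bar> \<le> \<bar>b\<bar>" by (simp add: abs_mod_less less_imp_le)
  then show ?thesis using int_size_mono by (meson trans_le_add2)
qed simp

primrec size_bound :: "nat \<Rightarrow> aexp \<Rightarrow> nat" where
  "size_bound L (Num k) = int_size k"
| "size_bound L (Elem x i) = L"
| "size_bound L (Plus a b) = size_bound L a + size_bound L b"
| "size_bound L (Minus a b) = size_bound L a + size_bound L b"
| "size_bound L (Times a b) = size_bound L a + size_bound L b"
| "size_bound L (Div a b) = size_bound L a + size_bound L b"
| "size_bound L (Mod a b) = size_bound L a + size_bound L b"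

lemma int_size_aval:
  assumes "\<forall>x i. int_size (s x i) \<le> L"
  shows "int_size (aval s a) \<le> size_bound L a"
proof (induction a)
  case (Plus a b)
  then show ?case using int_size_add[of "aval s a" "aval s b"] by simp
next
  case (Minus a b)
  then show ?case using int_size_add[of "aval s a" "- aval s b"] by simp
next
  case (Times a b)
  then show ?case using int_size_mult[of "aval s a" "aval s b"] by simp
next
  case (Div a b)
  then show ?case using int_size_mono[OF abs_div_le[of "aval s a" "aval s b"]] by simp
next
  case (Mod a b)
  then show ?case using int_size_mod[of "aval s a" "aval s b"] by simp
qed (simp_all add: assms)

primrec acost_bound :: "nat \<Rightarrow> aexp \<Rightarrow> nat" where
  "acost_bound L (Num k) = int_size k"
| "acost_bound L (Elem x i) = acost_bound L i + size_bound L i + L"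
| "acost_bound L (Plus a b) = acost_bound L a + acost_bound L b + size_bound L a + size_bound L b"
| "acost_bound L (Minus a b) = acost_bound L a + acost_bound L b + size_bound L a + size_bound L b"
| "acost_bound L (Times a b) = acost_bound L a + acost_bound L b + size_bound L a * size_bound L b"
| "acost_bound L (Div a b) = acost_bound L a + acost_bound L b + size_bound L a * size_bound L b"
| "acost_bound L (Mod a b) = acost_bound L a + acost_bound L b + size_bound L a * size_bound L b"

lemma acost_le:
  assumes "\<forall>x i. int_size (s x i) \<le> L"
  shows "acost s a \<le> acost_bound L a"
proof (induction a)
  case (Elem x i)
  then show ?case using assms int_size_aval[OF assms, where a = i] by (simp add: add_mono)
qed (simp_all add: add_mono mult_mono int_size_aval[OF assms])

primrec bcost_bound :: "nat \<Rightarrow> bexp \<Rightarrow> nat" where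
  "bcost_bound L (Less a b) = acost_bound L a + acost_bound L b + size_bound L a + size_bound L b"
| "bcost_bound L (Equal a b) = acost_bound L a + acost_bound L b + size_bound L a + size_bound L b"
| "bcost_bound L (Neg b) = 1 + bcost_bound L b"
| "bcost_bound L (Conj a b) = 1 + bcost_bound L a + bcost_bound L b"

lemma bcost_le:
  assumes "\<forall>x i. int_size (s x i) \<le> L"
  shows "bcost s b \<le> bcost_bound L b"
  by (induction b) (simp_all add: add_mono acost_le[OF assms] int_size_aval[OF assms])

text \<open>
  Bounds the cost of a single instruction of the program when all cells have at most \<open>L\<close> bits. The
  costs of all parts of the program are added up rather than maximized, which keeps the bound a
  polynomial in \<open>L\<close>.
\<close>

primrec instr_cost :: "nat \<Rightarrow> nat \<Rightarrow> com \<Rightarrow> nat" where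
  "instr_cost d L Skip = 1"
| "instr_cost d L (Assign x i a)
     = 1 + acost_bound L i + acost_bound L a + size_bound L i + size_bound L a"
| "instr_cost d L (Flip x) = 1"
| "instr_cost d L (Query x y z) = 1 + 2 * d * L"
| "instr_cost d L (Seq c1 c2) = instr_cost d L c1 + instr_cost d L c2"
| "instr_cost d L (If b c1 c2) = 1 + bcost_bound L b + instr_cost d L c1 + instr_cost d L c2"
| "instr_cost d L (While b c) = 1 + bcost_bound L b + instr_cost d L c"

text \<open>
  The same executions, but with unit cost and under the condition that every value written is
  smaller than \<open>\<beta>\<close> in absolute value. The sizes of the addresses are bounded along with them,
  as these are computed from the cells by the fixed expressions of the program.
\<close>

inductive bexec ::
  "nat \<Rightarrow> comparison_oracle \<Rightarrow> int \<Rightarrow> com \<Rightarrow> store \<times> bool stream \<Rightarrow> nat \<Rightarrow> store \<times> bool stream \<Rightarrow> bool"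
  for d :: nat and orc :: comparison_oracle and \<beta> :: int
where
  bexec_Skip: "bexec d orc \<beta> Skip (s, r) 1 (s, r)"
| bexec_Assign: "\<bar>aval s a\<bar> < \<beta> \<Longrightarrow>
    bexec d orc \<beta> (Assign x i a) (s, r) 1 (s(x := (s x)(aval s i := aval s a)), r)"
| bexec_Flip: "1 < \<beta> \<Longrightarrow>
    bexec d orc \<beta> (Flip x) (s, r) 1 (s(x := (s x)(0 := of_bool (shd r))), stl r)"
| bexec_Query: "1 < \<beta> \<Longrightarrow>
    bexec d orc \<beta> (Query x y z) (s, r) 1
       (s(x := (s x)(0 := of_bool (orc (vector_at d s y) (vector_at d s z)))), r)"
| bexec_Seq:
    "bexec d orc \<beta> c1 \<sigma>1 t1 \<sigma>2 \<Longrightarrow> bexec d orc \<beta> c2 \<sigma>2 t2 \<sigma>3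
      \<Longrightarrow> bexec d orc \<beta> (Seq c1 c2) \<sigma>1 (t1 + t2) \<sigma>3"
| bexec_IfTrue:
    "bval s b \<Longrightarrow> bexec d orc \<beta> c1 (s, r) t \<sigma>
      \<Longrightarrow> bexec d orc \<beta> (If b c1 c2) (s, r) (1 + t) \<sigma>"
| bexec_IfFalse:
    "\<not> bval s b \<Longrightarrow> bexec d orc \<beta> c2 (s, r) t \<sigma>
      \<Longrightarrow> bexec d orc \<beta> (If b c1 c2) (s, r) (1 + t) \<sigma>"
| bexec_WhileFalse:
    "\<not> bval s b \<Longrightarrow> bexec d orc \<beta> (While b c) (s, r) 1 (s, r)"
| bexec_WhileTrue:
    "bval s b \<Longrightarrow> bexec d orc \<beta> c (s, r) t1 \<sigma>2 \<Longrightarrow> bexec d orc \<beta> (While b c) \<sigma>2 t2 \<sigma>3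
      \<Longrightarrow> bexec d orc \<beta> (While b c) (s, r) (1 + t1 + t2) \<sigma>3"

text \<open>
  The bridge between the two measures of cost: the boundedness of memory is maintained along
  the execution and bounds every single instruction.
\<close>

lemma bexec_imp_exec:
  assumes "bexec d orc (2 ^ L) c \<sigma> k \<sigma>'" and "\<forall>x i. \<bar>fst \<sigma> x i\<bar> < 2 ^ L"
  shows "(\<exists>t \<le> k * instr_cost d (Suc L) c. exec d orc c \<sigma> t \<sigma>') \<and> (\<forall>x i. \<bar>fst \<sigma>' x i\<bar> < 2 ^ L)"
  using assms
proof (induction rule: bexec.induct)
  case (bexec_Skip s r)
  then show ?case using exec_Skip[of d orc s r] by auto
next
  case (bexec_Assign s a x i r)
  then have sz: "\<forall>x i. int_size (s x i) \<le> Suc L" by (simp add: int_size_le_iff)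
  have "1 + acost s i + acost s a + int_size (aval s i) + int_size (aval s a)
      \<le> 1 * instr_cost d (Suc L) (Assign x i a)"
    by (simp add: add_mono acost_le[OF sz] int_size_aval[OF sz])
  then show ?case using exec_Assign[of d orc x i a s r] bexec_Assign by auto
next
  case (bexec_Flip x s r)
  then show ?case using exec_Flip[of d orc x s r] by auto
next
  case (bexec_Query x y z s r)
  then have sz: "\<forall>x i. int_size (s x i) \<le> Suc L" by (simp add: int_size_le_iff)
  have "(\<Sum>k\<leftarrow>vector_at d s y. int_size k) \<le> d * Suc L" for y
  proof -
    have "(\<Sum>k\<leftarrow>vector_at d s y. int_size k) \<le> (\<Sum>k\<leftarrow>vector_at d s y. Suc L)"
      using sz by (intro sum_list_mono) (auto simp: vector_at_def)
    then show ?thesis by (simp add: vector_at_def sum_list_triv)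
  qed
  from this[of y] this[of z]
  have "1 + (\<Sum>k\<leftarrow>vector_at d s y. int_size k) + (\<Sum>k\<leftarrow>vector_at d s z. int_size k)
     \<le> 1 * instr_cost d (Suc L) (Query x y z)" by simp
  then show ?case using exec_Query[of d orc x y z s r] bexec_Query by auto
next
  case (bexec_Seq c1 \<sigma>1 k1 \<sigma>2 c2 k2 \<sigma>3)
  then obtain t1 t2 where t: "t1 \<le> k1 * instr_cost d (Suc L) c1" "exec d orc c1 \<sigma>1 t1 \<sigma>2"
      "t2 \<le> k2 * instr_cost d (Suc L) c2" "exec d orc c2 \<sigma>2 t2 \<sigma>3" by auto
  then have "t1 + t2 \<le> (k1 + k2) * instr_cost d (Suc L) (Seq c1 c2)"
    by (simp add: algebra_simps)
  then show ?case using exec_Seq[OF t(2,4)] bexec_Seq by blast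
next
  case (bexec_IfTrue s b c1 r k \<sigma> c2)
  then have sz: "\<forall>x i. int_size (s x i) \<le> Suc L" by (simp add: int_size_le_iff)
  from bexec_IfTrue obtain t where t: "t \<le> k * instr_cost d (Suc L) c1" "exec d orc c1 (s, r) t \<sigma>"
    by auto
  then have "1 + bcost s b + t \<le> (1 + k) * instr_cost d (Suc L) (If b c1 c2)"
    using bcost_le[OF sz, where b = b] by (simp add: algebra_simps)
  then show ?case using exec_IfTrue[OF bexec_IfTrue.hyps(1) t(2)] bexec_IfTrue by blast
next
  case (bexec_IfFalse s b c2 r k \<sigma> c1)
  then have sz: "\<forall>x i. int_size (s x i) \<le> Suc L" by (simp add: int_size_le_iff)
  from bexec_IfFalse obtain t where t: "t \<le> k * instr_cost d (Suc L) c2" "exec d orc c2 (s, r) t \<sigma>"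
    by auto
  then have "1 + bcost s b + t \<le> (1 + k) * instr_cost d (Suc L) (If b c1 c2)"
    using bcost_le[OF sz, where b = b] by (simp add: algebra_simps)
  then show ?case using exec_IfFalse[OF bexec_IfFalse.hyps(1) t(2)] bexec_IfFalse by blast
next
  case (bexec_WhileFalse s b c r)
  then have sz: "\<forall>x i. int_size (s x i) \<le> Suc L" by (simp add: int_size_le_iff)
  have "1 + bcost s b \<le> 1 * instr_cost d (Suc L) (While b c)"
    using bcost_le[OF sz, where b = b] by simp
  then show ?case using exec_WhileFalse[OF bexec_WhileFalse.hyps(1)] bexec_WhileFalse by blast
next
  case (bexec_WhileTrue s b c r k1 \<sigma>2 k2 \<sigma>3)
  then have sz: "\<forall>x i. int_size (s x i) \<le> Suc L" by (simp add: int_size_le_iff)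
  from bexec_WhileTrue obtain t1 t2 where t: "t1 \<le> k1 * instr_cost d (Suc L) c"
      "exec d orc c (s, r) t1 \<sigma>2"
      "t2 \<le> k2 * instr_cost d (Suc L) (While b c)" "exec d orc (While b c) \<sigma>2 t2 \<sigma>3" by auto
  then have "1 + bcost s b + t1 + t2 \<le> (1 + k1 + k2) * instr_cost d (Suc L) (While b c)"
    using bcost_le[OF sz, where b = b] by (simp add: algebra_simps)
  then show ?case using exec_WhileTrue[OF bexec_WhileTrue.hyps(1) t(2,4)] bexec_WhileTrue by blast
qed

section \<open>Preconditions with a count of instructions\<close>

primrec mods :: "com \<Rightarrow> string set" where
  "mods Skip = {}"
| "mods (Assign x i a) = {x}"
| "mods (Flip x) = {x}"
| "mods (Query x y z) = {x}"
| "mods (Seq c1 c2) = mods c1 \<union> mods c2"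
| "mods (If b c1 c2) = mods c1 \<union> mods c2"
| "mods (While b c) = mods c"

primrec flips :: "com \<Rightarrow> bool" where
  "flips Skip = False"
| "flips (Assign x i a) = False"
| "flips (Flip x) = True"
| "flips (Query x y z) = False"
| "flips (Seq c1 c2) = (flips c1 \<or> flips c2)"
| "flips (If b c1 c2) = (flips c1 \<or> flips c2)"
| "flips (While b c) = flips c"

primrec avars :: "aexp \<Rightarrow> string set" where
  "avars (Num k) = {}"
| "avars (Elem x i) = insert x (avars i)"
| "avars (Plus a b) = avars a \<union> avars b"
| "avars (Minus a b) = avars a \<union> avars b"
| "avars (Times a b) = avars a \<union> avars b"
| "avars (Div a b) = avars a \<union> avars b"
| "avars (Mod a b) = avars a \<union> avars b"

lemma aval_cong: "(\<And>x. x \<in> avars a \<Longrightarrow> s x = s' x) \<Longrightarrow> aval s a = aval s' a"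
  by (induction a) auto

text \<open>
  What a command leaves alone can be read off its text. Carrying this information automatically
  keeps the loop invariants free of statements about untouched arrays.
\<close>

definition frame :: "com \<Rightarrow> store \<Rightarrow> bool stream \<Rightarrow> store \<Rightarrow> bool stream \<Rightarrow> bool" where
  "frame c s r s' r' \<longleftrightarrow> (\<forall>y. y \<notin> mods c \<longrightarrow> s' y = s y) \<and> (\<not> flips c \<longrightarrow> r' = r)"

lemma bexec_frame: "bexec d orc \<beta> c \<sigma> k \<sigma>' \<Longrightarrow> frame c (fst \<sigma>) (snd \<sigma>) (fst \<sigma>') (snd \<sigma>')"
  by (induction rule: bexec.induct) (auto simp: frame_def)

abbreviation V :: "string \<Rightarrow> aexp" where
  "V x \<equiv> Elem x (Num 0)"

definition For :: "string \<Rightarrow> aexp \<Rightarrow> com \<Rightarrow> com" where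
  "For x e c = Seq (Assign x (Num 0) (Num 0))
     (While (Less (V x) e) (Seq c (Assign x (Num 0) (Plus (V x) (Num 1)))))"

lemma mods_For [simp]: "mods (For x e c) = insert x (mods c)"
  and flips_For [simp]: "flips (For x e c) = flips c"
  by (auto simp: For_def)

locale bounded_machine =
  fixes d :: nat and orc :: comparison_oracle and \<beta> :: int
  assumes \<beta>: "1 < \<beta>"
begin

text \<open>
  Total correctness, at most \<open>k\<close> instructions, and values below \<open>\<beta>\<close>. The bounds \<open>k\<close> are kept as
  unsimplified sums that follow the structure of the command, so that the rules apply by
  unification.
\<close>

definition wp :: "com \<Rightarrow> store \<Rightarrow> bool stream \<Rightarrow> nat \<Rightarrow> (store \<Rightarrow> bool stream \<Rightarrow> bool) \<Rightarrow> bool" where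
  "wp c s r k Q \<longleftrightarrow> (\<exists>k' s' r'. k' \<le> k \<and> bexec d orc \<beta> c (s, r) k' (s', r') \<and> Q s' r')"

lemma wp_conseq:
  assumes "wp c s r k Q" and "k \<le> k'" and "\<And>s' r'. Q s' r' \<Longrightarrow> frame c s r s' r' \<Longrightarrow> Q' s' r'"
  shows "wp c s r k' Q'"
proof -
  from assms(1) obtain l s' r' where "l \<le> k" "bexec d orc \<beta> c (s, r) l (s', r')" "Q s' r'"
    unfolding wp_def by blast
  moreover from this bexec_frame[of d orc \<beta> c "(s, r)" l "(s', r')"] have "Q' s' r'"
    by (intro assms(3)) auto
  ultimately show ?thesis
    unfolding wp_def using assms(2) le_trans by blast
qed

lemma wp_Skip: "Q s r \<Longrightarrow> wp Skip s r 1 Q"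
  unfolding wp_def using bexec_Skip by blast

lemma wp_Assign:
  "\<bar>aval s a\<bar> < \<beta> \<Longrightarrow> Q (s(x := (s x)(aval s i := aval s a))) r \<Longrightarrow> wp (Assign x i a) s r 1 Q"
  unfolding wp_def using bexec_Assign by blast

lemma wp_Flip: "Q (s(x := (s x)(0 := of_bool (shd r)))) (stl r) \<Longrightarrow> wp (Flip x) s r 1 Q"
  unfolding wp_def using bexec_Flip \<beta> by blast

lemma wp_Query:
  "Q (s(x := (s x)(0 := of_bool (orc (vector_at d s y) (vector_at d s z))))) r
    \<Longrightarrow> wp (Query x y z) s r 1 Q"
  unfolding wp_def using bexec_Query \<beta> by blast

lemma wp_Seq:
  assumes "wp c1 s r k1 Q1"
    and "\<And>s' r'. Q1 s' r' \<Longrightarrow> frame c1 s r s' r' \<Longrightarrow> wp c2 s' r' k2 Q"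
  shows "wp (Seq c1 c2) s r (k1 + k2) Q"
proof -
  from assms(1) obtain k s' r' where 1: "k \<le> k1" "bexec d orc \<beta> c1 (s, r) k (s', r')" "Q1 s' r'"
    unfolding wp_def by blast
  from assms(2)[OF 1(3)] bexec_frame[OF 1(2)] obtain k' s'' r''
    where "k' \<le> k2" "bexec d orc \<beta> c2 (s', r') k' (s'', r'')" "Q s'' r''"
    unfolding wp_def by auto
  moreover from this 1(1) have "k + k' \<le> k1 + k2" by simp
  ultimately show ?thesis unfolding wp_def using bexec_Seq[OF 1(2)] by blast
qed

lemma wp_If:
  assumes "bval s b \<Longrightarrow> wp c1 s r k Q" and "\<not> bval s b \<Longrightarrow> wp c2 s r k Q"
  shows "wp (If b c1 c2) s r (1 + k) Q"
proof (cases "bval s b")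
  case True
  with assms(1) obtain l s' r' where "l \<le> k" "bexec d orc \<beta> c1 (s, r) l (s', r')" "Q s' r'"
    unfolding wp_def by blast
  with bexec_IfTrue[OF True this(2)] show ?thesis unfolding wp_def by (meson add_le_cancel_left)
next
  case False
  with assms(2) obtain l s' r' where "l \<le> k" "bexec d orc \<beta> c2 (s, r) l (s', r')" "Q s' r'"
    unfolding wp_def by blast
  with bexec_IfFalse[OF False this(2)] show ?thesis unfolding wp_def by (meson add_le_cancel_left)
qed

text \<open>
  The invariant speaks about the state at the beginning of a round, and must not depend on the
  counter \<open>x\<close>, since this is changed between the rounds. Proofs about programs number the goals
  in the order of the premises of the rules: for a loop, goal 7 is the body; then follows, under the
  rule for sequences, the rest of the program as goal 8, and under the consequence rule the bound
  on the count as goal 8 and the use of the final invariant as goal 9.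
\<close>

lemma wp_For:
  assumes e: "aval s e = int N" "avars e \<inter> insert x (mods c) = {}"
    and x: "x \<notin> mods c" and N: "int N < \<beta>"
    and ins: "\<And>i s r v. I i s r \<Longrightarrow> I i (s(x := v)) r"
    and I0: "I 0 s r"
    and step: "\<And>i s' r'. i < N \<Longrightarrow> I i s' r' \<Longrightarrow> s' x 0 = int i \<Longrightarrow> frame (For x e c) s r s' r'
       \<Longrightarrow> wp c s' r' k (I (Suc i))"
  shows "wp (For x e c) s r (2 + N * (k + 2)) (I N)"
proof -
  define w where "w = While (Less (V x) e) (Seq c (Assign x (Num 0) (Plus (V x) (Num 1))))"
  have loop: "wp w s' r' (1 + m * (k + 2)) (I N)"
    if "m + i = N" "I i s' r'" "s' x 0 = int i" "frame (For x e c) s r s' r'" for m i s' r'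
    using that
  proof (induction m arbitrary: i s' r')
    case 0
    have "aval s' e = aval s e"
      by (rule aval_cong) (use 0 e(2) in \<open>auto simp: frame_def\<close>)
    then have "bexec d orc \<beta> w (s', r') 1 (s', r')"
      unfolding w_def using 0 e by (intro bexec_WhileFalse) auto
    then show ?case unfolding wp_def using 0 by auto
  next
    case (Suc m)
    have "aval s' e = aval s e"
      by (rule aval_cong) (use Suc.prems e(2) in \<open>auto simp: frame_def\<close>)
    then have b: "bval s' (Less (V x) e)" using Suc.prems e by simp
    have "i < N" using Suc.prems(1) by simp
    from step[OF this Suc.prems(2-4)]
    have "\<exists>k1 s1 r1. k1 \<le> k \<and> bexec d orc \<beta> c (s', r') k1 (s1, r1) \<and> I (Suc i) s1 r1"
      unfolding wp_def .
    then obtain k1 s1 r1 where 1: "k1 \<le> k"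
        "bexec d orc \<beta> c (s', r') k1 (s1, r1)" "I (Suc i) s1 r1"
      by (elim exE conjE)
    define s2 where "s2 = s1(x := (s1 x)(0 := int (Suc i)))"
    have fr: "frame c s' r' s1 r1" using bexec_frame[OF 1(2)] by simp
    have "s1 x = s' x" using fr x unfolding frame_def by blast
    then have x1: "s1 x 0 = int i" using Suc.prems(3) by (simp only:)
    have v: "aval s1 (Plus (V x) (Num 1)) = int (Suc i)" using x1 by simp
    have "\<bar>aval s1 (Plus (V x) (Num 1))\<bar> < \<beta>"
      unfolding v using Suc.prems(1) N by linarith
    from bexec_Assign[OF this, of d orc x "Num 0" r1]
    have "bexec d orc \<beta> (Assign x (Num 0) (Plus (V x) (Num 1))) (s1, r1) 1 (s2, r1)"
      unfolding v s2_def by simp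
    from bexec_Seq[OF 1(2) this]
    have body: "bexec d orc \<beta> (Seq c (Assign x (Num 0) (Plus (V x) (Num 1)))) (s', r') (k1 + 1) (s2, r1)" .
    have "s2 y = s y" if "y \<notin> insert x (mods c)" for y
    proof -
      have "s2 y = s1 y" using that by (simp add: s2_def)
      also have "\<dots> = s' y" using that fr by (simp add: frame_def)
      also have "\<dots> = s y" using that Suc.prems(4) by (simp add: frame_def)
      finally show ?thesis .
    qed
    moreover have "r1 = r" if "\<not> flips c"
      using that fr Suc.prems(4) by (simp add: frame_def)
    ultimately have "frame (For x e c) s r s2 r1" by (simp add: frame_def)
    moreover have "I (Suc i) s2 r1" unfolding s2_def by (rule ins[OF 1(3)])
    moreover have "s2 x 0 = int (Suc i)" by (simp add: s2_def)
    moreover have "m + Suc i = N" using Suc.prems(1) by simp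
    ultimately have "wp w s2 r1 (1 + m * (k + 2)) (I N)" by (intro Suc.IH)
    then obtain k2 s3 r3 where 2: "k2 \<le> 1 + m * (k + 2)" "bexec d orc \<beta> w (s2, r1) k2 (s3, r3)" "I N s3 r3"
      unfolding wp_def by blast
    have "bexec d orc \<beta> w (s', r') (1 + (k1 + 1) + k2) (s3, r3)"
      unfolding w_def by (rule bexec_WhileTrue[OF b body 2(2)[unfolded w_def]])
    moreover have "1 + (k1 + 1) + k2 \<le> 1 + Suc m * (k + 2)" using 1(1) 2(1) by simp
    ultimately show ?case unfolding wp_def using 2(3) by blast
  qed
  define s0 where "s0 = s(x := (s x)(0 := 0))"
  have "wp w s0 r (1 + N * (k + 2)) (I N)"
    unfolding s0_def by (rule loop[where i = 0]) (use I0 ins in \<open>auto simp: frame_def\<close>)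
  moreover have "bexec d orc \<beta> (Assign x (Num 0) (Num 0)) (s, r) 1 (s0, r)"
    using bexec_Assign[of s "Num 0" \<beta> d orc x "Num 0" r] \<beta> by (simp add: s0_def)
  ultimately have "wp (For x e c) s r (1 + (1 + N * (k + 2))) (I N)"
    unfolding For_def w_def[symmetric]
    by (intro wp_Seq[where ?Q1.0 = "\<lambda>s' r'. s' = s0 \<and> r' = r"]) (auto simp: wp_def)
  then show ?thesis by simp
qed

lemma wp_Assign_Seq:
  "\<bar>aval s a\<bar> < \<beta> \<Longrightarrow> wp c (s(x := (s x)(aval s i := aval s a))) r k Q
    \<Longrightarrow> wp (Seq (Assign x i a) c) s r (1 + k) Q"
  by (rule wp_Seq[OF wp_Assign[where Q = "\<lambda>s' r'. s' = s(x := (s x)(aval s i := aval s a)) \<and> r' = r"]]) auto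

lemma wp_Flip_Seq:
  "wp c (s(x := (s x)(0 := of_bool (shd r)))) (stl r) k Q \<Longrightarrow> wp (Seq (Flip x) c) s r (1 + k) Q"
  by (rule wp_Seq[OF wp_Flip[where Q = "\<lambda>s' r'. s' = s(x := (s x)(0 := of_bool (shd r))) \<and> r' = stl r"]]) auto

lemma wp_AssignI:
  "aval s i = x \<Longrightarrow> aval s a = v \<Longrightarrow> \<bar>v\<bar> < \<beta> \<Longrightarrow> Q (s(y := (s y)(x := v))) r \<Longrightarrow> wp (Assign y i a) s r 1 Q"
  using wp_Assign by blast

lemma wp_Assign_SeqI:
  "aval s i = x \<Longrightarrow> aval s a = v \<Longrightarrow> \<bar>v\<bar> < \<beta> \<Longrightarrow> wp c (s(y := (s y)(x := v))) r k Q
    \<Longrightarrow> wp (Seq (Assign y i a) c) s r (1 + k) Q"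
  using wp_Assign_Seq by blast

end

section \<open>Codes and matrix entries\<close>

abbreviation n_var :: aexp where "n_var \<equiv> V ''n''"
abbreviation let_var :: "string \<Rightarrow> aexp \<Rightarrow> com" where "let_var x a \<equiv> Assign x (Num 0) a"

primrec base_power :: "nat \<Rightarrow> aexp" where
  "base_power 0 = Num 1"
| "base_power (Suc k) = Times (V ''B'') (base_power k)"

primrec code_exp :: "nat \<Rightarrow> aexp" where
  "code_exp 0 = Num 0"
| "code_exp (Suc k) = Plus (code_exp k)
     (Times (Plus (Elem ''w'' (Plus (Times (Num (int k)) (Times n_var n_var)) (V ''a''))) (V ''W'')) (base_power k))"

primrec decode :: "string \<Rightarrow> aexp \<Rightarrow> nat \<Rightarrow> com" where
  "decode x e 0 = Skip"
| "decode x e (Suc k) = Seq (decode x e k)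
     (Assign x (Num (int k)) (Minus (Mod (Div e (base_power k)) (V ''B'')) (Times n_var (V ''W''))))"

definition draw_entries :: com where
  "draw_entries = For ''a'' (Times n_var n_var) (For ''k'' (Times (Num 2) n_var)
     (Seq (Flip ''b'') (Assign ''r'' (V ''a'') (Plus (Times (Num 2) (Elem ''r'' (V ''a''))) (V ''b'')))))"

text \<open>
  The sum of the squares of all weights serves as the bound on their absolute values: it needs no
  comparisons and is still polynomial.
\<close>

definition compute_base :: "nat \<Rightarrow> com" where
  "compute_base d = Seq (For ''a'' (Times (Num (int d)) (Times n_var n_var))
       (let_var ''W'' (Plus (V ''W'') (Times (Elem ''w'' (V ''a'')) (Elem ''w'' (V ''a''))))))
     (Seq (let_var ''B'' (Plus (Times (Num 2) (Times n_var (V ''W''))) (Num 1)))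
       (let_var ''T'' (base_power d)))"

definition compute_codes :: "nat \<Rightarrow> com" where
  "compute_codes d = For ''a'' (Times n_var n_var) (Assign ''u'' (V ''a'') (code_exp d))"

definition compute_radix :: com where
  "compute_radix = Seq (let_var ''X'' (Num 2)) (For ''a'' (Times n_var n_var) (let_var ''X'' (Times (Num 8) (V ''X''))))"

definition compute_entries :: com where
  "compute_entries = For ''a'' (Times n_var n_var) (Seq (Assign ''g'' (V ''a'') (Elem ''r'' (V ''a'')))
     (For ''k'' (Elem ''u'' (V ''a'')) (Assign ''g'' (V ''a'') (Times (Elem ''g'' (V ''a'')) (V ''X'')))))"

lemma aval_base_power [simp]: "aval s (base_power k) = s ''B'' 0 ^ k"
  by (induction k) auto

lemma aval_code_exp:
  "aval s (code_exp k) = (\<Sum>l<k. (s ''w'' (int l * (s ''n'' 0 * s ''n'' 0) + s ''a'' 0) + s ''W'' 0) * s ''B'' 0 ^ l)"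
  by (induction k) auto

locale matching_program = bounded_machine d orc \<beta> for d orc \<beta> +
  fixes n :: nat and wa :: "nat \<Rightarrow> int"
  assumes n: "1 \<le> n" and d: "1 \<le> d"
begin

text \<open>
  The values that the program stores in \<open>W\<close>, \<open>B\<close>, \<open>T\<close>, \<open>u\<close> and \<open>X\<close>. The radix takes the place of
  the variable \<open>x\<close> of the determinant; half of it, \<open>8 ^ (n * n)\<close>, exceeds every coefficient, which is a
  signed sum of at most \<open>fact n\<close> products of \<open>n\<close> numbers below \<open>4 ^ n\<close>.
\<close>

definition shift :: nat where "shift = nat (\<Sum>m<d * (n * n). wa m * wa m)"
definition base :: nat where "base = 2 * (n * shift) + 1"
definition codes :: nat where "codes = base ^ d"
definition code :: "nat \<Rightarrow> nat" where
  "code a = (\<Sum>k<d. nat (wa (k * (n * n) + a) + int shift) * base ^ k)"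
definition radix :: nat where "radix = 2 * 8 ^ (n * n)"
definition entry_bound :: nat where "entry_bound = 4 ^ n * radix ^ codes"

end

text \<open>
  Everything that the program writes is bounded by one of these three quantities; the last one
  bounds the numbers of the recursion of Faddeev and Leverrier.
\<close>

locale sized_matching_program = matching_program +
  assumes size1: "int (d * (n * n)) < \<beta>" and size2: "int codes < \<beta>"
    and size3: "int (n * (2 * n * entry_bound) ^ n) < \<beta>"
begin

lemma int_shift: "int shift = (\<Sum>m<d * (n * n). wa m * wa m)"
  by (simp add: shift_def sum_nonneg)

lemma abs_le_square: "\<bar>x\<bar> \<le> x * (x :: int)"
proof (cases "x = 0")
  case False
  then have "1 * \<bar>x\<bar> \<le> \<bar>x\<bar> * \<bar>x\<bar>" by (intro mult_right_mono) auto
  then show ?thesis by simp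
qed simp

lemma wa_le_shift: "m < d * (n * n) \<Longrightarrow> \<bar>wa m\<bar> \<le> int shift"
  unfolding int_shift
  by (rule order.trans[OF abs_le_square member_le_sum[of m _ "\<lambda>m. wa m * wa m"]]) auto

lemma radix_pos: "0 < radix" and base_pos: "0 < base" and codes_pos: "0 < codes"
  and entry_bound_pos: "0 < entry_bound"
  by (simp_all add: radix_def base_def codes_def entry_bound_def)

lemma base_le_codes: "base \<le> codes"
  using d self_le_power[of base d] base_pos by (simp add: codes_def)

lemma entry_bound_less: "int entry_bound < \<beta>"
proof -
  have "entry_bound \<le> 2 * n * entry_bound" using n by simp
  also have "\<dots> \<le> (2 * n * entry_bound) ^ n"
    using n entry_bound_pos by (intro self_le_power) auto
  also have "\<dots> \<le> n * (2 * n * entry_bound) ^ n" using n by simp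
  finally show ?thesis using size3 by linarith
qed

lemma less_beta:
  shows shift_less: "int shift < \<beta>" and base_less: "int base < \<beta>"
    and nn_less: "int (n * n) < \<beta>" and n_less: "int n < \<beta>"
    and radix_power_less: "k \<le> codes \<Longrightarrow> int (4 ^ n * radix ^ k) < \<beta>"
    and radix_less: "int radix < \<beta>" and four_less: "int (4 ^ n) < \<beta>" and two_n_less: "int (2 * n) < \<beta>"
proof -
  show B: "int base < \<beta>" using base_le_codes size2 by linarith
  have "1 * shift \<le> n * shift" using n by (intro mult_le_mono1)
  then have "shift \<le> base" unfolding base_def by linarith
  then show "int shift < \<beta>" using B by linarith
  have "1 * (n * n) \<le> d * (n * n)" using d by (intro mult_le_mono1)
  then show nn: "int (n * n) < \<beta>" using size1 by linarith
  have "n \<le> n * n" by simp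
  then show "int n < \<beta>" using nn by linarith
  have G: "4 ^ n * radix ^ k \<le> entry_bound" if "k \<le> codes" for k
    unfolding entry_bound_def using that radix_pos by (intro mult_le_mono2 power_increasing) auto
  then show *: "int (4 ^ n * radix ^ k) < \<beta>" if "k \<le> codes" for k
    using that entry_bound_less by (meson of_nat_le_iff order_le_less_trans)
  have "int (4 ^ n * radix ^ 1) < \<beta>" using codes_pos by (intro *) simp
  moreover have "radix \<le> 4 ^ n * radix ^ 1" by simp
  ultimately show "int radix < \<beta>" by (meson of_nat_le_iff order_le_less_trans)
  show 4: "int (4 ^ n) < \<beta>" using *[of 0] by simp
  have "2 * n \<le> 4 ^ n" for n :: nat
  proof (induction n)
    case (Suc n)
    have "1 \<le> (4 :: nat) ^ n" by simp
    then have "2 * n + 2 \<le> 4 * 4 ^ n" using Suc by linarith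
    then show ?case by simp
  qed simp
  then show "int (2 * n) < \<beta>" using 4 by (meson of_nat_le_iff order_le_less_trans)
qed

lemma wp_draw_entries:
  assumes "s ''n'' 0 = int n" and "\<And>a. s ''r'' a = 0"
  shows "wp draw_entries s r (2 + n * n * ((2 + 2 * n * ((1 + 1) + 2)) + 2))
    (\<lambda>s' r'. \<forall>a<n * n. s' ''r'' (int a) = int (bits_value (2 * n) (sdrop (a * (2 * n)) r)))"
  unfolding draw_entries_def
proof (rule wp_conseq[OF wp_For[where N = "n * n" and k = "2 + 2 * n * ((1 + 1) + 2)"
    and I = "\<lambda>i s' r'. r' = sdrop (i * (2 * n)) r
    \<and> (\<forall>a<i. s' ''r'' (int a) = int (bits_value (2 * n) (sdrop (a * (2 * n)) r)))
    \<and> (\<forall>a\<ge>i. s' ''r'' (int a) = 0)"]], goal_cases)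
  case (7 i s1 r1)
  have s1: "s1 ''n'' 0 = int n" using 7(4) assms by (simp add: frame_def)
  show ?case
  proof (rule wp_conseq[OF wp_For[where N = "2 * n" and k = "1 + 1"
      and I = "\<lambda>k s' r'. r' = sdrop (i * (2 * n) + k) r
      \<and> (\<forall>a<i. s' ''r'' (int a) = int (bits_value (2 * n) (sdrop (a * (2 * n)) r)))
      \<and> s' ''r'' (int i) = int (bits_value k (sdrop (i * (2 * n)) r))
      \<and> (\<forall>a>i. s' ''r'' (int a) = 0)"]], goal_cases)
    case (7 k s2 r2)
    have a2: "s2 ''a'' 0 = int i" using 7(4) \<open>s1 ''a'' 0 = int i\<close> by (simp add: frame_def)
    have v: "2 * s2 ''r'' (int i) + of_bool (shd r2) = int (bits_value (Suc k) (sdrop (i * (2 * n)) r))"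
      using 7(2) unfolding bits_value_snoc by (simp add: sdrop_snth)
    have "bits_value (Suc k) (sdrop (i * (2 * n)) r) < 2 ^ Suc k" by (rule bits_value_less)
    also have "(2 :: nat) ^ Suc k \<le> 2 ^ (2 * n)" using 7(1) by (intro power_increasing) auto
    also have "(2 :: nat) ^ (2 * n) = 4 ^ n" by (simp add: power_mult)
    finally have "int (bits_value (Suc k) (sdrop (i * (2 * n)) r)) < int (4 ^ n)"
      by (simp only: of_nat_less_iff)
    with four_less have lt: "\<bar>int (bits_value (Suc k) (sdrop (i * (2 * n)) r))\<bar> < \<beta>" by linarith
    show ?case
      by (rule wp_Flip_Seq, rule wp_Assign)
        (use 7(2) a2 v lt in \<open>auto simp del: bits_value.simps(2) of_nat_add of_nat_mult simp: v\<close>)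
  qed (use 7 s1 two_n_less in \<open>auto simp: less_Suc_eq add.commute[of "i * (2 * n)" "2 * n"]\<close>)
qed (use assms nn_less in auto)

lemma wp_compute_base:
  assumes "s ''n'' 0 = int n" and "s ''W'' 0 = 0" and "\<And>m. m < d * (n * n) \<Longrightarrow> s ''w'' (int m) = wa m"
  shows "wp (compute_base d) s r ((2 + d * (n * n) * (1 + 2)) + (1 + 1))
    (\<lambda>s' r'. s' ''W'' 0 = int shift \<and> s' ''B'' 0 = int base \<and> s' ''T'' 0 = int codes)"
  unfolding compute_base_def
proof (rule wp_Seq[OF wp_For[where N = "d * (n * n)" and I = "\<lambda>i s' r'. s' ''W'' 0 = (\<Sum>m<i. wa m * wa m)"]])
  fix i s' r'
  assume i: "i < d * (n * n)" and I: "s' ''W'' 0 = (\<Sum>m<i. wa m * wa m)" and ai: "s' ''a'' 0 = int i"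
    and fr: "frame (For ''a'' (Times (Num (int d)) (Times n_var n_var))
       (let_var ''W'' (Plus (V ''W'') (Times (Elem ''w'' (V ''a'')) (Elem ''w'' (V ''a'')))))) s r s' r'"
  have w: "s' ''w'' (int i) = wa i" using fr assms(3)[OF i] by (simp add: frame_def)
  have "(\<Sum>m<Suc i. wa m * wa m) \<le> int shift"
    unfolding int_shift using i by (intro sum_mono2) auto
  moreover have "0 \<le> (\<Sum>m<Suc i. wa m * wa m)" by (intro sum_nonneg) simp
  ultimately have "\<bar>\<Sum>m<Suc i. wa m * wa m\<bar> < \<beta>" using shift_less by linarith
  then show "wp (let_var ''W'' (Plus (V ''W'') (Times (Elem ''w'' (V ''a'')) (Elem ''w'' (V ''a''))))) s' r' 1
     (\<lambda>s' r'. s' ''W'' 0 = (\<Sum>m<Suc i. wa m * wa m))"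
    by (intro wp_Assign) (simp_all add: I ai w)
next
  fix s' r'
  assume I: "s' ''W'' 0 = (\<Sum>m<d * (n * n). wa m * wa m)"
   and fr: "frame (For ''a'' (Times (Num (int d)) (Times n_var n_var))
       (let_var ''W'' (Plus (V ''W'') (Times (Elem ''w'' (V ''a'')) (Elem ''w'' (V ''a'')))))) s r s' r'"
  have "s' ''n'' 0 = int n" using fr assms by (simp add: frame_def)
  then have "2 * (s' ''n'' 0 * s' ''W'' 0) + 1 = int base"
    by (simp add: base_def I int_shift)
  moreover have "s' ''W'' 0 = int shift" by (simp add: I int_shift)
  ultimately show "wp (Seq (let_var ''B'' (Plus (Times (Num 2) (Times n_var (V ''W''))) (Num 1)))
       (let_var ''T'' (base_power d))) s' r' (1 + 1)
    (\<lambda>s' r'. s' ''W'' 0 = int shift \<and> s' ''B'' 0 = int base \<and> s' ''T'' 0 = int codes)"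
    using base_less size2 by (intro wp_Assign_Seq wp_Assign) (auto simp: codes_def)
qed (use assms size1 in auto)

text \<open>
  After the shift, each weight lies between 0 and \<open>2 * shift\<close>, which is a digit.
\<close>

lemma code_less: "a < n * n \<Longrightarrow> code a < codes"
proof -
  assume a: "a < n * n"
  have "nat (wa (k * (n * n) + a) + int shift) < base" if "k < d" for k
  proof -
    have "k * (n * n) + a < Suc k * (n * n)" using a by simp
    also have "\<dots> \<le> d * (n * n)" using that by (intro mult_le_mono1) simp
    finally have "wa (k * (n * n) + a) \<le> int shift" using wa_le_shift by force
    then have "nat (wa (k * (n * n) + a) + int shift) \<le> 2 * (1 * shift)" by simp
    also have "\<dots> \<le> 2 * (n * shift)" using n by (intro mult_le_mono mult_le_mono1) auto
    finally show ?thesis by (simp add: base_def)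
  qed
  then show ?thesis unfolding code_def codes_def by (rule digit_sum_less)
qed

lemma int_code: "a < n * n \<Longrightarrow> int (code a) = (\<Sum>k<d. (wa (k * (n * n) + a) + int shift) * int base ^ k)"
proof -
  assume a: "a < n * n"
  have "0 \<le> wa (k * (n * n) + a) + int shift" if "k < d" for k
  proof -
    have "k * (n * n) + a < Suc k * (n * n)" using a by simp
    also have "\<dots> \<le> d * (n * n)" using that by (intro mult_le_mono1) simp
    finally show "0 \<le> wa (k * (n * n) + a) + int shift" using wa_le_shift by force
  qed
  then show ?thesis unfolding code_def of_nat_sum by (intro sum.cong) auto
qed

lemma wp_compute_codes:
  assumes "s ''n'' 0 = int n" "s ''W'' 0 = int shift" "s ''B'' 0 = int base"
    and "\<And>m. m < d * (n * n) \<Longrightarrow> s ''w'' (int m) = wa m"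
  shows "wp (compute_codes d) s r (2 + n * n * (1 + 2)) (\<lambda>s' r'. \<forall>a<n * n. s' ''u'' (int a) = int (code a))"
  unfolding compute_codes_def
proof (rule wp_For[where I = "\<lambda>i s' r'. \<forall>a<i. s' ''u'' (int a) = int (code a)"])
  fix i s' r'
  assume i: "i < n * n" and I: "\<forall>a<i. s' ''u'' (int a) = int (code a)" and ai: "s' ''a'' 0 = int i"
    and fr: "frame (For ''a'' (Times n_var n_var) (Assign ''u'' (V ''a'') (code_exp d))) s r s' r'"
  have "aval s' (code_exp d) = (\<Sum>k<d. (wa (k * (n * n) + i) + int shift) * int base ^ k)"
    unfolding aval_code_exp
  proof (rule sum.cong[OF refl])
    fix k assume "k \<in> {..<d}"
    then have "k * (n * n) + i < Suc k * (n * n)" "Suc k * (n * n) \<le> d * (n * n)"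
      using i mult_le_mono1[of "Suc k" d "n * n"] by simp_all
    then have "s ''w'' (int (k * (n * n) + i)) = wa (k * (n * n) + i)" by (intro assms) linarith
    then show "(s' ''w'' (int k * (s' ''n'' 0 * s' ''n'' 0) + s' ''a'' 0) + s' ''W'' 0) * s' ''B'' 0 ^ k
        = (wa (k * (n * n) + i) + int shift) * int base ^ k"
      using fr assms ai by (simp add: frame_def)
  qed
  then have v: "aval s' (code_exp d) = int (code i)" using int_code[OF i] by simp
  have "int (code i) < \<beta>" using code_less[OF i] size2 by linarith
  with v show "wp (Assign ''u'' (V ''a'') (code_exp d)) s' r' 1 (\<lambda>s' r'. \<forall>a<Suc i. s' ''u'' (int a) = int (code a))"
    by (intro wp_Assign) (auto simp: ai I less_Suc_eq)
qed (use assms nn_less in auto)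

lemma wp_compute_radix:
  assumes "s ''n'' 0 = int n"
  shows "wp compute_radix s r (1 + (2 + n * n * (1 + 2))) (\<lambda>s' r'. s' ''X'' 0 = int radix)"
  unfolding compute_radix_def
proof (rule wp_Assign_Seq)
  show "\<bar>aval s (Num 2)\<bar> < \<beta>" using two_n_less n by simp
  show "wp (For ''a'' (Times n_var n_var) (let_var ''X'' (Times (Num 8) (V ''X''))))
     (s(''X'' := (s ''X'')(aval s (Num 0) := aval s (Num 2)))) r (2 + n * n * (1 + 2)) (\<lambda>s' r'. s' ''X'' 0 = int radix)"
    unfolding radix_def
  proof (rule wp_For[where I = "\<lambda>i s' r'. s' ''X'' 0 = int (2 * 8 ^ i)"])
    fix i r' and s' :: store
    assume i: "i < n * n" and I: "s' ''X'' 0 = int (2 * 8 ^ i)"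
    have "(8 :: nat) ^ Suc i \<le> 8 ^ (n * n)" using i by (intro power_increasing) auto
    then have "int (2 * 8 ^ Suc i) < \<beta>"
      using radix_less unfolding radix_def by linarith
    then show "wp (let_var ''X'' (Times (Num 8) (V ''X''))) s' r' 1 (\<lambda>s' r'. s' ''X'' 0 = int (2 * 8 ^ Suc i))"
      by (intro wp_Assign) (simp_all add: I)
  qed (use assms nn_less in auto)
qed

lemma wp_compute_entries:
  assumes "s ''n'' 0 = int n" "s ''X'' 0 = int radix"
    and r: "\<And>a. a < n * n \<Longrightarrow> s ''r'' (int a) = int (v a)" "\<And>a. a < n * n \<Longrightarrow> v a < 4 ^ n"
    and u: "\<And>a. a < n * n \<Longrightarrow> s ''u'' (int a) = int (code a)"
  shows "wp compute_entries s r0 (2 + n * n * ((1 + (2 + codes * (1 + 2))) + 2))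
    (\<lambda>s' r'. \<forall>a<n * n. s' ''g'' (int a) = int (v a) * int radix ^ code a)"
  unfolding compute_entries_def
proof (rule wp_For[where I = "\<lambda>i s' r'. \<forall>a<i. s' ''g'' (int a) = int (v a) * int radix ^ code a"])
  fix i s' r'
  assume i: "i < n * n" and I: "\<forall>a<i. s' ''g'' (int a) = int (v a) * int radix ^ code a" and ai: "s' ''a'' 0 = int i"
    and fr: "frame (For ''a'' (Times n_var n_var) (Seq (Assign ''g'' (V ''a'') (Elem ''r'' (V ''a'')))
     (For ''k'' (Elem ''u'' (V ''a'')) (Assign ''g'' (V ''a'') (Times (Elem ''g'' (V ''a'')) (V ''X'')))))) s r0 s' r'"
  have vi: "s' ''r'' (int i) = int (v i)" using fr r(1)[OF i] by (simp add: frame_def)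
  have ui: "s' ''u'' (int i) = int (code i)" using fr u[OF i] by (simp add: frame_def)
  have X: "s' ''X'' 0 = int radix" using fr assms by (simp add: frame_def)
  have bnd: "int (v i * radix ^ k) < \<beta>" if "k \<le> codes" for k
  proof -
    have "v i * radix ^ k \<le> 4 ^ n * radix ^ k" using r(2)[OF i] by (intro mult_le_mono1) simp
    then show ?thesis using radix_power_less[OF that] by linarith
  qed
  show "wp (Seq (Assign ''g'' (V ''a'') (Elem ''r'' (V ''a'')))
     (For ''k'' (Elem ''u'' (V ''a'')) (Assign ''g'' (V ''a'') (Times (Elem ''g'' (V ''a'')) (V ''X''))))) s' r'
     (1 + (2 + codes * (1 + 2))) (\<lambda>s' r'. \<forall>a<Suc i. s' ''g'' (int a) = int (v a) * int radix ^ code a)"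
  proof (rule wp_Assign_Seq)
    show "\<bar>aval s' (Elem ''r'' (V ''a''))\<bar> < \<beta>" using bnd[of 0] by (simp add: ai vi)
    let ?s = "s'(''g'' := (s' ''g'')(aval s' (V ''a'') := aval s' (Elem ''r'' (V ''a''))))"
    show "wp (For ''k'' (Elem ''u'' (V ''a'')) (Assign ''g'' (V ''a'') (Times (Elem ''g'' (V ''a'')) (V ''X''))))
      ?s r' (2 + codes * (1 + 2)) (\<lambda>s' r'. \<forall>a<Suc i. s' ''g'' (int a) = int (v a) * int radix ^ code a)"
    proof (rule wp_conseq[OF wp_For[where N = "code i" and I = "\<lambda>k s' r'. s' ''g'' (int i) = int (v i) * int radix ^ k
        \<and> (\<forall>a<i. s' ''g'' (int a) = int (v a) * int radix ^ code a)"]])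
      fix k s1 r1
      assume k: "k < code i" and I1: "s1 ''g'' (int i) = int (v i) * int radix ^ k
        \<and> (\<forall>a<i. s1 ''g'' (int a) = int (v a) * int radix ^ code a)"
        and fr1: "frame (For ''k'' (Elem ''u'' (V ''a'')) (Assign ''g'' (V ''a'') (Times (Elem ''g'' (V ''a'')) (V ''X''))))
          ?s r' s1 r1"
      have "s1 ''a'' 0 = int i" "s1 ''X'' 0 = int radix" using fr1 ai X by (simp_all add: frame_def)
      moreover have "int (v i * radix ^ Suc k) < \<beta>" using k code_less[OF i] by (intro bnd) simp
      ultimately show "wp (Assign ''g'' (V ''a'') (Times (Elem ''g'' (V ''a'')) (V ''X''))) s1 r1 1
         (\<lambda>s' r'. s' ''g'' (int i) = int (v i) * int radix ^ Suc k
        \<and> (\<forall>a<i. s' ''g'' (int a) = int (v a) * int radix ^ code a))"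
        using I1 by (intro wp_Assign) (auto simp: mult_ac)
    next
      show "int (code i) < \<beta>" using code_less[OF i] size2 by linarith
      show "2 + code i * (1 + 2) \<le> 2 + codes * (1 + 2)" using code_less[OF i] by simp
    qed (use ai vi ui I in \<open>auto simp: less_Suc_eq\<close>)
  qed
qed (use assms nn_less in auto)

end

section \<open>The determinant in the machine\<close>

abbreviation row :: aexp where "row \<equiv> Div (V ''a'') n_var"
abbreviation col :: aexp where "col \<equiv> Mod (V ''a'') n_var"
abbreviation layer :: aexp where "layer \<equiv> Times (V ''k'') (Times n_var n_var)"
abbreviation next_layer :: aexp where "next_layer \<equiv> Times (Plus (V ''k'') (Num 1)) (Times n_var n_var)"
abbreviation next_k :: aexp where "next_k \<equiv> Plus (V ''k'') (Num 1)"

text \<open>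
  The step \<open>k\<close> of the recursion is kept in the \<open>k\<close>-th layer of the array \<open>Y\<close>. As a new layer is
  written while the previous one is read, no copying is needed.
\<close>

definition product_com :: com where
  "product_com = For ''a'' (Times n_var n_var)
     (Seq (Assign ''Y'' (Plus next_layer (V ''a'')) (Times (Elem ''c'' (V ''k'')) (Elem ''A'' (V ''a''))))
       (For ''l'' n_var (Assign ''Y'' (Plus next_layer (V ''a''))
          (Plus (Elem ''Y'' (Plus next_layer (V ''a'')))
            (Times (Elem ''A'' (Plus (Times row n_var) (V ''l'')))
              (Elem ''Y'' (Plus layer (Plus (Times (V ''l'') n_var) col))))))))"

definition trace_com :: com where
  "trace_com = Seq (Assign ''c'' next_k (Num 0))
     (Seq (For ''l'' n_var (Assign ''c'' next_k (Minus (Elem ''c'' next_k)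
         (Elem ''Y'' (Plus next_layer (Plus (Times (V ''l'') n_var) (V ''l'')))))))
       (Assign ''c'' next_k (Div (Elem ''c'' next_k) next_k)))"

definition leverrier_com :: com where
  "leverrier_com = Seq (Assign ''c'' (Num 0) (Num 1)) (For ''k'' n_var (Seq product_com trace_com))"

text \<open>
  The cell \<open>p[i]\<close> holds the column chosen for row \<open>i\<close>, counted from 1, or 0 as long as no choice
  has been made, in which case every position of the row is allowed. This is also the initial
  content of memory.
\<close>

definition mask_com :: com where
  "mask_com = For ''a'' (Times n_var n_var)
     (Seq (If (Neg (Conj (Neg (Equal (Elem ''p'' row) (Num 0)))
                (Neg (Equal (Elem ''p'' row) (Plus col (Num 1))))))
         (Assign ''A'' (V ''a'') (Elem ''g'' (V ''a'')))
         (Assign ''A'' (V ''a'') (Num 0)))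
       (Assign ''Y'' (V ''a'') (Num 0)))"

definition det_com :: com where
  "det_com = Seq mask_com leverrier_com"

lemma mods_det [simp]:
  "mods product_com = {''a'', ''Y'', ''l''}" "mods trace_com = {''c'', ''l''}"
  "mods leverrier_com = {''a'', ''Y'', ''l'', ''c'', ''k''}"
  "mods mask_com = {''a'', ''A'', ''Y''}"
  "mods det_com = {''a'', ''Y'', ''l'', ''c'', ''k'', ''A''}"
  by (auto simp: product_com_def trace_com_def leverrier_com_def mask_com_def det_com_def)

context sized_matching_program begin

lemma n_times_power_less_beta:
  assumes "k \<le> n"
  shows "int n * int (2 * n * entry_bound) ^ k < \<beta>"
proof -
  have "0 < 2 * n * entry_bound" using n entry_bound_pos by simp
  then have "1 \<le> int (2 * n * entry_bound)" by linarith
  then have "int n * int (2 * n * entry_bound) ^ k \<le> int n * int (2 * n * entry_bound) ^ n"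
    using assms by (intro mult_left_mono power_increasing) auto
  then show ?thesis using size3 by simp
qed

lemma power_less_beta: "k \<le> n \<Longrightarrow> int (2 * n * entry_bound) ^ k < \<beta>"
proof -
  assume "k \<le> n"
  have "1 * int (2 * n * entry_bound) ^ k \<le> int n * int (2 * n * entry_bound) ^ k"
    using n by (intro mult_right_mono) auto
  with n_times_power_less_beta[OF \<open>k \<le> n\<close>] show ?thesis by linarith
qed

lemma wp_product:
  assumes sn: "s ''n'' 0 = int n" and sk: "s ''k'' 0 = int k" and k: "k < n"
    and A: "\<And>i j. i < n \<Longrightarrow> j < n \<Longrightarrow> s ''A'' (int (i * n + j)) = A i j"
      "\<And>i j. i < n \<Longrightarrow> j < n \<Longrightarrow> \<bar>A i j\<bar> \<le> int entry_bound"
    and c: "s ''c'' (int k) = snd (leverrier n A k)"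
    and Y: "\<And>i j. i < n \<Longrightarrow> j < n \<Longrightarrow> s ''Y'' (int (k * (n * n) + (i * n + j))) = fst (leverrier n A k) i j"
  shows "wp product_com s r (2 + n * n * ((1 + (2 + n * (1 + 2))) + 2))
    (\<lambda>s' r'. \<forall>a<n * n. s' ''Y'' (int (Suc k * (n * n) + a)) = fst (leverrier n A (Suc k)) (a div n) (a mod n))"
  unfolding product_com_def
proof (rule wp_conseq[OF wp_For[where N = "n * n" and k = "1 + (2 + n * (1 + 2))" and I = "\<lambda>a s' r'.
    (\<forall>b<a. s' ''Y'' (int (Suc k * (n * n) + b)) = fst (leverrier n A (Suc k)) (b div n) (b mod n))
    \<and> (\<forall>b<n * n. s' ''Y'' (int (k * (n * n) + b)) = s ''Y'' (int (k * (n * n) + b)))"]], goal_cases)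
  case (7 a s1 r1)
  define i where "i = a div n"
  define j where "j = a mod n"
  have ij: "i < n" "j < n" "i * n + j = a"
    using 7(1) n by (auto simp: i_def j_def less_mult_imp_div_less)
  have s1: "s1 ''n'' 0 = int n" "s1 ''k'' 0 = int k" "s1 ''A'' = s ''A''" "s1 ''c'' = s ''c''" "s1 ''a'' 0 = int a"
    using 7 sn sk by (auto simp: frame_def)
  define val where "val m = snd (leverrier n A k) * A i j + (\<Sum>l<m. A i l * fst (leverrier n A k) l j)" for m
  have val: "\<bar>val m\<bar> < \<beta>" if "m \<le> n" for m
    using leverrier_product_bound[where A = A and G = entry_bound and k = k, OF n A(2) ij(1,2) that] power_less_beta[of "Suc k"] k
    unfolding val_def by linarith
  have val_n: "val n = fst (leverrier n A (Suc k)) i j" by (simp add: val_def Let_def)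
  \<comment> \<open>the layer being written does not overlap the one being read\<close>
  have ne: "int b \<noteq> int n * int n + int a" if "b < n * n" for b
    using that of_nat_less_iff[of b "n * n", where ?'a = int] by simp
  have A_a: "s ''A'' (int a) = A i j" using A(1)[OF ij(1,2)] ij(3) by simp
  show ?case
  proof (rule wp_Assign_SeqI[where x = "int (Suc k * (n * n) + a)" and v = "val 0"], goal_cases)
    case 4
    show ?case
    proof (rule wp_conseq[OF wp_For[where N = n and k = 1 and I = "\<lambda>l s' r'.
        s' ''Y'' (int (Suc k * (n * n) + a)) = val l
        \<and> (\<forall>b<a. s' ''Y'' (int (Suc k * (n * n) + b)) = fst (leverrier n A (Suc k)) (b div n) (b mod n))
        \<and> (\<forall>b<n * n. s' ''Y'' (int (k * (n * n) + b)) = s ''Y'' (int (k * (n * n) + b)))"]], goal_cases)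
      case (7 l s2 r2)
      have s2: "s2 ''n'' 0 = int n" "s2 ''k'' 0 = int k" "s2 ''A'' = s ''A''" "s2 ''a'' 0 = int a" "s2 ''l'' 0 = int l"
        using 7 s1 by (auto simp: frame_def)
      have Al: "s ''A'' (int (i * n + l)) = A i l" using A(1)[OF ij(1)] 7(1) by blast
      have "l * n + j < n * n" using address_bound 7(1) ij by blast
      then have "s2 ''Y'' (int (k * (n * n) + (l * n + j))) = s ''Y'' (int (k * (n * n) + (l * n + j)))"
        using 7(2) by blast
      then have Yl: "s2 ''Y'' (int (k * (n * n) + (l * n + j))) = fst (leverrier n A k) l j"
        using Y[OF 7(1) ij(2)] by (rule trans)
      have addrA: "aval s2 (Plus (Times row n_var) (V ''l'')) = int (i * n + l)"
        by (simp add: s2 i_def zdiv_int)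
      have addrY: "aval s2 (Plus layer (Plus (Times (V ''l'') n_var) col)) = int (k * (n * n) + (l * n + j))"
        by (simp add: s2 j_def zmod_int)
      have addr: "aval s2 (Plus next_layer (V ''a'')) = int (Suc k * (n * n) + a)"
        by (simp add: s2 algebra_simps)
      show ?case
      proof (rule wp_AssignI[where x = "int (Suc k * (n * n) + a)" and v = "val (Suc l)"], goal_cases)
        case 1
        show ?case by (rule addr)
      next
        case 2
        have ev: "aval s2 (Plus (Elem y e1) (Times (Elem x e2) (Elem z e3)))
          = s2 y (aval s2 e1) + s2 x (aval s2 e2) * s2 z (aval s2 e3)" for x y z e1 e2 e3 by simp
        show ?case unfolding ev addr addrA addrY Yl s2(3) Al using 7(2) by (simp add: val_def)
      next
        case 3
        show ?case using 7(1) by (intro val) simp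
      next
        case 4
        show ?case using 7(2) ne by auto
      qed
    qed (use s1 7 n_less ne val_n[unfolded i_def j_def] in \<open>auto simp del: leverrier.simps simp: less_Suc_eq\<close>)
  qed (use s1 A_a c n val[of 0] in \<open>auto simp: val_def algebra_simps\<close>)
qed (use sn nn_less in auto)

end

definition det_steps :: "nat \<Rightarrow> nat" where
  "det_steps n = (2 + n * n * (((1 + 1) + 1) + 2)) + (1 + (2 + n * ((2 + n * n * ((1 + (2 + n * (1 + 2))) + 2)) + (1 + ((2 + n * (1 + 2)) + 1)) + 2)))"

context sized_matching_program begin

lemma wp_trace:
  assumes sn: "s ''n'' 0 = int n" and sk: "s ''k'' 0 = int k" and k: "k < n"
    and A: "\<And>i j. i < n \<Longrightarrow> j < n \<Longrightarrow> \<bar>A i j\<bar> \<le> int entry_bound"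
    and Y: "\<And>a. a < n * n \<Longrightarrow> s ''Y'' (int (Suc k * (n * n) + a)) = fst (leverrier n A (Suc k)) (a div n) (a mod n)"
  shows "wp trace_com s r (1 + ((2 + n * (1 + 2)) + 1)) (\<lambda>s' r'. s' ''c'' (int (Suc k)) = snd (leverrier n A (Suc k)))"
  unfolding trace_com_def
proof (rule wp_Assign_SeqI[where x = "int (Suc k)" and v = 0], goal_cases)
  case 4
  define tr where "tr m = (\<Sum>i<m. fst (leverrier n A (Suc k)) i i)" for m
  have tr: "\<bar>tr m\<bar> < \<beta>" if "m \<le> n" for m
    using leverrier_trace_bound[where A = A and G = entry_bound and k = "Suc k", OF n A that]
      n_times_power_less_beta[of "Suc k"] k unfolding tr_def by linarith
  have snd_step: "snd (leverrier n A (Suc k)) = (- tr n) div int (Suc k)"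
    by (simp add: tr_def Let_def)
  show ?case
  proof (rule wp_Seq[OF wp_For[where N = n and k = 1 and I = "\<lambda>m s' r'. s' ''c'' (int (Suc k)) = - tr m"]], goal_cases)
    case (7 m s1 r1)
    have s1: "s1 ''n'' 0 = int n" "s1 ''k'' 0 = int k" "s1 ''Y'' = s ''Y''" "s1 ''l'' 0 = int m"
      using 7 sn sk by (auto simp: frame_def)
    have "m * n + m < n * n" using address_bound[of m n m] 7(1) by simp
    moreover have "(m * n + m) div n = m" "(m * n + m) mod n = m" using 7(1) by auto
    ultimately have Ym: "s ''Y'' (int (Suc k * (n * n) + (m * n + m))) = fst (leverrier n A (Suc k)) m m"
      using Y[of "m * n + m"] by (simp only:)
    have addrY: "aval s1 (Plus next_layer (Plus (Times (V ''l'') n_var) (V ''l''))) = int (Suc k * (n * n) + (m * n + m))"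
      by (simp add: s1 algebra_simps)
    have addrc: "aval s1 next_k = int (Suc k)" by (simp add: s1)
    have ev: "aval s1 (Minus (Elem x e1) (Elem y e2)) = s1 x (aval s1 e1) - s1 y (aval s1 e2)" for x y e1 e2
      by simp
    show ?case
    proof (rule wp_AssignI[where x = "int (Suc k)" and v = "- tr (Suc m)"], goal_cases)
      case 1
      show ?case by (rule addrc)
    next
      case 2
      show ?case unfolding ev addrc addrY s1(3) Ym 7(2) by (simp add: tr_def del: leverrier.simps)
    next
      case 3
      show ?case using tr[of "Suc m"] 7(1) by simp
    qed simp
  next
    case (8 s1 r1)
    have s1: "s1 ''k'' 0 = int k" using 8 sk by (auto simp: frame_def)
    have addrc: "aval s1 next_k = int (Suc k)" by (simp add: s1)
    have ev: "aval s1 (Div (Elem x e1) e2) = s1 x (aval s1 e1) div aval s1 e2" for x e1 e2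
      by simp
    show ?case
    proof (rule wp_AssignI[where x = "int (Suc k)" and v = "snd (leverrier n A (Suc k))"], goal_cases)
      case 1
      show ?case by (rule addrc)
    next
      case 2
      show ?case unfolding ev addrc 8(1) snd_step ..
    next
      case 3
      show ?case using leverrier_snd_bound[where A = A and G = entry_bound and k = "Suc k", OF n A]
        n_times_power_less_beta[of "Suc k"] k by linarith
    qed simp
  qed (use sn n_less in \<open>auto simp: tr_def\<close>)
qed (use sk \<beta> in auto)

lemma wp_leverrier:
  assumes sn: "s ''n'' 0 = int n"
    and A: "\<And>i j. i < n \<Longrightarrow> j < n \<Longrightarrow> s ''A'' (int (i * n + j)) = A i j"
      "\<And>i j. i < n \<Longrightarrow> j < n \<Longrightarrow> \<bar>A i j\<bar> \<le> int entry_bound"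
    and Y: "\<And>i j. i < n \<Longrightarrow> j < n \<Longrightarrow> s ''Y'' (int (i * n + j)) = 0"
  shows "wp leverrier_com s r (1 + (2 + n * ((2 + n * n * ((1 + (2 + n * (1 + 2))) + 2)) + (1 + ((2 + n * (1 + 2)) + 1)) + 2)))
    (\<lambda>s' r'. s' ''c'' (int n) = snd (leverrier n A n))"
  unfolding leverrier_com_def
proof (rule wp_Assign_SeqI[where x = 0 and v = 1], goal_cases)
  case 4
  show ?case
  proof (rule wp_conseq[OF wp_For[where N = n
      and k = "(2 + n * n * ((1 + (2 + n * (1 + 2))) + 2)) + (1 + ((2 + n * (1 + 2)) + 1))"
      and I = "\<lambda>k s' r'. s' ''c'' (int k) = snd (leverrier n A k)
      \<and> (\<forall>i<n. \<forall>j<n. s' ''Y'' (int (k * (n * n) + (i * n + j))) = fst (leverrier n A k) i j)"]], goal_cases)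
    case (7 k s1 r1)
    have s1: "s1 ''n'' 0 = int n" "s1 ''A'' = s ''A''"
      using 7 sn by (auto simp: frame_def)
    show ?case
    proof (rule wp_Seq[OF wp_product[where k = k and A = A]], goal_cases)
      case (8 s2 r2)
      have s2: "s2 ''n'' 0 = int n" "s2 ''k'' 0 = int k"
        using 8 s1 7 by (auto simp: frame_def)
      show ?case
      proof (rule wp_conseq[OF wp_trace[where k = k and A = A]], goal_cases)
        case (7 s3 r3)
        have "s3 ''Y'' = s2 ''Y''" using 7 by (simp add: frame_def)
        moreover have "s2 ''Y'' (int (Suc k * (n * n) + (i * n + j))) = fst (leverrier n A (Suc k)) i j"
          if "i < n" "j < n" for i j
        proof -
          have "(i * n + j) div n = i" "(i * n + j) mod n = j" using that by auto
          then show ?thesis using 8(1) address_bound[OF that] by (simp only:)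
        qed
        ultimately show ?case using 7(1) by (simp only: simp_thms) blast
      qed (use s2 8 A \<open>k < n\<close> in \<open>auto simp del: leverrier.simps\<close>)
    qed (use s1 7 A in auto)
  qed (use sn Y n_less in auto)
qed (use \<beta> in auto)

definition masked :: "(nat \<Rightarrow> int) \<Rightarrow> (nat \<Rightarrow> nat \<Rightarrow> bool) \<Rightarrow> nat \<Rightarrow> nat \<Rightarrow> int" where
  "masked v S i j = (if S i j then v (i * n + j) * int radix ^ code (i * n + j) else 0)"

lemma masked_bound:
  assumes "\<And>a. a < n * n \<Longrightarrow> 0 \<le> v a \<and> v a < 4 ^ n" "i < n" "j < n"
  shows "\<bar>masked v S i j\<bar> \<le> int entry_bound"
proof -
  have a: "i * n + j < n * n" using assms address_bound by blast
  have "int radix ^ code (i * n + j) \<le> int radix ^ codes"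
    using code_less[OF a] radix_pos by (intro power_increasing) auto
  then have "v (i * n + j) * int radix ^ code (i * n + j) \<le> 4 ^ n * int radix ^ codes"
    using assms(1)[OF a] by (intro mult_mono) auto
  moreover have "0 \<le> v (i * n + j) * int radix ^ code (i * n + j)" using assms(1)[OF a] by simp
  ultimately show ?thesis by (simp add: masked_def entry_bound_def)
qed

lemma wp_det:
  assumes sn: "s ''n'' 0 = int n"
    and g: "\<And>a. a < n * n \<Longrightarrow> s ''g'' (int a) = v a * int radix ^ code a"
    and v: "\<And>a. a < n * n \<Longrightarrow> 0 \<le> v a \<and> v a < 4 ^ n"
    and S: "\<And>i j. i < n \<Longrightarrow> j < n \<Longrightarrow> S i j \<longleftrightarrow> s ''p'' (int i) = 0 \<or> s ''p'' (int i) = int j + 1"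
  shows "wp det_com s r (det_steps n)
    (\<lambda>s' r'. s' ''c'' (int n) = snd (leverrier n (masked v S) n))"
  unfolding det_com_def mask_com_def det_steps_def
proof (rule wp_Seq[OF wp_For[where N = "n * n" and k = "(1 + 1) + 1" and I = "\<lambda>m s' r'.
    \<forall>a<m. s' ''A'' (int a) = masked v S (a div n) (a mod n) \<and> s' ''Y'' (int a) = 0"]], goal_cases)
  case (7 a s1 r1)
  define i where "i = a div n"
  define j where "j = a mod n"
  have ij: "i < n" "j < n" "i * n + j = a"
    using 7(1) n by (auto simp: i_def j_def less_mult_imp_div_less)
  have s1: "s1 ''n'' 0 = int n" "s1 ''g'' = s ''g''" "s1 ''p'' = s ''p''" "s1 ''a'' 0 = int a"
    using 7 sn by (auto simp: frame_def)
  have cond: "bval s1 (Neg (Conj (Neg (Equal (Elem ''p'' row) (Num 0))) (Neg (Equal (Elem ''p'' row) (Plus col (Num 1))))))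
     \<longleftrightarrow> S i j"
    unfolding S[OF ij(1,2)] by (simp add: s1 i_def j_def zdiv_int zmod_int)
  have mv: "masked v S i j = (if S i j then s ''g'' (int a) else 0)"
    using g[OF 7(1)] by (simp add: masked_def ij(3))
  have mb: "\<bar>masked v S i j\<bar> < \<beta>" using masked_bound[where S = S and v = v, OF v ij(1,2)] entry_bound_less by linarith
  have "wp (If (Neg (Conj (Neg (Equal (Elem ''p'' row) (Num 0))) (Neg (Equal (Elem ''p'' row) (Plus col (Num 1))))))
         (Assign ''A'' (V ''a'') (Elem ''g'' (V ''a''))) (Assign ''A'' (V ''a'') (Num 0))) s1 r1 (1 + 1)
      (\<lambda>s' r'. s' = s1(''A'' := (s1 ''A'')(int a := masked v S i j)))"
    by (rule wp_If; rule wp_AssignI[where x = "int a" and v = "masked v S i j"])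
       (use mv mb s1 in \<open>simp_all only: cond, simp_all\<close>)
  then show ?case
  proof (rule wp_Seq, goal_cases)
    case (1 s2 r2)
    show ?case
      by (rule wp_AssignI[where x = "int a" and v = 0])
         (use 1 7(2) s1 \<beta> in \<open>auto simp: less_Suc_eq i_def j_def\<close>)
  qed
next
  case (8 s1 r1)
  have "s1 ''n'' 0 = int n" using 8 sn by (auto simp: frame_def)
  moreover have "s1 ''A'' (int (i * n + j)) = masked v S i j \<and> s1 ''Y'' (int (i * n + j)) = 0"
    if "i < n" "j < n" for i j
  proof -
    have "(i * n + j) div n = i" "(i * n + j) mod n = j" using that by auto
    then show ?thesis using 8(1) address_bound[OF that] by metis
  qed
  ultimately show ?case using v by (intro wp_leverrier masked_bound) blast+
qed (use sn nn_less in auto)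

end

section \<open>Search for the best code and reconstruction of a matching\<close>

text \<open>
  With \<open>P\<close> holding the power \<open>t\<close> of the radix, \<open>R\<close> becomes zero if and only if the coefficient of
  \<open>x\<^sup>t\<close> vanishes.
\<close>

definition test_com :: com where
  "test_com = let_var ''R'' (Mod (Div (Plus (Times (Num 2) (Elem ''c'' n_var)) (V ''P'')) (Times (Num 2) (V ''P''))) (V ''X''))"

definition candidate_com :: "bool \<Rightarrow> nat \<Rightarrow> com" where
  "candidate_com maximize d = Seq (decode ''z'' (V ''t'') d)
     (Seq (If (Less (V ''best'') (Num 0)) (let_var ''q'' (Num 1))
        (Seq (decode ''y'' (V ''best'') d) (if maximize then Query ''q'' ''y'' ''z'' else Query ''q'' ''z'' ''y'')))
     (If (Equal (V ''q'') (Num 1)) (Seq (let_var ''best'' (V ''t'')) (let_var ''Q'' (V ''P''))) Skip))"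

text \<open>
  The cell \<open>best\<close> holds the best code so far, or \<open>-1\<close>, and \<open>Q\<close> the corresponding power of the
  radix.
\<close>

definition search_com :: "bool \<Rightarrow> nat \<Rightarrow> com" where
  "search_com maximize d = Seq (let_var ''best'' (Num (-1))) (Seq (let_var ''P'' (Num 1))
     (For ''t'' (V ''T'') (Seq test_com
       (Seq (If (Equal (V ''R'') (Num 0)) Skip (candidate_com maximize d))
         (let_var ''P'' (Times (V ''P'') (V ''X'')))))))"

text \<open>
  In each row the columns are tried until the coefficient survives. The loop over the columns is
  not left early; the test of \<open>R\<close> makes the remaining rounds idle.
\<close>

definition reduce_com :: com where
  "reduce_com = Seq (let_var ''P'' (V ''Q''))
     (For ''i'' n_var (Seq (let_var ''R'' (Num 0))
       (For ''j'' n_var (If (Equal (V ''R'') (Num 0))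
         (Seq (Assign ''p'' (V ''i'') (Plus (V ''j'') (Num 1))) (Seq det_com test_com)) Skip))))"

definition output_com :: com where
  "output_com = For ''i'' n_var (Assign ''M'' (Plus (Times (V ''i'') n_var) (Minus (Elem ''p'' (V ''i'')) (Num 1))) (Num 1))"

lemma mods_decode [simp]: "mods (decode x e k) = (if k = 0 then {} else {x})"
  and flips_decode [simp]: "\<not> flips (decode x e k)"
  by (induction k) auto

lemma mods_search [simp]:
  "mods test_com = {''R''}" "0 < d \<Longrightarrow> mods (candidate_com maximize d) = {''z'', ''q'', ''y'', ''best'', ''Q''}"
  "0 < d \<Longrightarrow> mods (search_com maximize d) = {''z'', ''q'', ''y'', ''best'', ''Q'', ''P'', ''t'', ''R''}"
  by (auto simp: test_com_def candidate_com_def search_com_def)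

context sized_matching_program begin

text \<open>
  The sign \<open>(-1) ^ n\<close> by which the recursion differs from the determinant is absorbed into the
  polynomial.
\<close>

lemma digit_zero_iff:
  assumes v: "\<And>a. a < n * n \<Longrightarrow> 0 \<le> v a \<and> v a < 4 ^ n"
  shows "(2 * snd (leverrier n (masked v S) n) + int radix ^ t) div (2 * int radix ^ t) mod int radix = 0
    \<longleftrightarrow> signed_sum n code S t v = 0"
proof -
  define p where "p = Polynomial.smult ((-1) ^ n) (Determinant.det (weight_mat n code S v))"
  have coeff: "coeff p t = (-1) ^ n * signed_sum n code S t v" for t
    by (simp add: p_def coeff_det_weight_mat)
  have "mat n n (\<lambda>(i, j). masked v S i j)
      = mat n n (\<lambda>(i, j). if S i j then v (i * n + j) * int radix ^ code (i * n + j) else 0)"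
    by (rule cong_mat) (auto simp: masked_def)
  then have D: "snd (leverrier n (masked v S) n) = poly p (int radix)"
    by (simp add: leverrier_eq_det p_def poly_det_weight_mat)
  have "\<bar>coeff p t\<bar> < 8 ^ (n * n)" for t
  proof -
    have "\<bar>coeff p t\<bar> = \<bar>signed_sum n code S t v\<bar>" by (simp add: coeff abs_mult power_abs)
    also have "\<dots> \<le> fact n * (4 ^ n) ^ n"
      using v by (intro abs_signed_sum_le) (force simp: abs_le_iff)
    also have "\<dots> < (2 ^ n) ^ n * (4 ^ n) ^ n"
    proof (rule mult_strict_right_mono)
      have "fact n \<le> int (n ^ n)" using of_nat_mono[OF fact_le_power[of n], where ?'a = int] by simp
      also have "int (n ^ n) < int ((2 ^ n) ^ n)"
        unfolding of_nat_less_iff using n by (intro power_strict_mono less_exp) auto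
      finally show "fact n < (2 ^ n :: int) ^ n" by simp
    qed simp
    also have "\<dots> = (8 :: int) ^ (n * n)"
      by (simp add: power_mult power_mult_distrib[symmetric])
    finally show ?thesis .
  qed
  from coeff_zero_iff_digit_zero[of p, OF this, of t] show ?thesis
    unfolding D coeff radix_def by simp
qed

lemma wp_test:
  assumes "s ''n'' 0 = int n" "s ''c'' (int n) = snd (leverrier n (masked v S) n)"
    and "s ''P'' 0 = int radix ^ t" "s ''X'' 0 = int radix"
    and v: "\<And>a. a < n * n \<Longrightarrow> 0 \<le> v a \<and> v a < 4 ^ n"
  shows "wp test_com s r 1 (\<lambda>s' r'. s' ''R'' 0 = 0 \<longleftrightarrow> signed_sum n code S t v = 0)"
  unfolding test_com_def
proof (rule wp_AssignI[where x = 0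
      and v = "(2 * snd (leverrier n (masked v S) n) + int radix ^ t) div (2 * int radix ^ t) mod int radix"], goal_cases)
  case 3
  have "0 < int radix" using radix_pos by simp
  from pos_mod_bound[OF this] pos_mod_sign[OF this] radix_less show ?case
    by (smt (verit))
next
  case 4
  show ?case using digit_zero_iff[OF v] by simp
qed (use assms in auto)

text \<open>
  A code determines the weight vector: its digits are the coordinates, increased by
  \<open>shift\<close> for each of the \<open>n\<close> edges of a perfect matching.
\<close>

definition decoded :: "nat \<Rightarrow> int list" where
  "decoded t = map (\<lambda>k. int (t div base ^ k mod base) - int (n * shift)) [0..<d]"

lemma wp_decode:
  assumes "aval s e = int t" "x \<notin> avars e" "x \<notin> {''B'', ''n'', ''W''}"
    and "s ''n'' 0 = int n" "s ''W'' 0 = int shift" "s ''B'' 0 = int base"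
  shows "wp (decode x e k) s r (1 + k)
    (\<lambda>s' r'. \<forall>l<k. s' x (int l) = int (t div base ^ l mod base) - int (n * shift))"
proof (induction k)
  case 0
  show ?case by (auto intro: wp_conseq[OF wp_Skip])
next
  case (Suc k)
  have "wp (Seq (decode x e k) (Assign x (Num (int k)) (Minus (Mod (Div e (base_power k)) (V ''B'')) (Times n_var (V ''W'')))))
    s r ((1 + k) + 1) (\<lambda>s' r'. \<forall>l<Suc k. s' x (int l) = int (t div base ^ l mod base) - int (n * shift))"
  proof (rule wp_Seq[OF Suc], goal_cases)
    case (1 s' r')
    have fr: "s' y = s y" if "y \<noteq> x" for y using 1(2) that by (auto simp: frame_def split: if_splits)
    have e: "aval s' e = int t"
      using assms(1,2) fr by (metis aval_cong)
    have s': "s' ''n'' 0 = int n" "s' ''W'' 0 = int shift" "s' ''B'' 0 = int base"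
      using assms fr by auto
    show ?case
    proof (rule wp_AssignI[where x = "int k" and v = "int (t div base ^ k mod base) - int (n * shift)"], goal_cases)
      case 2
      show ?case by (simp add: e s' zdiv_int zmod_int)
    next
      case 3
      have "t div base ^ k mod base < base" using base_pos by simp
      moreover have "n * shift < base" by (simp add: base_def)
      ultimately show ?case using base_less by linarith
    qed (use 1(1) in \<open>auto simp: less_Suc_eq\<close>)
  qed
  then show ?case by simp
qed

lemma vector_at_decoded:
  "(\<And>l. l < d \<Longrightarrow> s x (int l) = int (t div base ^ l mod base) - int (n * shift)) \<Longrightarrow> vector_at d s x = decoded t"
  by (simp add: vector_at_def decoded_def)

abbreviation feasible :: "(nat \<Rightarrow> int) \<Rightarrow> nat \<Rightarrow> bool" where
  "feasible v t \<equiv> signed_sum n code (\<lambda>i j. True) t v \<noteq> 0"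

lemma radix_power_less_beta: "t \<le> codes \<Longrightarrow> int radix ^ t < \<beta>"
proof -
  assume t: "t \<le> codes"
  have "radix ^ t \<le> 4 ^ n * radix ^ t" by simp
  then have "int (radix ^ t) < \<beta>"
    using radix_power_less[OF t] by (meson of_nat_le_iff order_le_less_trans)
  then show ?thesis by simp
qed

text \<open>
  The function \<open>F\<close> abstracts from the direction of optimization: it is \<open>f\<close> for maximization and \<open>- f\<close> for
  minimization.
\<close>

lemma wp_candidate:
  fixes F :: "int list \<Rightarrow> real"
  assumes F: "\<And>a b. (if maximize then orc a b else orc b a) \<longleftrightarrow> F a \<le> F b"
    and s: "s ''n'' 0 = int n" "s ''W'' 0 = int shift" "s ''B'' 0 = int base"
      "s ''t'' 0 = int t" "s ''P'' 0 = int radix ^ t" "t < codes"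
    and best: "s ''best'' 0 = -1 \<or> (\<exists>b<t. s ''best'' 0 = int b)"
  shows "wp (candidate_com maximize d) s r ((1 + d) + ((1 + ((1 + d) + 1)) + (1 + (1 + 1))))
    (\<lambda>s' r'. if s ''best'' 0 = -1 \<or> F (decoded (nat (s ''best'' 0))) \<le> F (decoded t)
      then s' ''best'' 0 = int t \<and> s' ''Q'' 0 = int radix ^ t
      else s' ''best'' = s ''best'' \<and> s' ''Q'' = s ''Q'')"
  unfolding candidate_com_def
proof (rule wp_Seq[OF wp_decode[where t = t]], goal_cases)
  case (7 s1 r1)
  have fr1: "s1 y = s y" if "y \<noteq> ''z''" for y using 7(2) that by (auto simp: frame_def split: if_splits)
  have z1: "vector_at d s1 ''z'' = decoded t" using 7(1) by (intro vector_at_decoded) auto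
  define answer where "answer = (s ''best'' 0 = -1 \<or> F (decoded (nat (s ''best'' 0))) \<le> F (decoded t))"
  have "wp (If (Less (V ''best'') (Num 0)) (let_var ''q'' (Num 1))
        (Seq (decode ''y'' (V ''best'') d) (if maximize then Query ''q'' ''y'' ''z'' else Query ''q'' ''z'' ''y'')))
     s1 r1 (1 + ((1 + d) + 1)) (\<lambda>s' r'. s' ''q'' 0 = of_bool answer)"
  proof (rule wp_If, goal_cases)
    case 1
    then have "answer" using best fr1 by (auto simp: answer_def)
    then show ?case
      using \<beta> by (intro wp_conseq[OF wp_AssignI[where x = 0 and v = 1 and Q = "\<lambda>s' r'. s' ''q'' 0 = 1"]]) auto
  next
    case 2
    then obtain b where b: "s ''best'' 0 = int b" using best fr1 by auto
    then have answer: "answer \<longleftrightarrow> F (decoded b) \<le> F (decoded t)" by (simp add: answer_def)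
    show ?case
    proof (rule wp_Seq[OF wp_decode[where t = b]], goal_cases)
      case (7 s2 r2)
      have "s2 ''z'' = s1 ''z''" using 7(2) by (auto simp: frame_def split: if_splits)
      then have z2: "vector_at d s2 ''z'' = decoded t" using z1 by (simp add: vector_at_def)
      have y2: "vector_at d s2 ''y'' = decoded b" using 7(1) by (intro vector_at_decoded) auto
      have "wp (Query ''q'' ''y'' ''z'') s2 r2 1 (\<lambda>s' r'. s' ''q'' 0 = of_bool answer)" if maximize
        by (rule wp_Query) (use F[of "decoded b" "decoded t"] that in \<open>simp add: y2 z2 answer\<close>)
      moreover have "wp (Query ''q'' ''z'' ''y'') s2 r2 1 (\<lambda>s' r'. s' ''q'' 0 = of_bool answer)" if "\<not> maximize"
        by (rule wp_Query) (use F[of "decoded b" "decoded t"] that in \<open>simp add: y2 z2 answer\<close>)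
      ultimately show ?case by (cases maximize) simp_all
    qed (use s b fr1 in auto)
  qed
  then show ?case
  proof (rule wp_Seq, goal_cases)
    case (1 s2 r2)
    have fr2: "s2 y = s y" if "y \<notin> {''z'', ''y'', ''q''}" for y
      using 1(2) fr1[of y] that by (auto simp: frame_def split: if_splits)
    show ?case
    proof (rule wp_If, goal_cases)
      case 1
      then have "answer" using \<open>s2 ''q'' 0 = of_bool answer\<close> by (auto split: if_splits)
      moreover have "\<bar>int radix ^ t\<bar> < \<beta>" using radix_power_less_beta[of t] s by simp
      ultimately show ?case
        using s fr2 size2
        by (intro wp_Assign_SeqI[where x = 0 and v = "int t"] wp_AssignI[where x = 0 and v = "int radix ^ t"])
           (auto simp: answer_def)
    next
      case 2
      then have "\<not> answer" using \<open>s2 ''q'' 0 = of_bool answer\<close> by (auto split: if_splits)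
      then show ?case using fr2 by (intro wp_conseq[OF wp_Skip]) (auto simp: answer_def)
    qed
  qed
qed (use s in auto)

lemma wp_search:
  fixes F :: "int list \<Rightarrow> real"
  assumes F: "\<And>a b. (if maximize then orc a b else orc b a) \<longleftrightarrow> F a \<le> F b"
    and s: "s ''n'' 0 = int n" "s ''W'' 0 = int shift" "s ''B'' 0 = int base" "s ''X'' 0 = int radix"
      "s ''T'' 0 = int codes"
    and c: "s ''c'' (int n) = snd (leverrier n (masked v (\<lambda>i j. True)) n)"
    and v: "\<And>a. a < n * n \<Longrightarrow> 0 \<le> v a \<and> v a < 4 ^ n"
  shows "wp (search_com maximize d) s r (1 + (1 + (2 + codes * ((1 + ((1 + ((1 + d) + ((1 + ((1 + d) + 1)) + (1 + (1 + 1))))) + 1)) + 2))))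
    (\<lambda>s' r'. (s' ''best'' 0 = -1 \<and> (\<forall>t<codes. \<not> feasible v t))
      \<or> (\<exists>b. s' ''best'' 0 = int b \<and> s' ''Q'' 0 = int radix ^ b \<and> b < codes \<and> feasible v b
        \<and> (\<forall>t<codes. feasible v t \<longrightarrow> F (decoded t) \<le> F (decoded b))))"
  unfolding search_com_def
proof (rule wp_Assign_SeqI[where x = 0 and v = "-1"], goal_cases)
  case 4
  show ?case
  proof (rule wp_Assign_SeqI[where x = 0 and v = 1], goal_cases)
    case 4
    have d0: "0 < d" using d by simp
    show ?case
    proof (rule wp_conseq[OF wp_For[where N = codes
          and k = "1 + ((1 + ((1 + d) + ((1 + ((1 + d) + 1)) + (1 + (1 + 1))))) + 1)" and
          I = "\<lambda>m s' r'. s' ''P'' 0 = int radix ^ m \<and> ((s' ''best'' 0 = -1 \<and> (\<forall>t<m. \<not> feasible v t))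
      \<or> (\<exists>b<m. s' ''best'' 0 = int b \<and> s' ''Q'' 0 = int radix ^ b \<and> feasible v b
        \<and> (\<forall>t<m. feasible v t \<longrightarrow> F (decoded t) \<le> F (decoded b))))"]], goal_cases)
      case (7 m s1 r1)
      have s1: "s1 ''n'' 0 = int n" "s1 ''W'' 0 = int shift" "s1 ''B'' 0 = int base" "s1 ''X'' 0 = int radix"
          "s1 ''c'' = s ''c''" "s1 ''t'' 0 = int m" "s1 ''P'' 0 = int radix ^ m"
        using 7 s d0 by (auto simp: frame_def)
      show ?case
      proof (rule wp_Seq[OF wp_test[where t = m and v = v and S = "\<lambda>i j. True"]], goal_cases)
        case (6 s2 r2)
        have s2: "s2 ''n'' 0 = int n" "s2 ''W'' 0 = int shift" "s2 ''B'' 0 = int base" "s2 ''X'' 0 = int radix"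
          "s2 ''t'' 0 = int m" "s2 ''P'' 0 = int radix ^ m" "s2 ''best'' = s1 ''best''" "s2 ''Q'' = s1 ''Q''"
          using 6(2) s1 by (auto simp: frame_def)
        have best: "s2 ''best'' 0 = -1 \<or> (\<exists>b<m. s2 ''best'' 0 = int b)" using 7(2) s2(7) by auto
        define I where "I m s' \<longleftrightarrow> ((s' ''best'' 0 = -1 \<and> (\<forall>t<m. \<not> feasible v t))
          \<or> (\<exists>b<m. s' ''best'' 0 = int b \<and> s' ''Q'' 0 = int radix ^ b \<and> feasible v b
          \<and> (\<forall>t<m. feasible v t \<longrightarrow> F (decoded t) \<le> F (decoded b))))" for m and s' :: store
        have I2: "I m s2" using 7(2) s2 by (simp add: I_def)
        have "wp (If (Equal (V ''R'') (Num 0)) Skip (candidate_com maximize d)) s2 r2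
          (1 + ((1 + d) + ((1 + ((1 + d) + 1)) + (1 + (1 + 1))))) (\<lambda>s' r'. I (Suc m) s')"
        proof (rule wp_If, goal_cases)
          case 1
          then have "\<not> feasible v m" using 6(1) by simp
          then have "I (Suc m) s2" using I2 unfolding I_def less_Suc_eq by blast
          then show ?case by (intro wp_conseq[OF wp_Skip]) auto
        next
          case 2
          then have feas: "feasible v m" using 6(1) by simp
          show ?case
          proof (rule wp_conseq[OF wp_candidate[where t = m and F = F, OF F]], goal_cases)
            case (9 s3 r3)
            show ?case
            proof (cases "s2 ''best'' 0 = -1 \<or> F (decoded (nat (s2 ''best'' 0))) \<le> F (decoded m)")
              case True
              then have "s3 ''best'' 0 = int m" "s3 ''Q'' 0 = int radix ^ m" using 9(1) by simp_all
              moreover have "\<forall>t<Suc m. feasible v t \<longrightarrow> F (decoded t) \<le> F (decoded m)"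
                using I2 True unfolding I_def less_Suc_eq by fastforce
              ultimately show ?thesis using feas unfolding I_def by blast
            next
              case False
              then have "s3 ''best'' = s2 ''best''" "s3 ''Q'' = s2 ''Q''" using 9(1) by simp_all
              moreover from I2 False obtain b where "b < m" "s2 ''best'' 0 = int b" "s2 ''Q'' 0 = int radix ^ b"
                "feasible v b" "\<forall>t<m. feasible v t \<longrightarrow> F (decoded t) \<le> F (decoded b)"
                unfolding I_def by blast
              moreover from this False have "F (decoded m) \<le> F (decoded b)" by simp
              ultimately show ?thesis unfolding I_def less_Suc_eq by auto
            qed
          qed (use s2 best 7 in auto)
        qed
        then show ?case
        proof (rule wp_Seq, goal_cases)
          case (1 s3 r3)
          have s3: "s3 ''X'' 0 = int radix" "s3 ''P'' 0 = int radix ^ m"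
            using 1(2) s2 d0 by (auto simp: frame_def)
          show ?case
            by (rule wp_AssignI[where x = 0 and v = "int radix ^ Suc m"])
              (use 1(1) s3 radix_power_less_beta[of "Suc m"] 7(1) in \<open>auto simp: I_def\<close>)
        qed
      qed (use s1 c v in auto)
    qed (use s size2 d0 in auto)
  qed (use \<beta> in auto)
qed (use \<beta> in auto)

text \<open>
  The invariant is that the signed sum over the permutations that agree with the columns chosen
  so far is nonzero. By \<open>signed_sum_row\<close> some column of the next row preserves it, so the search
  for one succeeds. In the end only one permutation can be left, and it has the code \<open>b\<close>.
\<close>

lemma wp_reduce:
  assumes s: "s ''n'' 0 = int n" "s ''X'' 0 = int radix" "s ''Q'' 0 = int radix ^ b"
    and b: "b < codes" "feasible v b"
    and p: "\<And>i. i < n \<Longrightarrow> s ''p'' (int i) = 0"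
    and g: "\<And>a. a < n * n \<Longrightarrow> s ''g'' (int a) = v a * int radix ^ code a"
    and v: "\<And>a. a < n * n \<Longrightarrow> 0 \<le> v a \<and> v a < 4 ^ n"
  shows "wp reduce_com s r (1 + (2 + n * ((1 + (2 + n * ((1 + (1 + (det_steps n + 1))) + 2))) + 2)))
    (\<lambda>s' r'. \<exists>\<pi> \<in> selections n code (\<lambda>i j. True) b. \<forall>i<n. s' ''p'' (int i) = int (\<pi> i) + 1)"
  unfolding reduce_com_def
proof (rule wp_Assign_SeqI[where x = 0 and v = "int radix ^ b"], goal_cases)
  case 4
  define J where "J i s' \<sigma> \<longleftrightarrow> (\<forall>k<i. \<sigma> k < n \<and> s' ''p'' (int k) = int (\<sigma> k) + 1)
      \<and> (\<forall>k. i \<le> k \<longrightarrow> k < n \<longrightarrow> s' ''p'' (int k) = 0)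
      \<and> signed_sum n code (\<lambda>k l. k < i \<longrightarrow> l = \<sigma> k) b v \<noteq> 0" for i and s' :: store and \<sigma> :: "nat \<Rightarrow> nat"
  show ?case
  proof (rule wp_conseq[OF wp_For[where N = n and k = "1 + (2 + n * ((1 + (1 + (det_steps n + 1))) + 2))"
      and I = "\<lambda>i s' r'. \<exists>\<sigma>. J i s' \<sigma>"]], goal_cases)
    case (7 i s1 r1)
    from 7(2) obtain \<sigma> where J: "J i s1 \<sigma>" ..
    have s1: "s1 ''n'' 0 = int n" "s1 ''X'' 0 = int radix" "s1 ''P'' 0 = int radix ^ b" "s1 ''g'' = s ''g''"
        "s1 ''i'' 0 = int i"
      using 7 s by (auto simp: frame_def)
    \<comment> \<open>the positions allowed once column \<open>j\<close> is chosen in row \<open>i\<close>\<close>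
    define S where "S j k l \<longleftrightarrow> (k < i \<longrightarrow> l = \<sigma> k) \<and> (k = i \<longrightarrow> l = j)" for j k l :: nat
    define found where "found s' j \<longleftrightarrow> j < n \<and> s' ''p'' (int i) = int j + 1
       \<and> signed_sum n code (S j) b v \<noteq> 0" for s' :: store and j
    have found_upd: "found (s'(''j'' := u)) = found s'" for s' u
      by (intro ext) (simp add: found_def)
    show ?case
    proof (rule wp_Assign_SeqI[where x = 0 and v = 0], goal_cases)
      case 4
      show ?case
      proof (rule wp_conseq[OF wp_For[where N = n and k = "1 + (1 + (det_steps n + 1))"
          and I = "\<lambda>j s' r'. (\<forall>k<n. k \<noteq> i \<longrightarrow> s' ''p'' (int k) = s1 ''p'' (int k))
            \<and> (if s' ''R'' 0 = 0 then \<forall>j'<j. signed_sum n code (S j') b v = 0 else \<exists>j'. found s' j')"]], goal_cases)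
        case (7 j s2 r2)
        have s2: "s2 ''n'' 0 = int n" "s2 ''X'' 0 = int radix" "s2 ''P'' 0 = int radix ^ b" "s2 ''g'' = s ''g''"
            "s2 ''i'' 0 = int i" "s2 ''j'' 0 = int j"
          using 7(3,4) s1 by (auto simp: frame_def)
        show ?case
        proof (rule wp_If, goal_cases)
          case 1
          then have R: "\<forall>j'<j. signed_sum n code (S j') b v = 0" using 7(2) by simp
          show ?case
          proof (rule wp_Assign_SeqI[where x = "int i" and v = "int j + 1"], goal_cases)
            case 3
            show ?case using \<open>j < n\<close> n_less by simp
          next
            case 4
            let ?s = "s2(''p'' := (s2 ''p'')(int i := int j + 1))"
            have S: "S j k l \<longleftrightarrow> ?s ''p'' (int k) = 0 \<or> ?s ''p'' (int k) = int l + 1"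
              if "k < n" "l < n" for k l
            proof -
              consider "k < i" | "k = i" | "i < k" by linarith
              then show ?thesis
                using J 7(2) that by cases (auto simp: J_def S_def)
            qed
            show ?case
            proof (rule wp_Seq[OF wp_det[where v = v and S = "S j"]], goal_cases)
              case (5 s3 r3)
              have s3: "s3 ''n'' 0 = int n" "s3 ''X'' 0 = int radix" "s3 ''P'' 0 = int radix ^ b"
                  "s3 ''p'' = (s2 ''p'')(int i := int j + 1)"
                using 5(2) s2 by (auto simp: frame_def)
              show ?case
              proof (rule wp_conseq[OF wp_test[where t = b and v = v and S = "S j"]], goal_cases)
                case (7 s4 r4)
                have p4: "s4 ''p'' = (s2 ''p'')(int i := int j + 1)"
                  using 7(2) s3(4) by (simp add: frame_def)
                show ?case
                  using p4 7(1) R \<open>j < n\<close>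
                    \<open>(\<forall>k<n. k \<noteq> i \<longrightarrow> s2 ''p'' (int k) = s1 ''p'' (int k)) \<and> _\<close>
                  by (auto simp: less_Suc_eq found_def)
              qed (use s3 5(1) v in auto)
            qed (use s2 g v S in auto)
          qed (use s2 in auto)
        next
          case 2
          then have "\<exists>j'. found s2 j'" using 7(2) by simp
          then show ?case using 2 7(2) by (intro wp_conseq[OF wp_Skip]) auto
        qed
      next
        case (9 s2 r2)
        have "\<exists>j'. found s2 j'"
        proof (rule ccontr)
          assume "\<not> ?thesis"
          then have 0: "\<forall>j<n. signed_sum n code (S j) b v = 0" using 9(1) by presburger
          from signed_sum_row[OF \<open>i < n\<close>] J obtain j where j: "j < n"
            "signed_sum n code (\<lambda>k l. (k < i \<longrightarrow> l = \<sigma> k) \<and> (k = i \<longrightarrow> l = j)) b v \<noteq> 0"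
            unfolding J_def by blast
          have eq: "(\<lambda>k l. (k < i \<longrightarrow> l = \<sigma> k) \<and> (k = i \<longrightarrow> l = j)) = S j"
            by (intro ext) (simp add: S_def)
          show False using 0 j(1) j(2)[unfolded eq] by blast
        qed
        then obtain j where j: "found s2 j" ..
        have "(\<lambda>k l. k < Suc i \<longrightarrow> l = (\<sigma>(i := j)) k) = S j"
          by (intro ext) (auto simp: S_def less_Suc_eq)
        then have "J (Suc i) s2 (\<sigma>(i := j))"
          using J j 9(1) \<open>i < n\<close> by (auto simp: J_def found_def less_Suc_eq)
        then show ?case by blast
      qed (use s1 n_less in \<open>auto simp: found_upd\<close>)
    qed (use \<beta> in auto)
  next
    case (9 s1 r1)
    then obtain \<sigma> where J: "J n s1 \<sigma>" by blast
    then have "selections n code (\<lambda>k l. k < n \<longrightarrow> l = \<sigma> k) b \<noteq> {}"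
      by (intro signed_sum_nonzeroD[where r = v]) (simp add: J_def)
    then obtain \<pi> where \<pi>: "\<pi> \<in> selections n code (\<lambda>k l. k < n \<longrightarrow> l = \<sigma> k) b" by blast
    then have "\<pi> \<in> selections n code (\<lambda>i j. True) b" "\<forall>i<n. \<pi> i = \<sigma> i" by (auto simp: selections_def)
    then show ?case using J unfolding J_def by metis
  qed (use s p b n_less in \<open>auto simp: J_def\<close>)
qed (use s b radix_power_less_beta[of b] in auto)

lemma wp_output:
  assumes s: "s ''n'' 0 = int n" "\<And>a. s ''M'' a = 0"
    and p: "\<And>i. i < n \<Longrightarrow> s ''p'' (int i) = int (\<pi> i) + 1" and \<pi>: "\<pi> permutes {0..<n}"
  shows "wp output_com s r (2 + n * (1 + 2)) (\<lambda>s' r'. output_edges n s' = matching_of n \<pi>)"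
  unfolding output_com_def
proof (rule wp_conseq[OF wp_For[where N = n and k = 1
    and I = "\<lambda>m s' r'. \<forall>a. s' ''M'' a = of_bool (\<exists>i<m. a = int (i * n + \<pi> i))"]], goal_cases)
  case (7 i s1 r1)
  have s1: "s1 ''n'' 0 = int n" "s1 ''p'' = s ''p''" "s1 ''i'' 0 = int i"
    using 7 s by (auto simp: frame_def)
  show ?case
    by (rule wp_AssignI[where x = "int (i * n + \<pi> i)" and v = 1])
      (use 7(1,2) s1 p[of i] \<beta> in \<open>auto simp: less_Suc_eq\<close>)
next
  case (9 s1 r1)
  have pn: "\<pi> i < n" if "i < n" for i using \<pi> that permutes_in_image[of \<pi> "{0..<n}" i] by auto
  show ?case
  proof (intro equalityI subsetI)
    fix e assume "e \<in> output_edges n s1"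
    then obtain i j where e: "e = (i, j)" "i \<in> {1..n}" "j \<in> {1..n}"
        "s1 ''M'' (int ((i - 1) * n + (j - 1))) = 1"
      by (cases e) (auto simp: output_edges_def edges_def simp del: of_nat_add of_nat_mult of_nat_diff)
    then obtain k where k: "k < n" "(i - 1) * n + (j - 1) = k * n + \<pi> k"
      using 9(1) by (auto simp only: of_nat_eq_iff of_bool_eq_1_iff)
    then have "i - 1 = k \<and> j - 1 = \<pi> k" using e pn[OF k(1)] by (intro address_inject) auto
    then show "e \<in> matching_of n \<pi>" using e k(1) by (force simp: matching_of_def)
  next
    fix e assume "e \<in> matching_of n \<pi>"
    then obtain k where k: "k < n" "e = (Suc k, Suc (\<pi> k))" by (auto simp: matching_of_def)
    then have "s1 ''M'' (int (k * n + \<pi> k)) = 1" using 9(1) by auto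
    then show "e \<in> output_edges n s1" using k pn[OF k(1)] by (simp add: output_edges_def edges_def)
  qed
qed (use s n_less in auto)

end

section \<open>The whole program\<close>

text \<open>
  The determinant of the full matrix is computed once and serves the tests of all codes.
\<close>

definition main_com :: "bool \<Rightarrow> nat \<Rightarrow> com" where
  "main_com maximize d = Seq draw_entries (Seq (compute_base d) (Seq (compute_codes d) (Seq compute_radix
     (Seq compute_entries (Seq det_com (Seq (search_com maximize d)
       (Seq (If (Less (V ''best'') (Num 0)) (For ''i'' n_var (Assign ''p'' (V ''i'') (Plus (V ''i'') (Num 1)))) reduce_com)
         output_com)))))))"

definition main_steps :: "nat \<Rightarrow> nat \<Rightarrow> nat \<Rightarrow> nat" where
  "main_steps d n T =
     (2 + n * n * ((2 + 2 * n * ((1 + 1) + 2)) + 2)) +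
     (((2 + d * (n * n) * (1 + 2)) + (1 + 1)) +
     ((2 + n * n * (1 + 2)) +
     ((1 + (2 + n * n * (1 + 2))) +
     ((2 + n * n * ((1 + (2 + T * (1 + 2))) + 2)) +
     (det_steps n +
     ((1 + (1 + (2 + T * ((1 + ((1 + ((1 + d) + ((1 + ((1 + d) + 1)) + (1 + (1 + 1))))) + 1)) + 2)))) +
     ((1 + ((2 + n * (1 + 2)) + (1 + (2 + n * ((1 + (2 + n * ((1 + (1 + (det_steps n + 1))) + 2))) + 2))))) +
     (2 + n * (1 + 2)))))))))"

lemma mods_compute [simp]:
  "mods draw_entries = {''a'', ''k'', ''b'', ''r''}" "mods (compute_base d) = {''a'', ''W'', ''B'', ''T''}"
  "mods (compute_codes d) = {''a'', ''u''}" "mods compute_radix = {''X'', ''a''}"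
  "mods compute_entries = {''a'', ''g'', ''k''}"
  "mods reduce_com = {''P'', ''i'', ''R'', ''j'', ''p'', ''a'', ''Y'', ''l'', ''c'', ''k'', ''A''}"
  by (auto simp: draw_entries_def compute_base_def compute_codes_def compute_radix_def compute_entries_def
    reduce_com_def)

context sized_matching_program begin

text \<open>
  Chance decides only which codes have a nonzero coefficient; that the output is at least as good as
  all of these, and a perfect matching, is certain.
\<close>

lemma wp_main:
  fixes F :: "int list \<Rightarrow> real" and s :: store and r :: "bool stream"
  assumes F: "\<And>a b. (if maximize then orc a b else orc b a) \<longleftrightarrow> F a \<le> F b"
    and s: "s ''n'' 0 = int n" "s ''W'' 0 = 0" "\<And>a. s ''r'' a = 0" "\<And>a. s ''p'' a = 0" "\<And>a. s ''M'' a = 0"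
    and w: "\<And>m. m < d * (n * n) \<Longrightarrow> s ''w'' (int m) = wa m"
  defines "v \<equiv> \<lambda>a. int (bits_value (2 * n) (sdrop (a * (2 * n)) r))"
  shows "wp (main_com maximize d) s r (main_steps d n codes)
    (\<lambda>s' r'. \<exists>\<pi>. \<pi> permutes {0..<n} \<and> output_edges n s' = matching_of n \<pi>
      \<and> (\<forall>t<codes. feasible v t \<longrightarrow> F (decoded t) \<le> F (decoded (\<Sum>i<n. code (i * n + \<pi> i)))))"
  unfolding main_com_def main_steps_def
proof (rule wp_Seq[OF wp_draw_entries], goal_cases)
  case (3 s1 r1)
  have d0: "0 < d" using d by simp
  have s1: "s1 ''n'' 0 = int n" "s1 ''W'' 0 = 0" "\<And>a. s1 ''p'' a = 0" "\<And>a. s1 ''M'' a = 0"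
      "\<And>m. m < d * (n * n) \<Longrightarrow> s1 ''w'' (int m) = wa m"
      "\<And>a. a < n * n \<Longrightarrow> s1 ''r'' (int a) = v a"
    using 3 s w by (auto simp: frame_def v_def)
  have "bits_value (2 * n) r < 4 ^ n" for r
    using bits_value_less[of "2 * n" r] by (simp add: power_mult)
  then have v: "0 \<le> v a \<and> v a < 4 ^ n" for a
    unfolding v_def by (metis of_nat_0_le_iff of_nat_less_iff of_nat_numeral of_nat_power)
  show ?case
  proof (rule wp_Seq[OF wp_compute_base], goal_cases)
    case (4 s2 r2)
    have s2: "s2 ''n'' 0 = int n" "\<And>a. s2 ''p'' a = 0" "\<And>a. s2 ''M'' a = 0"
        "\<And>m. m < d * (n * n) \<Longrightarrow> s2 ''w'' (int m) = wa m"
        "\<And>a. a < n * n \<Longrightarrow> s2 ''r'' (int a) = v a"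
        "s2 ''W'' 0 = int shift" "s2 ''B'' 0 = int base" "s2 ''T'' 0 = int codes"
      using 4 s1 by (auto simp: frame_def)
    show ?case
    proof (rule wp_Seq[OF wp_compute_codes], goal_cases)
      case (5 s3 r3)
      have s3: "s3 ''n'' 0 = int n" "\<And>a. s3 ''p'' a = 0" "\<And>a. s3 ''M'' a = 0"
          "\<And>a. a < n * n \<Longrightarrow> s3 ''r'' (int a) = v a"
          "s3 ''W'' 0 = int shift" "s3 ''B'' 0 = int base" "s3 ''T'' 0 = int codes"
          "\<And>a. a < n * n \<Longrightarrow> s3 ''u'' (int a) = int (code a)"
        using 5 s2 by (auto simp: frame_def)
      show ?case
      proof (rule wp_Seq[OF wp_compute_radix], goal_cases)
        case (2 s4 r4)
        have s4: "s4 ''n'' 0 = int n" "\<And>a. s4 ''p'' a = 0" "\<And>a. s4 ''M'' a = 0"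
            "\<And>a. a < n * n \<Longrightarrow> s4 ''r'' (int a) = v a"
            "s4 ''W'' 0 = int shift" "s4 ''B'' 0 = int base" "s4 ''T'' 0 = int codes"
            "\<And>a. a < n * n \<Longrightarrow> s4 ''u'' (int a) = int (code a)" "s4 ''X'' 0 = int radix"
          using 2 s3 by (auto simp: frame_def)
        show ?case
        proof (rule wp_Seq[OF wp_compute_entries[where v = "\<lambda>a. nat (v a)"]], goal_cases)
          case (6 s5 r5)
          have s5: "s5 ''n'' 0 = int n" "\<And>a. s5 ''p'' a = 0" "\<And>a. s5 ''M'' a = 0"
              "s5 ''W'' 0 = int shift" "s5 ''B'' 0 = int base" "s5 ''T'' 0 = int codes"
              "s5 ''X'' 0 = int radix"
              "\<And>a. a < n * n \<Longrightarrow> s5 ''g'' (int a) = v a * int radix ^ code a"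
            using 6 s4 v by (auto simp: frame_def)
          show ?case
          proof (rule wp_Seq[OF wp_det[where v = v and S = "\<lambda>i j. True"]], goal_cases)
            case (5 s6 r6)
            have s6: "s6 ''n'' 0 = int n" "\<And>a. s6 ''p'' a = 0" "\<And>a. s6 ''M'' a = 0"
                "s6 ''W'' 0 = int shift" "s6 ''B'' 0 = int base" "s6 ''T'' 0 = int codes"
                "s6 ''X'' 0 = int radix"
                "\<And>a. a < n * n \<Longrightarrow> s6 ''g'' (int a) = v a * int radix ^ code a"
              using 5(2) s5 by (auto simp: frame_def)
            show ?case
            proof (rule wp_Seq[OF wp_search[where F = F and v = v, OF F]], goal_cases)
              case (8 s7 r7)
              have s7: "s7 ''n'' 0 = int n" "\<And>a. s7 ''p'' a = 0" "\<And>a. s7 ''M'' a = 0"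
                  "s7 ''X'' 0 = int radix"
                  "\<And>a. a < n * n \<Longrightarrow> s7 ''g'' (int a) = v a * int radix ^ code a"
                using 8(2) s6 d0 by (auto simp: frame_def)
              define good where "good \<pi> \<longleftrightarrow> \<pi> permutes {0..<n} \<and>
                (\<forall>t<codes. feasible v t \<longrightarrow> F (decoded t) \<le> F (decoded (\<Sum>i<n. code (i * n + \<pi> i))))"
                for \<pi> :: "nat \<Rightarrow> nat"
              let ?choose = "If (Less (V ''best'') (Num 0)) (For ''i'' n_var (Assign ''p'' (V ''i'') (Plus (V ''i'') (Num 1)))) reduce_com"
              have "wp ?choose s7 r7
                (1 + ((2 + n * (1 + 2)) + (1 + (2 + n * ((1 + (2 + n * ((1 + (1 + (det_steps n + 1))) + 2))) + 2)))))
                (\<lambda>s' r'. \<exists>\<pi>. good \<pi> \<and> (\<forall>i<n. s' ''p'' (int i) = int (\<pi> i) + 1))"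
              proof (rule wp_If, goal_cases)
                case 1
                then have none: "\<forall>t<codes. \<not> feasible v t" using 8(1) by auto
                show ?case
                proof (rule wp_conseq[OF wp_For[where N = n and k = 1
                      and I = "\<lambda>m s' r'. \<forall>i<m. s' ''p'' (int i) = int i + 1"]], goal_cases)
                  case (7 i s8 r8)
                  have "s8 ''i'' 0 = int i" by (rule 7(3))
                  with 7(1,2) show ?case using n_less
                    by (intro wp_AssignI[where x = "int i" and v = "int i + 1"]) (auto simp: less_Suc_eq)
                next
                  case (9 s8 r8)
                  \<comment> \<open>no coefficient survived, so any perfect matching meets the claim\<close>
                  have "good id" using none by (simp add: good_def permutes_id)
                  then show ?case using 9(1) by (intro exI[of _ id]) simp
                qed (use s7 n_less in auto)
              next
                case 2
                then obtain b where b: "s7 ''Q'' 0 = int radix ^ b" "b < codes" "feasible v b"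
                    "\<forall>t<codes. feasible v t \<longrightarrow> F (decoded t) \<le> F (decoded b)"
                  using 8(1) by auto
                show ?case
                proof (rule wp_conseq[OF wp_reduce[where b = b and v = v]], goal_cases)
                  case (10 s8 r8)
                  then obtain \<pi> where \<pi>: "\<pi> \<in> selections n code (\<lambda>i j. True) b"
                      "\<forall>i<n. s8 ''p'' (int i) = int (\<pi> i) + 1" by blast
                  then have "good \<pi>" using b(4) by (auto simp: good_def selections_def)
                  with \<pi>(2) show ?case by blast
                qed (use s7 b v in auto)
              qed
              then show ?case
              proof (rule wp_Seq, goal_cases)
                case (1 s8 r8)
                then obtain \<pi> where \<pi>: "good \<pi>" "\<forall>i<n. s8 ''p'' (int i) = int (\<pi> i) + 1" by blast
                have s8: "s8 ''n'' 0 = int n" "\<And>a. s8 ''M'' a = 0"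
                  using 1(2) s7 by (auto simp: frame_def)
                show ?case
                proof (rule wp_conseq[OF wp_output[where \<pi> = \<pi>]], goal_cases)
                  case (6 s9 r9)
                  then show ?case using \<pi>(1) unfolding good_def by blast
                qed (use s8 \<pi> in \<open>auto simp: good_def\<close>)
              qed
            qed (use s6 5(1) v in auto)
          qed (use s5 v in auto)
        qed (use s4 v in \<open>auto simp: nat_less_iff\<close>)
      qed (use s3 in auto)
    qed (use s2 in auto)
  qed (use s1 in auto)
qed (use s in auto)

text \<open>
  The digits of the code of a matching are sums of \<open>n\<close> digits of edges, and the base is large enough
  that no carries occur.
\<close>

lemma decoded_matching:
  assumes \<pi>: "\<pi> permutes {0..<n}"
    and wa: "\<And>k i j. k < d \<Longrightarrow> i < n \<Longrightarrow> j < n \<Longrightarrow> wa (k * (n * n) + (i * n + j)) = w (Suc k) (Suc i, Suc j)"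
  shows "(\<Sum>i<n. code (i * n + \<pi> i)) < codes"
    and "decoded (\<Sum>i<n. code (i * n + \<pi> i)) = weight_vector d w (matching_of n \<pi>)"
proof -
  have pn: "\<pi> i < n" if "i < n" for i using \<pi> that permutes_in_image[of \<pi> "{0..<n}" i] by auto
  \<comment> \<open>the digits of the code of the whole matching\<close>
  define digit where "digit k = (\<Sum>i<n. nat (wa (k * (n * n) + (i * n + \<pi> i)) + int shift))" for k
  have bound: "\<bar>wa (k * (n * n) + (i * n + \<pi> i))\<bar> \<le> int shift" if "k < d" "i < n" for k i
  proof (rule wa_le_shift)
    have "k * (n * n) + (i * n + \<pi> i) < Suc k * (n * n)" using address_bound[OF that(2) pn[OF that(2)]] by simp
    also have "\<dots> \<le> d * (n * n)" using that by (intro mult_le_mono1) simp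
    finally show "k * (n * n) + (i * n + \<pi> i) < d * (n * n)" .
  qed
  have digit: "digit k < base" if "k < d" for k
  proof -
    have "digit k \<le> (\<Sum>i<n. 2 * shift)"
      unfolding digit_def using bound[OF that] by (intro sum_mono) (force simp: nat_le_iff)
    then show ?thesis by (simp add: base_def)
  qed
  have sum: "(\<Sum>i<n. code (i * n + \<pi> i)) = (\<Sum>k<d. digit k * base ^ k)"
    unfolding code_def digit_def sum_distrib_right by (rule sum.swap)
  show "(\<Sum>i<n. code (i * n + \<pi> i)) < codes"
    unfolding sum codes_def using digit by (rule digit_sum_less)
  have "int (digit k) - int (n * shift) = (\<Sum>e\<in>matching_of n \<pi>. w (Suc k) e)" if "k < d" for k
  proof -
    have "int (digit k) = (\<Sum>i<n. wa (k * (n * n) + (i * n + \<pi> i)) + int shift)"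
      unfolding digit_def of_nat_sum using bound[OF that] by (intro sum.cong) force+
    then show ?thesis using wa[OF that] pn by (simp add: sum.distrib sum_matching_of)
  qed
  then have "decoded (\<Sum>i<n. code (i * n + \<pi> i)) = map (\<lambda>k. \<Sum>e\<in>matching_of n \<pi>. w (Suc k) e) [0..<d]"
    unfolding decoded_def sum using digit by (intro map_cong) (auto simp: digit_sum_digit)
  then show "decoded (\<Sum>i<n. code (i * n + \<pi> i)) = weight_vector d w (matching_of n \<pi>)"
    by (simp add: weight_vector_def map_Suc_upt[symmetric] del: upt_Suc)
qed

end

section \<open>Polynomial bounds\<close>

definition polynomial1 :: "(nat \<Rightarrow> nat) \<Rightarrow> bool" where
  "polynomial1 g \<longleftrightarrow> (\<exists>p :: nat poly. \<forall>L. g L = poly p L)"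

lemma polynomial1_const: "polynomial1 (\<lambda>L. c)"
  unfolding polynomial1_def by (intro exI[of _ "[:c:]"]) simp

lemma polynomial1_id: "polynomial1 (\<lambda>L. L)"
  unfolding polynomial1_def by (intro exI[of _ "[:0, 1:]"]) simp

lemma polynomial1_add: "polynomial1 g \<Longrightarrow> polynomial1 h \<Longrightarrow> polynomial1 (\<lambda>L. g L + h L)"
  unfolding polynomial1_def by (metis poly_add)

lemma polynomial1_mult: "polynomial1 g \<Longrightarrow> polynomial1 h \<Longrightarrow> polynomial1 (\<lambda>L. g L * h L)"
  unfolding polynomial1_def by (metis poly_mult)

lemma polynomial1_instr_cost: "polynomial1 (\<lambda>L. instr_cost d L c)"
proof -
  note rules = polynomial1_const polynomial1_id polynomial1_add polynomial1_mult
  have size: "polynomial1 (\<lambda>L. size_bound L a)" for a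
    by (induction a) (simp_all add: rules)
  have acost: "polynomial1 (\<lambda>L. acost_bound L a)" for a
    by (induction a) (simp_all add: rules size)
  have bcost: "polynomial1 (\<lambda>L. bcost_bound L b)" for b
    by (induction b) (simp_all add: rules size acost polynomial1_add[OF polynomial1_const[of 1], simplified])
  show ?thesis
    by (induction c) (simp_all add: rules size acost bcost polynomial1_add[OF polynomial1_const[of 1], simplified])
qed

definition polynomial2 :: "(nat \<Rightarrow> nat \<Rightarrow> nat) \<Rightarrow> bool" where
  "polynomial2 g \<longleftrightarrow> (\<exists>p :: nat poly poly. \<forall>n m. g n m = poly (poly p [:n:]) m)"

lemma polynomial2_const: "polynomial2 (\<lambda>n m. c)"
  unfolding polynomial2_def by (intro exI[of _ "[:[:c:]:]"]) simp

lemma polynomial2_fst: "polynomial2 (\<lambda>n m. n)"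
  unfolding polynomial2_def by (intro exI[of _ "[:0, 1:]"]) simp

lemma polynomial2_snd: "polynomial2 (\<lambda>n m. m)"
  unfolding polynomial2_def by (intro exI[of _ "[:[:0, 1:]:]"]) simp

lemma polynomial2_add: "polynomial2 g \<Longrightarrow> polynomial2 h \<Longrightarrow> polynomial2 (\<lambda>n m. g n m + h n m)"
  unfolding polynomial2_def by (metis poly_add)

lemma polynomial2_mult: "polynomial2 g \<Longrightarrow> polynomial2 h \<Longrightarrow> polynomial2 (\<lambda>n m. g n m * h n m)"
  unfolding polynomial2_def by (metis poly_mult)

lemma polynomial2_power: "polynomial2 g \<Longrightarrow> polynomial2 (\<lambda>n m. g n m ^ k)"
  by (induction k) (simp_all add: polynomial2_const polynomial2_mult)

lemma polynomial2_compose: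
  assumes "polynomial1 q" "polynomial2 g"
  shows "polynomial2 (\<lambda>n m. q (g n m))"
proof -
  obtain p where "\<And>L. q L = poly p L" using assms(1) unfolding polynomial1_def by blast
  moreover have "polynomial2 (\<lambda>n m. poly p (g n m))"
    by (induction p) (simp_all add: polynomial2_const polynomial2_add polynomial2_mult assms(2))
  ultimately show ?thesis by simp
qed

lemmas polynomial2_intros = polynomial2_add polynomial2_mult polynomial2_power
  polynomial2_fst polynomial2_snd polynomial2_const

definition code_bound :: "nat \<Rightarrow> nat \<Rightarrow> nat \<Rightarrow> nat" where
  "code_bound d n m = (2 * (n * (d * (n * n) * (m * m))) + 1) ^ d"

text \<open>
  The number of bits of a memory cell. Two to the power of the last summand exceeds
  \<open>n * (2 * n * entry_bound) ^ n\<close>, since the radix is \<open>2 ^ (1 + 3 * (n * n))\<close>; the other summands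
  account for counters, codes and the input.
\<close>

definition bit_bound :: "nat \<Rightarrow> nat \<Rightarrow> nat \<Rightarrow> nat" where
  "bit_bound d n m = d * (n * n) + code_bound d n m + m
     + (n + (1 + n + 2 * n + (1 + 3 * (n * n)) * code_bound d n m) * n)"

lemma polynomial2_time:
  "polynomial2 (\<lambda>n m. main_steps d n (code_bound d n m) * instr_cost d (bit_bound d n m + 1) c)"
proof (rule polynomial2_mult)
  show "polynomial2 (\<lambda>n m. main_steps d n (code_bound d n m))"
    unfolding main_steps_def det_steps_def code_bound_def by (intro polynomial2_intros)
  have "polynomial2 (\<lambda>n m. bit_bound d n m + 1)"
    unfolding bit_bound_def code_bound_def by (intro polynomial2_intros)
  then show "polynomial2 (\<lambda>n m. instr_cost d (bit_bound d n m + 1) c)"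
    by (rule polynomial2_compose[OF polynomial1_instr_cost])
qed

section \<open>Correctness and running time on the input\<close>

definition input_weights :: "nat \<Rightarrow> weights \<Rightarrow> nat \<Rightarrow> int" where
  "input_weights n w m = w (m div (n * n) + 1) (m div n mod n + 1, m mod n + 1)"

lemma input_store_w: "m < d * (n * n) \<Longrightarrow> input_store d n w ''w'' (int m) = input_weights n w m"
  by (simp add: input_store_def input_weights_def mult.assoc Let_def flip: of_nat_mult)

lemma input_weights_address:
  assumes "i < n" "j < n"
  shows "input_weights n w (k * (n * n) + (i * n + j)) = w (Suc k) (Suc i, Suc j)"
proof -
  have a: "i * n + j < n * n" by (rule address_bound[OF assms])
  have divmod: "(q * N + x) div N = q" "(q * N + x) mod N = x" if "x < N" for q N x :: nat
    using that by simp_all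
  have eq: "k * (n * n) + (i * n + j) = (k * n + i) * n + j" by (simp add: algebra_simps)
  have "(k * (n * n) + (i * n + j)) div n = k * n + i" "(k * (n * n) + (i * n + j)) mod n = j"
    unfolding eq by (rule divmod[OF assms(2)])+
  moreover have "(k * (n * n) + (i * n + j)) div (n * n) = k" by (rule divmod(1)[OF a])
  ultimately show ?thesis using assms by (simp add: input_weights_def)
qed

lemma input_weights_le_max:
  assumes n: "1 \<le> n" and m: "m < d * (n * n)"
  shows "\<bar>input_weights n w m\<bar> \<le> int (max_weight d n w)"
proof -
  let ?S = "{nat \<bar>w k e\<bar> |k e. k \<in> {1..d} \<and> e \<in> edges n}"
  have "?S \<subseteq> (\<lambda>p. nat \<bar>w (fst p) (snd p)\<bar>) ` ({1..d} \<times> edges n)" by force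
  then have "finite ?S" by (rule finite_subset) (simp add: edges_def)
  moreover have "m div (n * n) < d" using m by (rule less_mult_imp_div_less)
  then have "nat \<bar>input_weights n w m\<bar> \<in> ?S"
    using n unfolding input_weights_def edges_def
    by (intro CollectI exI conjI refl) (auto simp: Suc_le_eq)
  ultimately have "nat \<bar>input_weights n w m\<bar> \<le> max_weight d n w"
    unfolding max_weight_def by (rule Max_ge)
  then show ?thesis by linarith
qed

text \<open>
  The program works with the sum of the squares of the weights, whereas the time bound refers to
  the largest weight; the second claim relates the two.
\<close>

lemma sized_input:
  fixes w :: weights
  assumes n: "1 \<le> n" and d: "1 \<le> d"
  defines "m \<equiv> max_weight d n w"
  shows "sized_matching_program d (2 ^ bit_bound d n m) n (input_weights n w)"
    and "matching_program.codes d n (input_weights n w) \<le> code_bound d n m"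
    and "\<bar>input_store d n w x a\<bar> < 2 ^ bit_bound d n m"
proof -
  define T where "T = code_bound d n m"
  define L where "L = bit_bound d n m"
  have L: "L = d * (n * n) + T + m + (n + (1 + n + 2 * n + (1 + 3 * (n * n)) * T) * n)"
    by (simp add: L_def T_def bit_bound_def)
  \<comment> \<open>a quantity that occurs as a summand of the exponent is small enough\<close>
  have small: "int x < 2 ^ L" if "x \<le> L" for x
  proof -
    have "x < 2 ^ x" by (rule less_exp)
    also have "(2 :: nat) ^ x \<le> 2 ^ L" using that by (intro power_increasing) auto
    finally show ?thesis by (metis of_nat_less_iff of_nat_numeral of_nat_power)
  qed
  interpret bounded_machine d "\<lambda>_ _. True" "2 ^ L"
    by unfold_locales (use n L in \<open>auto intro!: one_less_power\<close>)
  interpret matching_program d "\<lambda>_ _. True" "2 ^ L" n "input_weights n w"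
    by unfold_locales (use n d in auto)
  have "(\<Sum>a<d * (n * n). input_weights n w a * input_weights n w a) \<le> (\<Sum>a<d * (n * n). int m * int m)"
  proof (rule sum_mono)
    fix a assume "a \<in> {..<d * (n * n)}"
    then have "\<bar>input_weights n w a\<bar> \<le> int m" using input_weights_le_max[OF n] by (simp add: m_def)
    then have "\<bar>input_weights n w a\<bar> * \<bar>input_weights n w a\<bar> \<le> int m * int m" by (intro mult_mono) auto
    then show "input_weights n w a * input_weights n w a \<le> int m * int m" by simp
  qed
  then have "int shift \<le> int (d * (n * n) * (m * m))" by (simp add: shift_def sum_nonneg)
  then have "shift \<le> d * (n * n) * (m * m)" by (simp only: of_nat_le_iff)
  then have "base \<le> 2 * (n * (d * (n * n) * (m * m))) + 1"
    unfolding base_def by (intro add_mono mult_le_mono2) auto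
  then have codes: "codes \<le> T" unfolding codes_def T_def code_bound_def by (rule power_mono) simp
  then show "codes \<le> code_bound d n m" by (simp add: T_def)
  have "n * (2 * n * entry_bound) ^ n < 2 ^ L"
  proof -
    have "n * (2 * n * entry_bound) ^ n \<le> n * (2 ^ (1 + n + 2 * n + (1 + 3 * (n * n)) * T)) ^ n"
    proof (intro mult_le_mono2 power_mono)
      have "radix = 2 ^ (1 + 3 * (n * n))" by (simp add: radix_def power_mult)
      then have "radix ^ codes = 2 ^ ((1 + 3 * (n * n)) * codes)" by (simp only: power_mult)
      also have "\<dots> \<le> 2 ^ ((1 + 3 * (n * n)) * T)" using codes by (intro power_increasing mult_le_mono2) auto
      finally have "entry_bound \<le> 2 ^ (2 * n) * 2 ^ ((1 + 3 * (n * n)) * T)"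
        unfolding entry_bound_def by (simp add: power_mult)
      then have "2 * n * entry_bound \<le> 2 * 2 ^ n * (2 ^ (2 * n) * 2 ^ ((1 + 3 * (n * n)) * T))"
        using less_exp[of n] by (intro mult_le_mono) auto
      also have "\<dots> = 2 ^ (1 + n + 2 * n + (1 + 3 * (n * n)) * T)" by (simp only: power_add power_one_right mult.assoc)
      finally show "2 * n * entry_bound \<le> 2 ^ (1 + n + 2 * n + (1 + 3 * (n * n)) * T)" .
    qed simp
    also have "\<dots> < 2 ^ n * (2 ^ (1 + n + 2 * n + (1 + 3 * (n * n)) * T)) ^ n"
      by (intro mult_less_mono1 less_exp) simp
    also have "\<dots> = 2 ^ (n + (1 + n + 2 * n + (1 + 3 * (n * n)) * T) * n)"
      by (simp only: power_add power_mult)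
    also have "\<dots> \<le> 2 ^ L" unfolding L by (intro power_increasing) auto
    finally show ?thesis .
  qed
  then have "int (n * (2 * n * entry_bound) ^ n) < 2 ^ L" by (metis of_nat_less_iff of_nat_numeral of_nat_power)
  then show "sized_matching_program d (2 ^ bit_bound d n m) n (input_weights n w)"
    unfolding L_def[symmetric]
  proof unfold_locales
    show "int (d * (n * n)) < 2 ^ L" by (rule small) (simp add: L)
    show "int codes < 2 ^ L" by (rule small) (use codes L in linarith)
  qed
  show "\<bar>input_store d n w x a\<bar> < 2 ^ bit_bound d n m"
  proof (cases "x = ''w'' \<and> 0 \<le> a \<and> a < int (d * n * n)")
    case True
    then have a: "a = int (nat a)" "nat a < d * (n * n)" by (auto simp: nat_less_iff mult.assoc)
    then have "input_store d n w x a = input_weights n w (nat a)"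
      using True input_store_w[OF a(2)] by simp
    moreover have "int m < 2 ^ L" by (rule small) (simp add: L)
    ultimately show ?thesis using input_weights_le_max[OF n a(2), of w] unfolding m_def L_def by linarith
  next
    case False
    have "int n < 2 ^ L" by (rule small) (simp add: L)
    then show ?thesis using False by (auto simp: input_store_def L_def)
  qed
qed

lemma main_com_correct:
  fixes F :: "int list \<Rightarrow> real" and w :: weights
  assumes n: "1 \<le> n" and d: "1 \<le> d"
    and F: "\<And>a b. (if maximize then comparison_oracle f a b else comparison_oracle f b a) \<longleftrightarrow> F a \<le> F b"
  defines "m \<equiv> max_weight d n w"
  shows "\<exists>t M. halts_with d (main_com maximize d) n w f r t M
      \<and> t \<le> main_steps d n (code_bound d n m) * instr_cost d (bit_bound d n m + 1) (main_com maximize d)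
      \<and> perfect_matching n M
      \<and> (\<forall>\<pi>. \<pi> permutes {0..<n} \<longrightarrow>
           signed_sum n (matching_program.code d n (input_weights n w)) (\<lambda>i j. True)
             (\<Sum>i<n. matching_program.code d n (input_weights n w) (i * n + \<pi> i))
             (\<lambda>a. int (bits_value (2 * n) (sdrop (a * (2 * n)) r))) \<noteq> 0 \<longrightarrow>
           F (weight_vector d w (matching_of n \<pi>)) \<le> F (weight_vector d w M))"
proof -
  define L where "L = bit_bound d n m"
  interpret sized_matching_program d "comparison_oracle f" "2 ^ L" n "input_weights n w"
    unfolding L_def m_def by (rule sized_input[OF n d])
  have "wp (main_com maximize d) (input_store d n w) r (main_steps d n codes)
    (\<lambda>s' r'. \<exists>\<pi>. \<pi> permutes {0..<n} \<and> output_edges n s' = matching_of n \<pi>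
      \<and> (\<forall>t<codes. feasible (\<lambda>a. int (bits_value (2 * n) (sdrop (a * (2 * n)) r))) t
          \<longrightarrow> F (decoded t) \<le> F (decoded (\<Sum>i<n. code (i * n + \<pi> i)))))"
    by (rule wp_main[OF F]) (use input_store_w[of _ d n w] in \<open>auto simp: input_store_def\<close>)
  then obtain k s' r' \<pi> where k: "k \<le> main_steps d n codes"
      "bexec d (comparison_oracle f) (2 ^ L) (main_com maximize d) (input_store d n w, r) k (s', r')"
    and \<pi>: "\<pi> permutes {0..<n}" "output_edges n s' = matching_of n \<pi>"
      "\<And>t. t < codes \<Longrightarrow> feasible (\<lambda>a. int (bits_value (2 * n) (sdrop (a * (2 * n)) r))) t
          \<Longrightarrow> F (decoded t) \<le> F (decoded (\<Sum>i<n. code (i * n + \<pi> i)))"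
    unfolding wp_def by blast
  have "\<forall>x a. \<bar>fst (input_store d n w, r) x a\<bar> < 2 ^ L"
    unfolding L_def m_def using sized_input(3)[OF n d] by simp
  from bexec_imp_exec[OF k(2) this] obtain t where t: "t \<le> k * instr_cost d (Suc L) (main_com maximize d)"
      "exec d (comparison_oracle f) (main_com maximize d) (input_store d n w, r) t (s', r')" by blast
  have "main_steps d n codes \<le> main_steps d n (code_bound d n m)"
    using sized_input(2)[OF n d, of w] unfolding main_steps_def m_def by (intro add_mono mult_le_mono) auto
  with k(1) t(1) have "t \<le> main_steps d n (code_bound d n m) * instr_cost d (bit_bound d n m + 1) (main_com maximize d)"
    unfolding L_def by (metis Suc_eq_plus1 le_trans mult_le_mono1)
  moreover have "halts_with d (main_com maximize d) n w f r t (matching_of n \<pi>)"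
    unfolding halts_with_def using t(2) \<pi>(2) by blast
  moreover have "F (weight_vector d w (matching_of n \<rho>)) \<le> F (weight_vector d w (matching_of n \<pi>))"
    if "\<rho> permutes {0..<n}"
      "feasible (\<lambda>a. int (bits_value (2 * n) (sdrop (a * (2 * n)) r))) (\<Sum>i<n. code (i * n + \<rho> i))" for \<rho>
    using \<pi>(3)[OF decoded_matching(1)[OF that(1) input_weights_address] that(2)]
      decoded_matching(2)[OF that(1) input_weights_address] decoded_matching(2)[OF \<pi>(1) input_weights_address]
    by simp
  ultimately show ?thesis using perfect_matching_of[OF \<pi>(1)] by blast
qed

text \<open>
  Fix an optimal matching \<open>\<rho>\<close>. Whenever the coefficient at the code of \<open>\<rho>\<close> does not vanish, the
  output is at least as good as \<open>\<rho>\<close>, hence optimal. The error is thus bounded by the probability of a single event, and no union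
  over the codes is taken.
\<close>

lemma main_com_solves:
  fixes F :: "(real list \<Rightarrow> real) \<Rightarrow> int list \<Rightarrow> real"
  assumes d: "1 \<le> d"
    and F: "\<And>f a b. (if maximize then comparison_oracle f a b else comparison_oracle f b a) \<longleftrightarrow> F f a \<le> F f b"
    and optimal: "\<And>n w f M. perfect_matching n M \<Longrightarrow>
      (\<And>M'. perfect_matching n M' \<Longrightarrow> F f (weight_vector d w M') \<le> F f (weight_vector d w M)) \<Longrightarrow> optimal n w f M"
  shows "solves_in_polynomial_oracle_time d optimal (main_com maximize d)"
proof -
  obtain p :: "nat poly poly" where p: "\<And>n m. main_steps d n (code_bound d n m)
      * instr_cost d (bit_bound d n m + 1) (main_com maximize d) = poly (poly p [:n:]) m"
    using polynomial2_time unfolding polynomial2_def by blast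
  show ?thesis
    unfolding solves_in_polynomial_oracle_time_def
  proof (intro exI[of _ p] allI impI conjI)
    fix n :: nat and w :: weights and f :: "real list \<Rightarrow> real" and r :: "bool stream"
    assume n: "1 \<le> n"
    show "\<exists>t M. halts_with d (main_com maximize d) n w f r t M
        \<and> t \<le> poly (poly p [:n:]) (max_weight d n w) \<and> perfect_matching n M"
      using main_com_correct[OF n d F, where w = w and r = r] unfolding p by blast
  next
    fix n :: nat and w :: weights and f :: "real list \<Rightarrow> real"
    assume n: "1 \<le> n"
    let ?value = "\<lambda>\<pi>. F f (weight_vector d w (matching_of n \<pi>))"
    obtain \<rho> where \<rho>: "\<rho> permutes {0..<n}" "\<And>\<pi>. \<pi> permutes {0..<n} \<Longrightarrow> ?value \<pi> \<le> ?value \<rho>"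
    proof -
      have fin: "finite {\<pi>. \<pi> permutes {0..<n}}" by (rule finite_permutations) simp
      have "id \<in> {\<pi>. \<pi> permutes {0..<n}}" by (simp add: permutes_id)
      then have "Max (?value ` {\<pi>. \<pi> permutes {0..<n}}) \<in> ?value ` {\<pi>. \<pi> permutes {0..<n}}"
        by (intro Max_in finite_imageI[OF fin]) blast
      then obtain \<rho> where "\<rho> permutes {0..<n}" "?value \<rho> = Max (?value ` {\<pi>. \<pi> permutes {0..<n}})" by auto
      then show ?thesis using fin by (intro that) auto
    qed
    define u where "u = matching_program.code d n (input_weights n w)"
    define bad where "bad r \<longleftrightarrow> signed_sum n u (\<lambda>i j. True) (\<Sum>i<n. u (i * n + \<rho> i))
        (\<lambda>a. int (bits_value (2 * n) (sdrop (a * (2 * n)) r))) = 0" for r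
    define succeeds where "succeeds r \<longleftrightarrow> (\<exists>t M. halts_with d (main_com maximize d) n w f r t M \<and> optimal n w f M)" for r
    have succeeds: "succeeds r" if "\<not> bad r" for r
    proof -
      from main_com_correct[OF n d F, where w = w and r = r] obtain t M where M: "halts_with d (main_com maximize d) n w f r t M"
          "perfect_matching n M"
        and le: "\<And>\<pi>. \<pi> permutes {0..<n} \<Longrightarrow> signed_sum n u (\<lambda>i j. True) (\<Sum>i<n. u (i * n + \<pi> i))
            (\<lambda>a. int (bits_value (2 * n) (sdrop (a * (2 * n)) r))) \<noteq> 0 \<Longrightarrow> ?value \<pi> \<le> F f (weight_vector d w M)"
        unfolding u_def by blast
      have "?value \<rho> \<le> F f (weight_vector d w M)" using le[OF \<rho>(1)] that by (simp add: bad_def)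
      then have "F f (weight_vector d w M') \<le> F f (weight_vector d w M)" if "perfect_matching n M'" for M'
        using perfect_matching_imp_matching_of[OF that] \<rho>(2) by (metis order.trans)
      then have "optimal n w f M" by (rule optimal[OF M(2)])
      then show ?thesis using M(1) unfolding succeeds_def by blast
    qed
    interpret prob_space random_bits by (rule prob_space_random_bits)
    have "\<rho> \<in> selections n u (\<lambda>i j. True) (\<Sum>i<n. u (i * n + \<rho> i))"
      using \<rho>(1) by (simp add: selections_def)
    then have "prob {r. bad r} \<le> 1 / 2" unfolding bad_def by (rule prob_signed_sum_zero[OF n])
    moreover have "{r. bad r} \<in> events"
      unfolding bad_def by (intro finitary_sets finitary_signed_sum_zero)
    moreover have ev: "{r. succeeds r} \<in> events"
      unfolding succeeds_def by (intro finitary_sets finitary_halts)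
    moreover have "- {r. succeeds r} \<subseteq> {r. bad r}" using succeeds by blast
    ultimately have "prob (space random_bits - {r. succeeds r}) \<le> 1 / 2"
      using finite_measure_mono[of "- {r. succeeds r}" "{r. bad r}"] by (simp add: Compl_eq_Diff_UNIV)
    then show "1 / 2 \<le> measure random_bits {r \<in> space random_bits.
        \<exists>t M. halts_with d (main_com maximize d) n w f r t M \<and> optimal n w f M}"
      using prob_compl[OF ev] by (simp add: succeeds_def)
  qed
qed

theorem theorem1p2:
  fixes d :: nat
  assumes "d \<ge> 1"
  shows "(\<exists>c. solves_in_polynomial_oracle_time d (maximizer d) c)
       \<and> (\<exists>c. solves_in_polynomial_oracle_time d (minimizer d) c)"
proof
  have "solves_in_polynomial_oracle_time d (maximizer d) (main_com True d)"
    by (rule main_com_solves[OF assms, where F = "\<lambda>f y. f (map real_of_int y)"])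
       (auto simp: comparison_oracle_def maximizer_def is_arg_max_def objective_def not_less)
  then show "\<exists>c. solves_in_polynomial_oracle_time d (maximizer d) c" ..
  have "solves_in_polynomial_oracle_time d (minimizer d) (main_com False d)"
    by (rule main_com_solves[OF assms, where F = "\<lambda>f y. - f (map real_of_int y)"])
       (auto simp: comparison_oracle_def minimizer_def is_arg_min_def objective_def not_less)
  then show "\<exists>c. solves_in_polynomial_oracle_time d (minimizer d) c" ..
qed

end
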